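(* The expected amoeba measure $\mathbb{E}_d(\lambda)$ converges to the Lebesgue measure of $\mathbb{R}^2$ as $d$ grows to $+\infty$, in the sense of distributions.
   Context: For an integer $d\ge 1$, $H^0(\mathbb{CP}^2,L^d)$ is the space of homogeneous complex polynomials of degree $d$ in $X_0,X_1,X_2$, of dimension $N_d=(d+1)(d+2)/2$, with the Hermitian product for which distinct monomials are orthogonal and $\|X_0^{i_0}X_1^{i_1}X_2^{i_2}\|^2=\frac{2\,i_0!\,i_1!\,i_2!}{(d+2)!}$ when $i_0+i_1+i_2=d$, and with the Gaussian probability measure $\mu$ of density $\pi^{-N_d}e^{-\|P\|^2}$. $V_P=\{P=0\}\subset\mathbb{CP}^2$, $\mathbb{C}^2$ is identified with $\{X_0\neq0\}$ by $(z_1,z_2)\mapsto[1:z_1:z_2]$, $\mathrm{Log}(z_1,z_2)=(\ln|z_1|,\ln|z_2|)$ on $(\mathbb{C}^\times)^2$, and $\mathcal{A}(P)=\mathrm{Log}(V_P\cap(\mathbb{C}^\times)^2)$ is the amoeba. $\lambda_P$ is Lebesgue measure of $\mathbb{R}^2$ restricted to $\mathcal{A}(P)$: $\langle\lambda_P,\varphi\rangle=\int_{\mathcal{A}(P)}\varphi(t)|dt|$; the expected measure is $\mathbb{E}_d(\lambda)=\int\lambda_P\,d\mu(P)$. Convergence in the sense of distributions means $\langle\mathbb{E}_d(\lambda),\varphi\rangle\to\int_{\mathbb{R}^2}\varphi(t)|dt|$ for every compactly supported test function $\varphi$ on $\mathbb{R}^2$ (continuous test functions are allowed). *)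

theory Defs
  imports "HOL-Analysis.Analysis"
begin

text \<open>The coordinates \<open>X\<^sub>0, X\<^sub>1, X\<^sub>2\<close> are the components \<open>1, 2, 3\<close> of \<^typ>\<open>complex ^ 3\<close>.
  A homogeneous polynomial of degree \<open>d\<close> is its family of coefficients, indexed by the exponents
  of total degree \<open>d\<close> and extensional outside them, as in \<^const>\<open>Pi\<^sub>M\<close>.\<close>

definition exponents :: "nat \<Rightarrow> (nat ^ 3) set" where
  "exponents d = {\<alpha>. (\<Sum>k\<in>UNIV. \<alpha> $ k) = d}"

definition homogeneous_polys :: "nat \<Rightarrow> (nat ^ 3 \<Rightarrow> complex) set" where
  "homogeneous_polys d = exponents d \<rightarrow>\<^sub>E UNIV"

definition poly_eval :: "nat \<Rightarrow> (nat ^ 3 \<Rightarrow> complex) \<Rightarrow> complex ^ 3 \<Rightarrow> complex" where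
  "poly_eval d P x = (\<Sum>\<alpha>\<in>exponents d. P \<alpha> * (\<Prod>k\<in>UNIV. (x $ k) ^ (\<alpha> $ k)))"

definition dim_polys :: "nat \<Rightarrow> nat" where
  "dim_polys d = (d + 1) * (d + 2) div 2"

definition monomial_normsq :: "nat \<Rightarrow> nat ^ 3 \<Rightarrow> real" where
  "monomial_normsq d \<alpha> = 2 * (\<Prod>k\<in>UNIV. fact (\<alpha> $ k)) / fact (d + 2)"

definition herm_prod :: "nat \<Rightarrow> (nat ^ 3 \<Rightarrow> complex) \<Rightarrow> (nat ^ 3 \<Rightarrow> complex) \<Rightarrow> complex" where
  "herm_prod d P Q =
     (\<Sum>\<alpha>\<in>exponents d. P \<alpha> * cnj (Q \<alpha>) * complex_of_real (monomial_normsq d \<alpha>))"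

definition poly_normsq :: "nat \<Rightarrow> (nat ^ 3 \<Rightarrow> complex) \<Rightarrow> real" where
  "poly_normsq d P = Re (herm_prod d P P)"

text \<open>Lebesgue measure of the Hermitian space of polynomials: the image of the product Lebesgue
  measure under the isometry sending \<open>a\<close> to the polynomial with coordinates \<open>a\<close> in the orthonormal
  basis of the normalised monomials.\<close>

definition lebesgue_polys :: "nat \<Rightarrow> (nat ^ 3 \<Rightarrow> complex) measure" where
  "lebesgue_polys d =
     distr (\<Pi>\<^sub>M \<alpha>\<in>exponents d. lborel) (\<Pi>\<^sub>M \<alpha>\<in>exponents d. borel)
       (\<lambda>a. \<lambda>\<alpha>\<in>exponents d. a \<alpha> / complex_of_real (sqrt (monomial_normsq d \<alpha>)))"

definition gaussian_polys :: "nat \<Rightarrow> (nat ^ 3 \<Rightarrow> complex) measure" where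
  "gaussian_polys d =
     density (lebesgue_polys d) (\<lambda>P. ennreal (exp (- poly_normsq d P) / pi ^ dim_polys d))"

definition proj_rel :: "((complex ^ 3) \<times> (complex ^ 3)) set" where
  "proj_rel = {(x, y). x \<noteq> 0 \<and> y \<noteq> 0 \<and> (\<exists>c. y = c *s x)}"

definition CP2 :: "(complex ^ 3) set set" where
  "CP2 = (UNIV - {0}) // proj_rel"

definition zero_locus :: "nat \<Rightarrow> (nat ^ 3 \<Rightarrow> complex) \<Rightarrow> (complex ^ 3) set set" where
  "zero_locus d P = {p \<in> CP2. \<forall>x\<in>p. poly_eval d P x = 0}"

definition affine_chart :: "complex \<times> complex \<Rightarrow> (complex ^ 3) set" where
  "affine_chart z = proj_rel `` {vector [1, fst z, snd z]}"

definition complex_torus :: "(complex \<times> complex) set" where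
  "complex_torus = (UNIV - {0}) \<times> (UNIV - {0})"

definition Log_map :: "complex \<times> complex \<Rightarrow> real \<times> real" where
  "Log_map z = (ln (cmod (fst z)), ln (cmod (snd z)))"

definition amoeba :: "nat \<Rightarrow> (nat ^ 3 \<Rightarrow> complex) \<Rightarrow> (real \<times> real) set" where
  "amoeba d P = Log_map ` {z \<in> complex_torus. affine_chart z \<in> zero_locus d P}"

definition amoeba_measure :: "nat \<Rightarrow> (nat ^ 3 \<Rightarrow> complex) \<Rightarrow> (real \<times> real) measure" where
  "amoeba_measure d P = density lborel (indicator (amoeba d P))"

text \<open>The measure-valued integral of \<open>amoeba_measure d P\<close> over the random polynomial \<open>P\<close>,
  taken set by set.\<close>

definition expected_amoeba_measure :: "nat \<Rightarrow> (real \<times> real) measure" where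
  "expected_amoeba_measure d =
     measure_of UNIV (sets borel) (\<lambda>B. \<integral>\<^sup>+P. emeasure (amoeba_measure d P) B \<partial>gaussian_polys d)"

lemma space_gaussian_polys: "space (gaussian_polys d) = homogeneous_polys d"
  by (simp add: gaussian_polys_def lebesgue_polys_def homogeneous_polys_def space_PiM)

lemma equiv_proj_rel: "equiv (UNIV - {0}) proj_rel"
proof (rule equivI)
  show "proj_rel \<subseteq> (UNIV - {0}) \<times> (UNIV - {0})"
    by (auto simp: proj_rel_def)
  show "refl_on (UNIV - {0}) proj_rel"
    by (auto simp: refl_on_def proj_rel_def intro!: exI[of _ 1])
  show "sym proj_rel"
  proof (rule symI)
    fix x y assume "(x, y) \<in> proj_rel"
    then obtain c where c: "x \<noteq> 0" "y \<noteq> 0" "y = c *s x" by (auto simp: proj_rel_def)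
    then have "c \<noteq> 0" by auto
    then have "x = inverse c *s y" using c by (simp add: vector_smult_assoc)
    then show "(y, x) \<in> proj_rel" using c(1,2) unfolding proj_rel_def by blast
  qed
  show "trans proj_rel"
    by (rule transI) (auto simp: proj_rel_def vector_smult_assoc)
qed

lemma card_exponents: "card (exponents d) = dim_polys d"
proof -
  have "bij_betw (\<lambda>\<alpha>. (\<alpha> $ 1, \<alpha> $ 2)) (exponents d) (SIGMA i:{..d}. {..d - i})"
    by (rule bij_betw_byWitness[where f' = "\<lambda>(i, j). vector [i, j, d - i - j]"])
       (auto simp: exponents_def sum_3 vec_eq_iff forall_3)
  then have "card (exponents d) = card (SIGMA i:{..d}. {..d - i})"
    by (rule bij_betw_same_card)
  also have "\<dots> = (\<Sum>i\<le>d. Suc (d - i))" by simp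
  also have "\<dots> = (\<Sum>i\<le>d. Suc i)"
    by (rule sum.reindex_bij_witness[of _ "\<lambda>i. d - i" "\<lambda>i. d - i"]) auto
  also have "\<dots> = dim_polys d"
    unfolding dim_polys_def by (induction d) auto
  finally show ?thesis .
qed

end

theory Submission
  imports Defs "HOL-Probability.Probability" "HOL-Real_Asymp.Real_Asymp"
begin

text \<open>By Tonelli, the expected amoeba measure has density \<open>t \<mapsto> Pr (t \<in> amoeba d P)\<close>, so by
  dominated convergence it suffices that a random polynomial vanishes somewhere on the torus
  \<open>\<bar>X\<^sub>k\<bar> = r\<^sub>k\<close> with probability tending to one. On this torus the polynomial is, up to a
  constant, the trigonometric polynomial \<open>\<Sum> a\<^sub>\<alpha> w\<^sub>\<alpha> exp (i \<alpha>\<cdot>\<theta>)\<close> with independent standard Gaussians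
  \<open>a\<^sub>\<alpha>\<close> and multinomial probabilities \<open>w\<^sub>\<alpha>\<^sup>2\<close>. At scale \<open>1 / sqrt d\<close> around a point, its value and
  two suitable derivatives are uncorrelated of variance one, and if they fall into a small ball around
  \<open>(0, -i, 1)\<close> while the higher Taylor coefficients are not too large, Brouwer's theorem yields
  a zero. Correlations between the data at distinct fixed points tend to zero with \<open>d\<close>, so a
  second moment estimate over many points shows that this happens at one of them.\<close>

section \<open>Complex Gaussians\<close>

text \<open>At a single point the favourable event has a fixed but small probability, so the second
  moment estimate is useful only if every error is small against the square of that probability.
  This shapes the choices below. The event is replaced by a Gaussian bump: its expectation is a
  function of the Gram matrix of the functionals, so it passes to the limit with the covariances and
  no densities have to be compared. With N the scale of the admissible Taylor coefficients,
  Brouwer's theorem needs a ball of radius of order 1/N. A bump with sharpness \<open>\<tau>\<close>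
  = N^2 has mean at least of order N^(-12), whereas its values off the ball and the probability of
  too large Taylor coefficients are exponentially small in N. Hence exponential tails and a merely
  polynomial lower bound for the mean are enough. The parameters are chosen in the order N, number
  of points, d; the points are thus fixed while d grows, and no rate of decorrelation is
  needed.\<close>

definition complex_gaussian :: "complex measure" where
  "complex_gaussian = density lborel (\<lambda>z. ennreal (exp (- (cmod z)\<^sup>2) / pi))"

text \<open>The law of the real part of a standard complex Gaussian has variance 1/2, hence the
  factor 1/4 in the transforms below.\<close>

definition half_gaussian :: "real measure" where
  "half_gaussian = density lborel (normal_density 0 (1 / sqrt 2))"

lemma sets_complex_gaussian [simp, measurable_cong]: "sets complex_gaussian = sets borel"
  by (simp add: complex_gaussian_def)

lemma space_complex_gaussian [simp]: "space complex_gaussian = UNIV"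
  by (simp add: complex_gaussian_def)

lemma sets_half_gaussian [simp, measurable_cong]: "sets half_gaussian = sets borel"
  by (simp add: half_gaussian_def)

lemma prob_space_half_gaussian: "prob_space half_gaussian"
  unfolding half_gaussian_def by (rule prob_space_normal_density) simp

lemma measurable_Complex [measurable (raw)]:
  assumes [measurable]: "f \<in> borel_measurable M" "g \<in> borel_measurable M"
  shows "(\<lambda>x. Complex (f x) (g x)) \<in> borel_measurable M"
  unfolding Complex_eq by measurable

lemma lborel_complex: "lborel = distr (lborel \<Otimes>\<^sub>M lborel) borel (\<lambda>(x, y). Complex x y)"
proof (rule lborel_eqI)
  have m: "(\<lambda>(x, y). Complex x y) \<in> borel_measurable (lborel \<Otimes>\<^sub>M lborel)"
    by measurable
  fix l u :: complex assume lu: "\<And>b. b \<in> Basis \<Longrightarrow> l \<bullet> b \<le> u \<bullet> b"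
  have le: "Re l \<le> Re u" "Im l \<le> Im u"
    using lu[of 1] lu[of \<i>] by (auto simp: Basis_complex_def)
  have eq: "(\<lambda>(x, y). Complex x y) -` box l u \<inter> space (lborel \<Otimes>\<^sub>M lborel) = {Re l<..<Re u} \<times> {Im l<..<Im u}"
    by (auto simp: box_def Basis_complex_def space_pair_measure)
  show "emeasure (distr (lborel \<Otimes>\<^sub>M lborel) borel (\<lambda>(x, y). Complex x y)) (box l u) = (\<Prod>b\<in>Basis. (u - l) \<bullet> b)"
    using le by (subst emeasure_distr[OF m], simp, subst eq, subst lborel.emeasure_pair_measure_Times)
      (auto simp: Basis_complex_def ennreal_mult)
qed simp

lemma normal_density_half:
  "normal_density 0 (1 / sqrt 2) x = exp (- x\<^sup>2) / sqrt pi"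
  by (simp add: normal_density_def power_divide)

lemma complex_gaussian_eq:
  "complex_gaussian = distr (half_gaussian \<Otimes>\<^sub>M half_gaussian) borel (\<lambda>(x, y). Complex x y)"
proof -
  have m: "(\<lambda>(x, y). Complex x y) \<in> borel_measurable (lborel \<Otimes>\<^sub>M lborel)"
    by measurable
  interpret h: prob_space half_gaussian by (rule prob_space_half_gaussian)
  have "sigma_finite_measure (density lborel (\<lambda>x. ennreal (normal_density 0 (1 / sqrt 2) x)))"
    using h.sigma_finite_measure_axioms by (simp add: half_gaussian_def)
  then have "half_gaussian \<Otimes>\<^sub>M half_gaussian = density (lborel \<Otimes>\<^sub>M lborel)
     (\<lambda>(x, y). ennreal (normal_density 0 (1 / sqrt 2) x) * ennreal (normal_density 0 (1 / sqrt 2) y))"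
    unfolding half_gaussian_def by (intro pair_measure_density) (auto intro: lborel.sigma_finite_measure_axioms)
  moreover have "complex_gaussian = distr (density (lborel \<Otimes>\<^sub>M lborel)
     (\<lambda>p. ennreal (exp (- (cmod (Complex (fst p) (snd p)))\<^sup>2) / pi))) borel (\<lambda>(x, y). Complex x y)"
    unfolding complex_gaussian_def lborel_complex
    using m by (subst density_distr) (auto simp: case_prod_beta)
  moreover have "ennreal (exp (- (cmod (Complex x y))\<^sup>2) / pi) =
     ennreal (normal_density 0 (1 / sqrt 2) x) * ennreal (normal_density 0 (1 / sqrt 2) y)" for x y
    unfolding normal_density_half
    by (simp add: ennreal_mult[symmetric] cmod_def exp_add[symmetric])
  ultimately show ?thesis by (simp add: case_prod_beta')
qed

lemma prob_space_complex_gaussian: "prob_space complex_gaussian"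
proof -
  interpret h: prob_space half_gaussian by (rule prob_space_half_gaussian)
  interpret hh: pair_prob_space half_gaussian half_gaussian ..
  have "(\<lambda>(x, y). Complex x y) \<in> borel_measurable (half_gaussian \<Otimes>\<^sub>M half_gaussian)"
    by measurable
  then show ?thesis unfolding complex_gaussian_eq by (rule hh.prob_space_distr)
qed

lemma has_bochner_integral_complex_gaussian_prod:
  fixes f g :: "real \<Rightarrow> 'a :: {real_normed_field, banach, second_countable_topology}"
  assumes "integrable half_gaussian f" "integrable half_gaussian g"
  shows "has_bochner_integral complex_gaussian (\<lambda>z. f (Re z) * g (Im z))
           (integral\<^sup>L half_gaussian f * integral\<^sup>L half_gaussian g)"
proof -
  interpret h: prob_space half_gaussian by (rule prob_space_half_gaussian)
  interpret hh: pair_prob_space half_gaussian half_gaussian ..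
  have [measurable]: "f \<in> borel_measurable borel" "g \<in> borel_measurable borel"
    using assms[THEN borel_measurable_integrable] by auto
  have m: "(\<lambda>(x, y). Complex x y) \<in> borel_measurable (half_gaussian \<Otimes>\<^sub>M half_gaussian)"
    by measurable
  have i: "integrable (half_gaussian \<Otimes>\<^sub>M half_gaussian) (\<lambda>p. f (fst p) * g (snd p))"
    using assms by (intro hh.Fubini_integrable)
      (auto intro!: integrable_mult_left integrable_mult_right simp: norm_mult)
  have "(\<integral>p. f (fst p) * g (snd p) \<partial>(half_gaussian \<Otimes>\<^sub>M half_gaussian))
      = integral\<^sup>L half_gaussian f * integral\<^sup>L half_gaussian g"
    using hh.integral_fst'[of "\<lambda>p. f (fst p) * g (snd p)"] i assms by simp
  with i have "has_bochner_integral (half_gaussian \<Otimes>\<^sub>M half_gaussian) (\<lambda>p. f (fst p) * g (snd p))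
     (integral\<^sup>L half_gaussian f * integral\<^sup>L half_gaussian g)"
    by (simp add: has_bochner_integral_iff)
  then show ?thesis
    unfolding complex_gaussian_eq
    by (intro has_bochner_integral_distr m) (auto simp: case_prod_beta)
qed

lemma char_half_gaussian: "(\<integral>x. exp (\<i> * complex_of_real (s * x)) \<partial>half_gaussian) = complex_of_real (exp (- s\<^sup>2 / 4))"
proof -
  have "complex_of_real (exp (- (s / sqrt 2)\<^sup>2 / 2)) = (\<integral>x. exp (\<i> * complex_of_real (s / sqrt 2 * x)) \<partial>std_normal_distribution)"
    using fun_cong[OF char_std_normal_distribution, of "s / sqrt 2"] by (simp add: char_def exp_of_real)
  also have "\<dots> = (\<integral>x. std_normal_density x *\<^sub>R exp (\<i> * complex_of_real (s / sqrt 2 * x)) \<partial>lborel)"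
    by (subst integral_density) auto
  also have "\<dots> = sqrt 2 *\<^sub>R (\<integral>x. std_normal_density (sqrt 2 * x) *\<^sub>R exp (\<i> * complex_of_real (s / sqrt 2 * (sqrt 2 * x))) \<partial>lborel)"
    by (subst lborel_integral_real_affine[where c="sqrt 2" and t=0]) auto
  also have "\<dots> = (\<integral>x. (sqrt 2 * std_normal_density (sqrt 2 * x)) *\<^sub>R exp (\<i> * complex_of_real (s * x)) \<partial>lborel)"
    by (subst integral_scaleR_right[symmetric]) (simp)
  also have "\<dots> = (\<integral>x. exp (\<i> * complex_of_real (s * x)) \<partial>half_gaussian)"
    unfolding half_gaussian_def
    by (subst integral_density) (auto simp: normal_density_half std_normal_density_def power_mult_distrib real_sqrt_mult)
  finally show ?thesis by (simp add: power_divide)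
qed

text \<open>Completing the square: the weight \<open>exp (s * x)\<close> moves the mean of the
  density to \<open>s / 2\<close> and leaves the stated total mass.\<close>

lemma mgf_half_gaussian: "has_bochner_integral half_gaussian (\<lambda>x. exp (s * x)) (exp (s\<^sup>2 / 4))"
proof -
  have "normal_density 0 (1 / sqrt 2) x * exp (s * x) = exp (s\<^sup>2 / 4) * normal_density (s / 2) (1 / sqrt 2) x" for x
    unfolding normal_density_def
    by (simp add: power_divide exp_add[symmetric] power2_eq_square field_simps)
  moreover have "has_bochner_integral lborel (\<lambda>x. exp (s\<^sup>2 / 4) * normal_density (s / 2) (1 / sqrt 2) x) (exp (s\<^sup>2 / 4) * 1)"
    by (intro has_bochner_integral_mult_right) (simp add: has_bochner_integral_iff)
  ultimately show ?thesis
    unfolding half_gaussian_def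
    by (subst has_bochner_integral_density) auto
qed

lemma char_complex_gaussian:
  "(\<integral>z. exp (\<i> * complex_of_real (Re (z * c))) \<partial>complex_gaussian) = complex_of_real (exp (- (cmod c)\<^sup>2 / 4))"
proof -
  interpret h: prob_space half_gaussian by (rule prob_space_half_gaussian)
  have i: "integrable half_gaussian (\<lambda>x. exp (\<i> * complex_of_real (s * x)))" for s
    by (rule h.integrable_const_bound[where B=1]) auto
  have "exp (\<i> * complex_of_real (Re (z * c))) =
     exp (\<i> * complex_of_real (Re c * Re z)) * exp (\<i> * complex_of_real (- Im c * Im z))" for z
    by (simp add: exp_add[symmetric] algebra_simps)
  then have "(\<integral>z. exp (\<i> * complex_of_real (Re (z * c))) \<partial>complex_gaussian) =
    (\<integral>x. exp (\<i> * complex_of_real (Re c * x)) \<partial>half_gaussian) * (\<integral>x. exp (\<i> * complex_of_real (- Im c * x)) \<partial>half_gaussian)"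
    using has_bochner_integral_complex_gaussian_prod[OF i[of "Re c"] i[of "- Im c"]]
    by (simp only: has_bochner_integral_iff)
  then show ?thesis
    unfolding char_half_gaussian
    by (simp add: cmod_def exp_add[symmetric] flip: of_real_mult)
qed

lemma mgf_complex_gaussian:
  "has_bochner_integral complex_gaussian (\<lambda>z. exp (Re (z * c))) (exp ((cmod c)\<^sup>2 / 4))"
proof -
  have "exp (Re (z * c)) = exp (Re c * Re z) * exp (- Im c * Im z)" for z
    by (simp add: exp_add[symmetric] algebra_simps)
  moreover have "exp ((cmod c)\<^sup>2 / 4) = exp ((Re c)\<^sup>2 / 4) * exp ((- Im c)\<^sup>2 / 4)"
    by (simp add: cmod_def exp_add[symmetric] field_simps)
  ultimately show ?thesis
    using has_bochner_integral_complex_gaussian_prod[of "\<lambda>x. exp (Re c * x)" "\<lambda>x. exp (- Im c * x)"]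
      mgf_half_gaussian[of "Re c"] mgf_half_gaussian[of "- Im c"]
    by (simp add: has_bochner_integral_iff)
qed

section \<open>Families of independent Gaussians\<close>

definition iid_gaussian :: "'i set \<Rightarrow> ('i \<Rightarrow> complex) measure" where
  "iid_gaussian I = (\<Pi>\<^sub>M i\<in>I. complex_gaussian)"

lemma sets_iid_gaussian [measurable_cong]: "sets (iid_gaussian I) = sets (\<Pi>\<^sub>M i\<in>I. borel)"
  unfolding iid_gaussian_def by (intro sets_PiM_cong) auto

lemma prob_space_iid_gaussian: "prob_space (iid_gaussian I)"
  unfolding iid_gaussian_def by (intro prob_space_PiM prob_space_complex_gaussian)

lemma product_sigma_finite_complex_gaussian: "product_sigma_finite (\<lambda>_. complex_gaussian)"
  by (intro product_sigma_finite.intro prob_space_imp_sigma_finite prob_space_complex_gaussian)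

lemma char_iid_gaussian:
  assumes "finite I"
  shows "(\<integral>a. exp (\<i> * complex_of_real (Re (\<Sum>i\<in>I. a i * c i))) \<partial>iid_gaussian I)
           = complex_of_real (exp (- (\<Sum>i\<in>I. (cmod (c i))\<^sup>2) / 4))"
proof -
  interpret product_sigma_finite "\<lambda>_. complex_gaussian" by (rule product_sigma_finite_complex_gaussian)
  interpret p: prob_space complex_gaussian by (rule prob_space_complex_gaussian)
  have i: "integrable complex_gaussian (\<lambda>z. exp (\<i> * complex_of_real (Re (z * c i))))" for i
    by (rule p.integrable_const_bound[where B=1]) (simp, measurable)
  have "exp (\<i> * complex_of_real (Re (\<Sum>i\<in>I. a i * c i))) = (\<Prod>i\<in>I. exp (\<i> * complex_of_real (Re (a i * c i))))" for a
    by (simp only: Re_sum of_real_sum sum_distrib_left exp_sum[OF assms])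
  then have "(\<integral>a. exp (\<i> * complex_of_real (Re (\<Sum>i\<in>I. a i * c i))) \<partial>iid_gaussian I)
     = (\<Prod>i\<in>I. complex_of_real (exp (- (cmod (c i))\<^sup>2 / 4)))"
    unfolding iid_gaussian_def
    by (simp only: product_integral_prod[OF assms i] char_complex_gaussian)
  also have "\<dots> = complex_of_real (exp (- (\<Sum>i\<in>I. (cmod (c i))\<^sup>2) / 4))"
    using assms by (simp only: of_real_prod[symmetric] exp_sum[symmetric]) (simp add: sum_negf sum_divide_distrib)
  finally show ?thesis .
qed

lemma mgf_iid_gaussian:
  assumes "finite I"
  shows "has_bochner_integral (iid_gaussian I) (\<lambda>a. exp (Re (\<Sum>i\<in>I. a i * c i))) (exp ((\<Sum>i\<in>I. (cmod (c i))\<^sup>2) / 4))"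
proof -
  interpret product_sigma_finite "\<lambda>_. complex_gaussian" by (rule product_sigma_finite_complex_gaussian)
  have i: "integrable complex_gaussian (\<lambda>z. exp (Re (z * c i)))"
    "integral\<^sup>L complex_gaussian (\<lambda>z. exp (Re (z * c i))) = exp ((cmod (c i))\<^sup>2 / 4)" for i
    using mgf_complex_gaussian[of "c i"] by (auto simp: has_bochner_integral_iff)
  have e: "exp (Re (\<Sum>i\<in>I. a i * c i)) = (\<Prod>i\<in>I. exp (Re (a i * c i)))" for a
    by (simp only: Re_sum exp_sum[OF assms])
  show ?thesis
    unfolding iid_gaussian_def e has_bochner_integral_iff
    using product_integrable_prod[OF assms i(1)]
    by (simp only: product_integral_prod[OF assms i(1)] i(2) sum_divide_distrib exp_sum[OF assms])
qed

text \<open>Exponential Markov inequality in the four directions 1, -1, i, -i, one of which carries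
  at least half of the modulus. The tail is only exponential, not Gaussian, but it survives the
  later union bound over all Taylor coefficients.\<close>

lemma iid_gaussian_tail:
  assumes I: "finite I" and s: "0 < s" "(\<Sum>i\<in>I. (cmod (c i))\<^sup>2) \<le> s\<^sup>2"
  shows "measure (iid_gaussian I) {a \<in> space (iid_gaussian I). x \<le> cmod (\<Sum>i\<in>I. a i * c i)}
           \<le> 4 * exp (1 / 4) * exp (- x / (2 * s))"
proof -
  interpret prob_space "iid_gaussian I" by (rule prob_space_iid_gaussian)
  define E where "E u a = exp (Re (\<Sum>i\<in>I. a i * (u * c i / s)))" for u a
  have E_int: "integrable (iid_gaussian I) (E u)" "expectation (E u) \<le> exp (1 / 4)" if u: "cmod u = 1" for u
  proof -
    have "(\<Sum>i\<in>I. (cmod (u * c i / complex_of_real s))\<^sup>2) = (\<Sum>i\<in>I. (cmod (c i))\<^sup>2) / s\<^sup>2"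
      using u s by (simp add: norm_mult norm_divide power_divide sum_divide_distrib)
    also have "\<dots> \<le> 1" using s by (simp add: field_simps)
    finally have "exp ((\<Sum>i\<in>I. (cmod (u * c i / complex_of_real s))\<^sup>2) / 4) \<le> exp (1 / 4)" by simp
    with mgf_iid_gaussian[OF I, of "\<lambda>i. u * c i / complex_of_real s"]
    show "integrable (iid_gaussian I) (E u)" "expectation (E u) \<le> exp (1 / 4)"
      unfolding E_def has_bochner_integral_iff by auto
  qed
  have E_pos: "0 < E u a" for u a by (simp add: E_def)
  define S where "S a = E 1 a + E (-1) a + E \<i> a + E (-\<i>) a" for a
  have S_int: "integrable (iid_gaussian I) S" unfolding S_def using E_int(1) by auto
  have "expectation S = expectation (E 1) + expectation (E (-1)) + expectation (E \<i>) + expectation (E (-\<i>))"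
    unfolding S_def using E_int(1) by simp
  then have ES: "expectation S \<le> 4 * exp (1 / 4)"
    using E_int(2)[of 1] E_int(2)[of "-1"] E_int(2)[of \<i>] E_int(2)[of "-\<i>"] by simp
  have E_eq: "E u a = exp (Re (u * (\<Sum>i\<in>I. a i * c i)) / s)" for u a
  proof -
    have "(\<Sum>i\<in>I. a i * (u * c i / s)) = (u * (\<Sum>i\<in>I. a i * c i)) / s"
      by (simp add: sum_distrib_left sum_divide_distrib mult_ac)
    then show ?thesis unfolding E_def by simp
  qed
  have "measure (iid_gaussian I) {a \<in> space (iid_gaussian I). x \<le> cmod (\<Sum>i\<in>I. a i * c i)}
     \<le> measure (iid_gaussian I) {a \<in> space (iid_gaussian I). exp (x / (2 * s)) \<le> S a}"
  proof (rule finite_measure_mono)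
    show "{a \<in> space (iid_gaussian I). exp (x / (2 * s)) \<le> S a} \<in> events"
      using borel_measurable_integrable[OF S_int] by measurable
    show "{a \<in> space (iid_gaussian I). x \<le> cmod (\<Sum>i\<in>I. a i * c i)} \<subseteq> {a \<in> space (iid_gaussian I). exp (x / (2 * s)) \<le> S a}"
    proof clarsimp
      fix a assume x: "x \<le> cmod (\<Sum>i\<in>I. a i * c i)"
      let ?Y = "\<Sum>i\<in>I. a i * c i"
      have "x / 2 \<le> \<bar>Re ?Y\<bar> \<or> x / 2 \<le> \<bar>Im ?Y\<bar>" using cmod_le[of ?Y] x by linarith
      then have "x / 2 \<le> Re (1 * ?Y) \<or> x / 2 \<le> Re (-1 * ?Y) \<or> x / 2 \<le> Re (\<i> * ?Y) \<or> x / 2 \<le> Re (- \<i> * ?Y)"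
        by (auto simp: abs_if split: if_splits)
      then obtain u where u: "u \<in> {1, -1, \<i>, -\<i>}" "x / 2 \<le> Re (u * ?Y)" by blast
      have "exp (x / (2 * s)) \<le> E u a"
        unfolding E_eq using u(2) s(1) by (simp add: field_simps)
      also have "\<dots> \<le> S a"
        using u(1) E_pos[of 1 a] E_pos[of "-1" a] E_pos[of \<i> a] E_pos[of "-\<i>" a] unfolding S_def by auto
      finally show "exp (x / (2 * s)) \<le> S a" .
    qed
  qed
  also have "\<dots> \<le> expectation S / exp (x / (2 * s))"
    by (rule integral_Markov_inequality_measure[OF S_int, where A="{}"])
      (auto simp: S_def E_def intro!: AE_I2 add_nonneg_nonneg)
  also have "\<dots> \<le> 4 * exp (1 / 4) / exp (x / (2 * s))"
    using ES by (intro divide_right_mono) auto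
  finally show ?thesis by (simp add: exp_minus field_simps)
qed

text \<open>A smooth substitute for the indicator of the event that all the linear functionals with
  coefficient vectors \<open>v k\<close> are near \<open>c k\<close>. Unlike the indicator, it is
  itself the Fourier transform of a Gaussian.\<close>

definition gauss_bump :: "'i set \<Rightarrow> 'k set \<Rightarrow> ('k \<Rightarrow> 'i \<Rightarrow> complex) \<Rightarrow> ('k \<Rightarrow> complex) \<Rightarrow> ('i \<Rightarrow> complex) \<Rightarrow> real" where
  "gauss_bump I K v c a = exp (- (\<Sum>k\<in>K. (cmod ((\<Sum>i\<in>I. a i * v k i) - c k))\<^sup>2))"

lemma gauss_bump_measurable [measurable]: "gauss_bump I K v c \<in> borel_measurable (iid_gaussian I)"
  unfolding gauss_bump_def[abs_def] by measurable

lemma gauss_bump_bounds: "0 < gauss_bump I K v c a" "gauss_bump I K v c a \<le> 1"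
  by (auto simp: gauss_bump_def intro!: sum_nonneg)

text \<open>Writing the bump as the characteristic function of an auxiliary Gaussian \<open>g\<close> makes its
  expectation depend on the family \<open>v\<close> only through its Gram matrix.\<close>

lemma gauss_bump_fourier:
  assumes I: "finite I" and K: "finite K"
  shows "complex_of_real (\<integral>a. gauss_bump I K v c a \<partial>iid_gaussian I) =
    (\<integral>g. exp (- 2 * \<i> * complex_of_real (Re (\<Sum>k\<in>K. g k * c k))) *
       complex_of_real (exp (- Re (\<Sum>k\<in>K. \<Sum>l\<in>K. g k * cnj (g l) * (\<Sum>i\<in>I. v k i * cnj (v l i))))) \<partial>iid_gaussian K)"
proof -
  interpret pI: prob_space "iid_gaussian I" by (rule prob_space_iid_gaussian)
  interpret pK: prob_space "iid_gaussian K" by (rule prob_space_iid_gaussian)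
  interpret pair_prob_space "iid_gaussian I" "iid_gaussian K" ..
  \<comment> \<open>The factor 2 compensates the 1/4 in the characteristic function: exp (- |2w|^2 /
    4) = exp (- |w|^2).\<close>
  define H where "H a g = exp (\<i> * complex_of_real (Re (\<Sum>k\<in>K. g k * (2 * ((\<Sum>i\<in>I. a i * v k i) - c k)))))" for a g
  have H1: "complex_of_real (gauss_bump I K v c a) = (\<integral>g. H a g \<partial>iid_gaussian K)" for a
    unfolding H_def char_iid_gaussian[OF K] gauss_bump_def norm_mult power_mult_distrib sum_distrib_left[symmetric]
    by simp
  have H2: "(\<integral>a. H a g \<partial>iid_gaussian I) = exp (- 2 * \<i> * complex_of_real (Re (\<Sum>k\<in>K. g k * c k))) *
       complex_of_real (exp (- Re (\<Sum>k\<in>K. \<Sum>l\<in>K. g k * cnj (g l) * (\<Sum>i\<in>I. v k i * cnj (v l i)))))" for g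
  proof -
    have split: "exp (\<i> * complex_of_real (Re (x - 2 * z))) =
        exp (- 2 * \<i> * complex_of_real (Re z)) * exp (\<i> * complex_of_real (Re x))" for x z
      by (simp add: exp_add[symmetric] algebra_simps)
    have "(\<Sum>k\<in>K. g k * (2 * ((\<Sum>i\<in>I. a i * v k i) - c k))) =
       (\<Sum>i\<in>I. a i * (2 * (\<Sum>k\<in>K. g k * v k i))) - 2 * (\<Sum>k\<in>K. g k * c k)" for a
    proof -
      have "(\<Sum>k\<in>K. g k * (\<Sum>i\<in>I. a i * v k i)) = (\<Sum>i\<in>I. a i * (\<Sum>k\<in>K. g k * v k i))"
        unfolding sum_distrib_left by (subst sum.swap) (simp add: mult_ac)
      then show ?thesis
        by (simp add: right_diff_distrib sum_subtractf mult.left_commute[of _ 2] sum_distrib_left[symmetric])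
    qed
    then have "H a g = exp (- 2 * \<i> * complex_of_real (Re (\<Sum>k\<in>K. g k * c k))) *
        exp (\<i> * complex_of_real (Re (\<Sum>i\<in>I. a i * (2 * (\<Sum>k\<in>K. g k * v k i)))))" for a
      unfolding H_def by (simp only: split)
    then have "(\<integral>a. H a g \<partial>iid_gaussian I) = exp (- 2 * \<i> * complex_of_real (Re (\<Sum>k\<in>K. g k * c k))) *
       complex_of_real (exp (- (\<Sum>i\<in>I. (cmod (2 * (\<Sum>k\<in>K. g k * v k i)))\<^sup>2) / 4))"
      by (simp only: integral_mult_right_zero char_iid_gaussian[OF I])
    moreover have "(\<Sum>i\<in>I. (cmod (2 * (\<Sum>k\<in>K. g k * v k i)))\<^sup>2) / 4 =
       Re (\<Sum>k\<in>K. \<Sum>l\<in>K. g k * cnj (g l) * (\<Sum>i\<in>I. v k i * cnj (v l i)))"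
    proof -
      have "(\<Sum>i\<in>I. (cmod (2 * (\<Sum>k\<in>K. g k * v k i)))\<^sup>2) / 4 = (\<Sum>i\<in>I. (cmod (\<Sum>k\<in>K. g k * v k i))\<^sup>2)"
        by (simp add: norm_mult power_mult_distrib sum_distrib_left[symmetric])
      also have "\<dots> = Re (\<Sum>i\<in>I. (\<Sum>k\<in>K. g k * v k i) * cnj (\<Sum>k\<in>K. g k * v k i))"
        by (simp only: complex_norm_square[symmetric] Re_sum Re_complex_of_real)
      also have "(\<Sum>i\<in>I. (\<Sum>k\<in>K. g k * v k i) * cnj (\<Sum>k\<in>K. g k * v k i)) =
         (\<Sum>i\<in>I. \<Sum>k\<in>K. \<Sum>l\<in>K. g k * cnj (g l) * (v k i * cnj (v l i)))"
        by (simp add: sum_product mult_ac)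
      also have "\<dots> = (\<Sum>k\<in>K. \<Sum>l\<in>K. \<Sum>i\<in>I. g k * cnj (g l) * (v k i * cnj (v l i)))"
        by (subst sum.swap, intro sum.cong refl, rule sum.swap)
      finally show ?thesis by (simp only: sum_distrib_left)
    qed
    ultimately show ?thesis by simp
  qed
  have [measurable]: "(\<lambda>p. H (fst p) (snd p)) \<in> borel_measurable (iid_gaussian I \<Otimes>\<^sub>M iid_gaussian K)"
    unfolding H_def by measurable
  have "integrable (iid_gaussian I \<Otimes>\<^sub>M iid_gaussian K) (\<lambda>p. H (fst p) (snd p))"
    by (rule P.integrable_const_bound[where B=1]) (auto simp: H_def)
  then have "(\<integral>g. (\<integral>a. H a g \<partial>iid_gaussian I) \<partial>iid_gaussian K) = (\<integral>a. (\<integral>g. H a g \<partial>iid_gaussian K) \<partial>iid_gaussian I)"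
    by (intro Fubini_integral) (simp add: case_prod_beta')
  then show ?thesis unfolding H2 H1[symmetric] by simp
qed

text \<open>In the Fourier formula only the Gram matrix depends on \<open>d\<close>, and the
  integrand stays in the unit disc because Gram matrices are positive semidefinite; dominated
  convergence applies. The limit family may live on a different index set, since only its Gram
  matrix matters.\<close>

lemma gauss_bump_tendsto:
  assumes I: "\<And>d. finite (I d)" and J: "finite J" and K: "finite K"
    and gram: "\<And>k l. k \<in> K \<Longrightarrow> l \<in> K \<Longrightarrow>
      (\<lambda>d. \<Sum>i\<in>I d. v d k i * cnj (v d l i)) \<longlonglongrightarrow> (\<Sum>j\<in>J. u k j * cnj (u l j))"
  shows "(\<lambda>d. \<integral>a. gauss_bump (I d) K (v d) c a \<partial>iid_gaussian (I d)) \<longlonglongrightarrow> (\<integral>a. gauss_bump J K u c a \<partial>iid_gaussian J)"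
proof -
  interpret pK: prob_space "iid_gaussian K" by (rule prob_space_iid_gaussian)
  have [measurable]: "cnj \<in> borel_measurable borel"
    by (intro borel_measurable_continuous_onI continuous_intros)
  have m: "(\<lambda>g. exp (- 2 * \<i> * complex_of_real (Re (\<Sum>k\<in>K. g k * c k))) *
       complex_of_real (exp (- Re (\<Sum>k\<in>K. \<Sum>l\<in>K. g k * cnj (g l) * w k l)))) \<in> borel_measurable (iid_gaussian K)" for w
  proof -
    have [measurable]: "(\<lambda>g. cnj (g l)) \<in> borel_measurable (iid_gaussian K)" if "l \<in> K" for l
      using that by (intro measurable_compose[of "\<lambda>g. g l" _ borel cnj]) measurable
    show ?thesis by measurable
  qed
  have nn: "0 \<le> Re (\<Sum>k\<in>K. \<Sum>l\<in>K. g k * cnj (g l) * (\<Sum>i\<in>I d. v d k i * cnj (v d l i)))" for g d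
  proof -
    have "(\<Sum>k\<in>K. \<Sum>l\<in>K. g k * cnj (g l) * (\<Sum>i\<in>I d. v d k i * cnj (v d l i))) =
       (\<Sum>k\<in>K. \<Sum>l\<in>K. \<Sum>i\<in>I d. g k * cnj (g l) * (v d k i * cnj (v d l i)))"
      by (simp only: sum_distrib_left)
    also have "\<dots> = (\<Sum>i\<in>I d. \<Sum>k\<in>K. \<Sum>l\<in>K. g k * cnj (g l) * (v d k i * cnj (v d l i)))"
      by (subst (2) sum.swap, intro sum.cong refl, rule sum.swap)
    also have "\<dots> = (\<Sum>i\<in>I d. (\<Sum>k\<in>K. g k * v d k i) * cnj (\<Sum>k\<in>K. g k * v d k i))"
      by (simp add: sum_product mult_ac)
    also have "Re \<dots> \<ge> 0"
      unfolding complex_norm_square[symmetric] Re_sum by (intro sum_nonneg) (simp flip: of_real_power)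
    finally show ?thesis .
  qed
  have "(\<lambda>d. complex_of_real (\<integral>a. gauss_bump (I d) K (v d) c a \<partial>iid_gaussian (I d)))
     \<longlonglongrightarrow> complex_of_real (\<integral>a. gauss_bump J K u c a \<partial>iid_gaussian J)"
    unfolding gauss_bump_fourier[OF I K] gauss_bump_fourier[OF J K]
  proof (rule integral_dominated_convergence[where w="\<lambda>_. 1"])
    show "AE g in iid_gaussian K. (\<lambda>d. exp (- 2 * \<i> * complex_of_real (Re (\<Sum>k\<in>K. g k * c k))) *
       complex_of_real (exp (- Re (\<Sum>k\<in>K. \<Sum>l\<in>K. g k * cnj (g l) * (\<Sum>i\<in>I d. v d k i * cnj (v d l i))))))
       \<longlonglongrightarrow> exp (- 2 * \<i> * complex_of_real (Re (\<Sum>k\<in>K. g k * c k))) *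
       complex_of_real (exp (- Re (\<Sum>k\<in>K. \<Sum>l\<in>K. g k * cnj (g l) * (\<Sum>i\<in>J. u k i * cnj (u l i)))))"
      by (intro AE_I2 tendsto_intros gram)
    show "AE g in iid_gaussian K. cmod (exp (- 2 * \<i> * complex_of_real (Re (\<Sum>k\<in>K. g k * c k))) *
       complex_of_real (exp (- Re (\<Sum>k\<in>K. \<Sum>l\<in>K. g k * cnj (g l) * (\<Sum>i\<in>I d. v d k i * cnj (v d l i)))))) \<le> 1" for d
      using nn by (intro AE_I2) (simp add: norm_mult)
  qed (simp_all only: m, simp)
  then show ?thesis by (simp only: tendsto_of_real_iff)
qed

lemma integral_gauss_bump_diagonal:
  fixes \<tau> :: real and K :: "'k set"
  assumes K: "finite K"
  shows "(\<integral>a. gauss_bump K K (\<lambda>k i. if i = k then of_real \<tau> else 0) c a \<partial>iid_gaussian K)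
    = (\<Prod>k\<in>K. \<integral>z. exp (- (cmod (\<tau> * z - c k))\<^sup>2) \<partial>complex_gaussian)"
proof -
  interpret product_sigma_finite "\<lambda>_. complex_gaussian" by (rule product_sigma_finite_complex_gaussian)
  interpret p: prob_space complex_gaussian by (rule prob_space_complex_gaussian)
  have i: "integrable complex_gaussian (\<lambda>z. exp (- (cmod (\<tau> * z - c k))\<^sup>2))" for k
    by (rule p.integrable_const_bound[where B=1]) (simp, measurable)
  have "gauss_bump K K (\<lambda>k i. if i = k then of_real \<tau> else 0) c a = (\<Prod>k\<in>K. exp (- (cmod (\<tau> * a k - c k))\<^sup>2))" for a :: "'k \<Rightarrow> complex"
    using K unfolding gauss_bump_def
    by (simp add: exp_sum[symmetric] sum_negf if_distrib[of "\<lambda>x. _ * x"] mult.commute cong: if_cong)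
  then show ?thesis
    unfolding iid_gaussian_def by (simp only: product_integral_prod[OF K i])
qed

text \<open>Both exponents are bounded on the square of side 1/\<open>\<tau>\<close> with corner
  \<open>b\<close>, so the area of this square gives the bound. What matters later is that the loss
  is polynomial in \<open>\<tau>\<close>.\<close>

lemma integral_bump_lower_bound:
  fixes \<tau> :: real and b :: complex
  assumes \<tau>: "1 \<le> \<tau>"
  shows "exp (- 2 - (cmod b + 2)\<^sup>2) / \<tau>\<^sup>2 / pi \<le> (\<integral>z. exp (- (cmod (\<tau> * z - \<tau> * b))\<^sup>2) \<partial>complex_gaussian)"
proof -
  let ?B = "cbox b (b + Complex (1/\<tau>) (1/\<tau>))"
  let ?C = "exp (- 2 - (cmod b + 2)\<^sup>2) / pi"
  interpret p: prob_space complex_gaussian by (rule prob_space_complex_gaussian)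
  have i: "integrable complex_gaussian (\<lambda>z. exp (- (cmod (\<tau> * z - \<tau> * b))\<^sup>2))"
    by (rule p.integrable_const_bound[where B=1]) (simp, measurable)
  then have i': "integrable lborel (\<lambda>z::complex. exp (- (cmod z)\<^sup>2) / pi * exp (- (cmod (\<tau> * z - \<tau> * b))\<^sup>2))"
    unfolding complex_gaussian_def by (subst (asm) integrable_density) auto
  have eq: "(\<integral>z. exp (- (cmod (\<tau> * z - \<tau> * b))\<^sup>2) \<partial>complex_gaussian) =
     integral\<^sup>L lborel (\<lambda>z::complex. exp (- (cmod z)\<^sup>2) / pi * exp (- (cmod (\<tau> * z - \<tau> * b))\<^sup>2))"
    unfolding complex_gaussian_def by (subst integral_density) auto
  have m: "measure lborel ?B = 1 / \<tau>\<^sup>2"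
    using \<tau> by (subst measure_lborel_cbox_eq) (auto simp: Basis_complex_def power2_eq_square)
  have "?C * (1 / \<tau>\<^sup>2) = (\<integral>z. ?C * indicator ?B z \<partial>lborel)"
    using m by simp
  also have "\<dots> \<le> integral\<^sup>L lborel (\<lambda>z::complex. exp (- (cmod z)\<^sup>2) / pi * exp (- (cmod (\<tau> * z - \<tau> * b))\<^sup>2))"
  proof (rule integral_mono)
    show "integrable lborel (\<lambda>z. ?C * indicator ?B z)"
      by (intro integrable_mult_right integrable_real_indicator emeasure_bounded_finite bounded_cbox) simp
    show "integrable lborel (\<lambda>z::complex. exp (- (cmod z)\<^sup>2) / pi * exp (- (cmod (\<tau> * z - \<tau> * b))\<^sup>2))" by (rule i')
    fix z :: complex
    show "?C * indicator ?B z \<le> exp (- (cmod z)\<^sup>2) / pi * exp (- (cmod (\<tau> * z - \<tau> * b))\<^sup>2)"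
    proof (cases "z \<in> ?B")
      case True
      then have r: "0 \<le> Re (z - b)" "Re (z - b) \<le> 1 / \<tau>" "0 \<le> Im (z - b)" "Im (z - b) \<le> 1 / \<tau>"
        by (auto simp: cbox_def Basis_complex_def)
      have zb: "(cmod (z - b))\<^sup>2 \<le> 2 / \<tau>\<^sup>2"
      proof -
        have "(Re (z - b))\<^sup>2 \<le> (1 / \<tau>)\<^sup>2" "(Im (z - b))\<^sup>2 \<le> (1 / \<tau>)\<^sup>2"
          using r by (auto intro!: power_mono simp del: minus_complex.sel)
        then show ?thesis unfolding cmod_power2 by (simp add: power_divide)
      qed
      have "cmod (\<tau> * z - \<tau> * b) = \<tau> * cmod (z - b)"
        using \<tau> by (simp add: right_diff_distrib[symmetric] norm_mult)
      then have "(cmod (\<tau> * z - \<tau> * b))\<^sup>2 = \<tau>\<^sup>2 * (cmod (z - b))\<^sup>2" by (simp add: power_mult_distrib)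
      also have "\<dots> \<le> \<tau>\<^sup>2 * (2 / \<tau>\<^sup>2)" using zb by (intro mult_left_mono) auto
      also have "\<dots> = 2" using \<tau> by simp
      finally have 1: "(cmod (\<tau> * z - \<tau> * b))\<^sup>2 \<le> 2" .
      have "2 / \<tau>\<^sup>2 \<le> 2 / 1" using one_le_power[OF \<tau>, of 2] by (intro divide_left_mono) auto
      then have "2 / \<tau>\<^sup>2 \<le> 2\<^sup>2" by simp
      then have "cmod (z - b) \<le> 2" using zb power2_le_imp_le[of "cmod (z - b)" 2] by linarith
      then have "cmod z \<le> cmod b + 2" using norm_triangle_ineq2[of z b] by linarith
      then have 2: "(cmod z)\<^sup>2 \<le> (cmod b + 2)\<^sup>2" by (intro power_mono) auto
      have "exp (- 2 - (cmod b + 2)\<^sup>2) \<le> exp (- (cmod z)\<^sup>2) * exp (- (cmod (\<tau> * z - \<tau> * b))\<^sup>2)"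
        unfolding exp_add[symmetric] exp_le_cancel_iff using 1 2 by linarith
      then show ?thesis using True by (simp add: field_simps)
    qed simp
  qed
  finally show ?thesis unfolding eq by (simp add: field_simps)
qed

section \<open>Zeros of exponential sums\<close>

text \<open>The \<open>Y k l\<close> are, up to powers of i and factorials, the Taylor coefficients
  at 0. The values -i and 1 for the two of order one make the linear part equal to \<open>s\<close>.
  The constant term, the two linear errors and the remainder each cost at most
  \<open>\<rho> / 4\<close>, so \<open>s\<close> minus the sum maps the disc of radius
  \<open>\<rho>\<close> into itself, and a fixed point is a zero. The sum is not holomorphic in
  \<open>s\<close>, which is why a topological fixed point theorem is used.\<close>

lemma exp_sum_has_zero:
  fixes I :: "'i set" and c :: "'i \<Rightarrow> complex" and x y :: "'i \<Rightarrow> real"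
  defines "Y \<equiv> (\<lambda>k l. \<Sum>i\<in>I. c i * complex_of_real (x i ^ k * y i ^ l))"
  assumes \<rho>: "0 < \<rho>" "\<rho> \<le> 1 / 16" and K: "0 \<le> K" "512 * K * \<rho> \<le> 1"
    and bound: "\<And>k l. cmod (Y k l) \<le> K * 4 ^ (k + l) * fact k * fact l"
    and Y00: "cmod (Y 0 0) \<le> \<rho> / 4"
    and Y10: "cmod (Y 1 0 + \<i>) \<le> 1 / 4"
    and Y01: "cmod (Y 0 1 - 1) \<le> 1 / 4"
  shows "\<exists>s. (\<Sum>i\<in>I. c i * exp (\<i> * complex_of_real (x i * Re s + y i * Im s))) = 0"
proof -
  define F where "F s = (\<Sum>i\<in>I. c i * exp (\<i> * complex_of_real (x i * Re s + y i * Im s)))" for s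
  define T where "T n s = (\<Sum>i\<in>I. c i * ((\<i> * complex_of_real (x i * Re s + y i * Im s)) ^ n /\<^sub>R fact n))" for n s
  have sumsT: "(\<lambda>n. T n s) sums F s" for s
    unfolding T_def F_def by (intro sums_sum sums_mult exp_converges)
  have T_eq: "T n s = \<i> ^ n * (\<Sum>k\<le>n. Y k (n - k) * complex_of_real (Re s ^ k * Im s ^ (n - k) / (fact k * fact (n - k))))" for n s
  proof -
    have e: "(x i * Re s + y i * Im s) ^ n / fact n
      = (\<Sum>k\<le>n. x i ^ k * y i ^ (n - k) * (Re s ^ k * Im s ^ (n - k) / (fact k * fact (n - k))))" for i
      unfolding binomial_ring sum_divide_distrib
      by (intro sum.cong refl) (simp add: binomial_fact power_mult_distrib field_simps)
    have "T n s = \<i> ^ n * (\<Sum>i\<in>I. c i * complex_of_real ((x i * Re s + y i * Im s) ^ n / fact n))"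
      unfolding T_def sum_distrib_left
      by (intro sum.cong refl) (simp add: power_mult_distrib scaleR_conv_of_real divide_inverse mult_ac)
    also have "(\<Sum>i\<in>I. c i * complex_of_real ((x i * Re s + y i * Im s) ^ n / fact n))
      = (\<Sum>i\<in>I. \<Sum>k\<le>n. c i * complex_of_real (x i ^ k * y i ^ (n - k)) * complex_of_real (Re s ^ k * Im s ^ (n - k) / (fact k * fact (n - k))))"
      unfolding e by (simp add: sum_distrib_left mult.assoc)
    also have "\<dots> = (\<Sum>k\<le>n. Y k (n - k) * complex_of_real (Re s ^ k * Im s ^ (n - k) / (fact k * fact (n - k))))"
      unfolding Y_def by (subst sum.swap) (simp only: sum_distrib_right)
    finally show ?thesis .
  qed
  have T_bound: "cmod (T n s) \<le> K * (8 * \<rho>) ^ n" if s: "cmod s \<le> \<rho>" for n s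
  proof -
    have "cmod (T n s) \<le> (\<Sum>k\<le>n. cmod (Y k (n - k) * complex_of_real (Re s ^ k * Im s ^ (n - k) / (fact k * fact (n - k)))))"
      unfolding T_eq by (simp add: norm_mult norm_power sum_norm_le)
    also have "\<dots> \<le> (\<Sum>k\<le>n. K * (4 * \<rho>) ^ n)"
    proof (rule sum_mono)
      fix k assume "k \<in> {..n}"
      then have kn: "k + (n - k) = n" by auto
      have r: "\<bar>Re s\<bar> ^ k * \<bar>Im s\<bar> ^ (n - k) \<le> \<rho> ^ k * \<rho> ^ (n - k)"
        using abs_Re_le_cmod[of s] abs_Im_le_cmod[of s] s by (intro mult_mono power_mono) auto
      have "cmod (Y k (n - k) * complex_of_real (Re s ^ k * Im s ^ (n - k) / (fact k * fact (n - k))))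
         = cmod (Y k (n - k)) * (\<bar>Re s\<bar> ^ k * \<bar>Im s\<bar> ^ (n - k) / (fact k * fact (n - k)))"
        unfolding norm_mult norm_of_real by (simp add: abs_mult power_abs)
      also have "\<dots> \<le> (K * 4 ^ (k + (n - k)) * fact k * fact (n - k)) * (\<rho> ^ k * \<rho> ^ (n - k) / (fact k * fact (n - k)))"
        using K by (intro mult_mono[OF bound divide_right_mono[OF r]]) auto
      also have "\<dots> = K * 4 ^ (k + (n - k)) * \<rho> ^ (k + (n - k))"
        by (simp add: power_add)
      also have "\<dots> = K * (4 * \<rho>) ^ n" unfolding kn by (simp add: power_mult_distrib)
      finally show "cmod (Y k (n - k) * complex_of_real (Re s ^ k * Im s ^ (n - k) / (fact k * fact (n - k)))) \<le> K * (4 * \<rho>) ^ n" .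
    qed
    also have "\<dots> = real (Suc n) * (K * (4 * \<rho>) ^ n)" by simp
    \<comment> \<open>The n + 1 monomials of degree n are absorbed by doubling the ratio from
      4\<open>\<rho>\<close> to 8\<open>\<rho>\<close>, which is still at most 1/2.\<close>
    also have "\<dots> \<le> 2 ^ n * (K * (4 * \<rho>) ^ n)"
    proof (rule mult_right_mono)
      have "Suc n \<le> 2 ^ n" using less_exp[of n] by linarith
      then show "real (Suc n) \<le> 2 ^ n" by (metis of_nat_le_iff of_nat_numeral of_nat_power)
    qed (use K \<rho> in auto)
    also have "\<dots> = K * (8 * \<rho>) ^ n" 
    proof -
      have "(8::real) ^ n = 2 ^ n * 4 ^ n" by (simp flip: power_mult_distrib)
      then show ?thesis by (simp add: power_mult_distrib)
    qed
    finally show ?thesis .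
  qed
  have rem: "cmod (F s - T 0 s - T 1 s) \<le> \<rho> / 4" if s: "cmod s \<le> \<rho>" for s
  proof -
    have "(\<lambda>n. T (n + 2) s) sums (F s - (\<Sum>i<2. T i s))"
      using sumsT by (rule sums_split_initial_segment)
    then have sm: "(\<lambda>n. T (n + 2) s) sums (F s - T 0 s - T 1 s)"
      by (simp add: numeral_2_eq_2 diff_diff_eq)
    have g: "(\<lambda>n. K * (8 * \<rho>) ^ (n + 2)) sums (K * (8 * \<rho>)\<^sup>2 * (1 / (1 - 8 * \<rho>)))"
      using sums_mult[OF geometric_sums[of "8 * \<rho>"], of "K * (8 * \<rho>)\<^sup>2"] \<rho>
      by (simp add: power_add power2_eq_square mult_ac)
    have "cmod (F s - T 0 s - T 1 s) \<le> K * (8 * \<rho>)\<^sup>2 * (1 / (1 - 8 * \<rho>))"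
      by (rule norm_sums_le[OF sm g]) (rule T_bound[OF s])
    also have "\<dots> \<le> K * (8 * \<rho>)\<^sup>2 * 2"
      using \<rho> K by (intro mult_left_mono) (auto simp: field_simps)
    \<comment> \<open>Origin of the constant 512: the quadratic remainder is at most 2 * 64 * K *
      \<open>\<rho>\<close>^2 and has to stay below \<open>\<rho> / 4\<close>.\<close>
    also have "\<dots> = (512 * K * \<rho>) * \<rho> / 4" by (simp add: power2_eq_square)
    also have "\<dots> \<le> 1 * \<rho> / 4"
      using \<rho> K by (intro divide_right_mono mult_right_mono) auto
    finally show ?thesis by simp
  qed
  have T0: "T 0 s = Y 0 0" for s unfolding T_eq by simp
  have T1: "T 1 s = s + (\<i> * (Y 1 0 + \<i>)) * Re s + (\<i> * (Y 0 1 - 1)) * Im s" for s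
    unfolding T_eq by (simp add: complex_eq_iff) (simp add: algebra_simps)
  have close: "cmod (s - F s) \<le> \<rho>" if s: "cmod s \<le> \<rho>" for s
  proof -
    have eq: "s - F s = - (F s - T 0 s - T 1 s) - Y 0 0 - (\<i> * (Y 1 0 + \<i>)) * Re s - (\<i> * (Y 0 1 - 1)) * Im s"
      unfolding T1 T0 by simp
    have "cmod (s - F s) \<le> cmod (F s - T 0 s - T 1 s) + cmod (Y 0 0) + cmod ((\<i> * (Y 1 0 + \<i>)) * Re s) + cmod ((\<i> * (Y 0 1 - 1)) * Im s)"
      using norm_triangle_ineq4[of "- (F s - T 0 s - T 1 s)" "Y 0 0"]
        norm_triangle_ineq4[of "- (F s - T 0 s - T 1 s) - Y 0 0" "(\<i> * (Y 1 0 + \<i>)) * Re s"]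
        norm_triangle_ineq4[of "- (F s - T 0 s - T 1 s) - Y 0 0 - (\<i> * (Y 1 0 + \<i>)) * Re s" "(\<i> * (Y 0 1 - 1)) * Im s"]
      unfolding norm_minus_cancel arg_cong[OF eq, of cmod] by linarith
    also have "\<dots> \<le> \<rho> / 4 + \<rho> / 4 + 1 / 4 * \<rho> + 1 / 4 * \<rho>"
    proof (intro add_mono rem[OF s] Y00)
      show "cmod ((\<i> * (Y 1 0 + \<i>)) * Re s) \<le> 1 / 4 * \<rho>"
        unfolding norm_mult norm_of_real using Y10 abs_Re_le_cmod[of s] s by (intro mult_mono) auto
      show "cmod ((\<i> * (Y 0 1 - 1)) * Im s) \<le> 1 / 4 * \<rho>"
        unfolding norm_mult norm_of_real using Y01 abs_Im_le_cmod[of s] s by (intro mult_mono) auto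
    qed
    finally show ?thesis by simp
  qed
  have "continuous_on (cball 0 \<rho>) (\<lambda>s. s - F s)"
    unfolding F_def by (intro continuous_intros)
  then obtain s where "s - F s = s"
    using brouwer[of "cball 0 \<rho>" "\<lambda>s. s - F s"] close \<rho> by auto
  then show ?thesis unfolding F_def by (intro exI[of _ s]) simp
qed

section \<open>Multinomial sums\<close>

lemma finite_exponents: "finite (exponents d)"
  using card_exponents[of d] by (intro card_ge_0_finite) (simp add: dim_polys_def)

definition multinom_sum :: "nat \<Rightarrow> (3 \<Rightarrow> complex) \<Rightarrow> (nat ^ 3 \<Rightarrow> complex) \<Rightarrow> complex" where
  "multinom_sum d q g = (\<Sum>\<alpha>\<in>exponents d. fact d / (\<Prod>k\<in>UNIV. fact (\<alpha> $ k)) * (\<Prod>k\<in>UNIV. q k ^ (\<alpha> $ k)) * g \<alpha>)"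

definition lin_form :: "(3 \<Rightarrow> complex) \<Rightarrow> nat ^ 3 \<Rightarrow> complex" where
  "lin_form y \<alpha> = (\<Sum>k\<in>UNIV. of_nat (\<alpha> $ k) * y k)"

lemma lin_form_add_axis: "lin_form y (\<alpha> + axis k 1) = lin_form y \<alpha> + y k"
  unfolding lin_form_def
  by (simp add: axis_def distrib_right sum.distrib if_distrib[of of_nat] if_distrib[of "\<lambda>x. x * _"] cong: if_cong)

lemma multinom_sum_add:
  "multinom_sum d q (\<lambda>\<alpha>. f \<alpha> + g \<alpha>) = multinom_sum d q f + multinom_sum d q g"
  by (simp add: multinom_sum_def distrib_left sum.distrib)

lemma multinom_sum_cmult: "multinom_sum d q (\<lambda>\<alpha>. c * f \<alpha>) = c * multinom_sum d q f"
  by (simp add: multinom_sum_def sum_distrib_left mult_ac)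

lemma multinom_sum_0: "multinom_sum 0 q g = g 0"
proof -
  have "exponents 0 = {0}" by (auto simp: exponents_def vec_eq_iff)
  then show ?thesis by (simp add: multinom_sum_def)
qed

text \<open>The law of a multinomial variable is that of a sum of \<open>d\<close> independent steps; this is the
  removal of one step.\<close>

lemma multinom_sum_Suc:
  "multinom_sum (Suc d) q g = (\<Sum>k\<in>UNIV. q k * multinom_sum d q (\<lambda>\<alpha>. g (\<alpha> + axis k 1)))"
proof -
  define T where "T \<alpha> = 1 / (\<Prod>k\<in>UNIV. fact (\<alpha> $ k)) * (\<Prod>k\<in>UNIV. q k ^ (\<alpha> $ k)) * g \<alpha>" for \<alpha> :: "nat ^ 3"
  have step: "(\<Sum>\<alpha>\<in>exponents (Suc d). of_nat (\<alpha> $ k) * fact d * T \<alpha>)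
      = q k * multinom_sum d q (\<lambda>\<alpha>. g (\<alpha> + axis k 1))" for k
  proof -
    have "(\<Sum>\<alpha>\<in>exponents (Suc d). of_nat (\<alpha> $ k) * fact d * T \<alpha>)
       = (\<Sum>\<alpha>\<in>{\<alpha>\<in>exponents (Suc d). \<alpha> $ k \<noteq> 0}. of_nat (\<alpha> $ k) * fact d * T \<alpha>)"
      by (rule sum.mono_neutral_right) (auto simp: finite_exponents)
    also have "\<dots> = (\<Sum>\<beta>\<in>exponents d. of_nat ((\<beta> + axis k 1) $ k) * fact d * T (\<beta> + axis k 1))"
    proof (rule sum.reindex_bij_witness[of _ "\<lambda>\<beta>. \<beta> + axis k 1" "\<lambda>\<alpha>. \<alpha> - axis k 1"])
      fix \<alpha> :: "nat ^ 3" assume a: "\<alpha> \<in> {\<alpha>\<in>exponents (Suc d). \<alpha> $ k \<noteq> 0}"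
      then show eq: "\<alpha> - axis k 1 + axis k 1 = \<alpha>"
        by (auto simp: vec_eq_iff axis_def)
      have "(\<Sum>j\<in>UNIV. (\<alpha> - axis k 1) $ j) + 1 = (\<Sum>j\<in>UNIV. (\<alpha> - axis k 1 + axis k 1) $ j)"
        by (simp add: axis_def sum.distrib)
      then show "\<alpha> - axis k 1 \<in> exponents d"
        using a unfolding eq by (simp add: exponents_def)
      show "of_nat ((\<alpha> - axis k 1 + axis k 1) $ k) * fact d * T (\<alpha> - axis k 1 + axis k 1) = of_nat (\<alpha> $ k) * fact d * T \<alpha>"
        unfolding eq ..
    next
      fix \<beta> :: "nat ^ 3" assume "\<beta> \<in> exponents d"
      then show "\<beta> + axis k 1 \<in> {\<alpha>\<in>exponents (Suc d). \<alpha> $ k \<noteq> 0}"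
        by (simp add: exponents_def axis_def sum.distrib)
      show "\<beta> + axis k 1 - axis k 1 = \<beta>" by (simp add: vec_eq_iff)
    qed
    also have "\<dots> = q k * multinom_sum d q (\<lambda>\<alpha>. g (\<alpha> + axis k 1))"
      unfolding multinom_sum_def sum_distrib_left
    proof (rule sum.cong[OF refl])
      fix \<beta> :: "nat ^ 3"
      have sp: "(\<Prod>j\<in>UNIV. h j ((\<beta> + axis k 1) $ j)) = h k (Suc (\<beta> $ k)) * (\<Prod>j\<in>UNIV - {k}. h j (\<beta> $ j))"
        "(\<Prod>j\<in>UNIV. h j (\<beta> $ j)) = h k (\<beta> $ k) * (\<Prod>j\<in>UNIV - {k}. h j (\<beta> $ j))" for h :: "3 \<Rightarrow> nat \<Rightarrow> complex"
        by (auto simp: prod.remove[of UNIV k] axis_def intro!: prod.cong)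
      have nz: "of_nat (Suc (\<beta> $ k)) \<noteq> (0::complex)" by (simp only: of_nat_eq_0_iff)
      show "of_nat ((\<beta> + axis k 1) $ k) * fact d * T (\<beta> + axis k 1)
        = q k * (fact d / (\<Prod>k\<in>UNIV. fact (\<beta> $ k)) * (\<Prod>k\<in>UNIV. q k ^ (\<beta> $ k)) * g (\<beta> + axis k 1))"
        unfolding T_def sp[of "\<lambda>_. fact"] sp[of "\<lambda>k n. q k ^ n"]
        using nz by (simp add: axis_def field_simps del: of_nat_Suc)
    qed
    finally show ?thesis .
  qed
  \<comment> \<open>As the exponents add up to d + 1, the factor \<open>fact (Suc d)\<close> splits
    into the shares \<alpha>_k * d!, one per coordinate; \<open>step\<close> then removes one unit
    from coordinate k.\<close>
  have "multinom_sum (Suc d) q g = (\<Sum>\<alpha>\<in>exponents (Suc d). \<Sum>k\<in>UNIV. of_nat (\<alpha> $ k) * fact d * T \<alpha>)"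
    unfolding multinom_sum_def
  proof (rule sum.cong[OF refl])
    fix \<alpha> :: "nat ^ 3" assume "\<alpha> \<in> exponents (Suc d)"
    then have "(\<Sum>k\<in>UNIV. of_nat (\<alpha> $ k)) = (of_nat (Suc d) :: complex)"
      unfolding exponents_def mem_Collect_eq by (metis of_nat_sum)
    then have "(\<Sum>k\<in>UNIV. of_nat (\<alpha> $ k) * fact d * T \<alpha>) = of_nat (Suc d) * fact d * T \<alpha>"
      by (simp only: sum_distrib_right[symmetric])
    then show "fact (Suc d) / (\<Prod>k\<in>UNIV. fact (\<alpha> $ k)) * (\<Prod>k\<in>UNIV. q k ^ (\<alpha> $ k)) * g \<alpha> = (\<Sum>k\<in>UNIV. of_nat (\<alpha> $ k) * fact d * T \<alpha>)"
      by (simp add: T_def)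
  qed
  also have "\<dots> = (\<Sum>k\<in>UNIV. \<Sum>\<alpha>\<in>exponents (Suc d). of_nat (\<alpha> $ k) * fact d * T \<alpha>)"
    by (rule sum.swap)
  finally show ?thesis unfolding step .
qed

lemma multinom_sum_one: "multinom_sum d q (\<lambda>_. 1) = (\<Sum>k\<in>UNIV. q k) ^ d"
  by (induction d) (simp_all add: multinom_sum_0 multinom_sum_Suc sum_distrib_right)

lemma multinom_sum_lin_form:
  "multinom_sum d q (lin_form y) = of_nat d * (\<Sum>k\<in>UNIV. q k * y k) * (\<Sum>k\<in>UNIV. q k) ^ (d - 1)"
proof (induction d)
  case 0
  then show ?case by (simp add: multinom_sum_0 lin_form_def)
next
  case (Suc d)
  let ?S = "\<Sum>k\<in>UNIV. q k" and ?A = "\<Sum>k\<in>UNIV. q k * y k"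
  have "multinom_sum (Suc d) q (lin_form y) = (\<Sum>k\<in>UNIV. q k * (multinom_sum d q (lin_form y) + y k * ?S ^ d))"
    unfolding multinom_sum_Suc lin_form_add_axis multinom_sum_add multinom_sum_one[symmetric] multinom_sum_cmult[symmetric]
    by simp
  also have "\<dots> = ?S * multinom_sum d q (lin_form y) + ?A * ?S ^ d"
    by (simp add: distrib_left sum.distrib sum_distrib_left sum_distrib_right mult_ac)
  also have "\<dots> = of_nat (Suc d) * ?A * ?S ^ d"
    unfolding Suc by (cases d) (simp_all add: algebra_simps)
  finally show ?case by simp
qed

text \<open>The first term counts pairs of distinct steps, the second a step paired with itself. The
  exponents \<open>d - 1\<close> and \<open>d - 2\<close> are truncated only where the factor in
  front vanishes.\<close>

lemma multinom_sum_lin_form2: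
  "multinom_sum d q (\<lambda>\<alpha>. lin_form y \<alpha> * lin_form z \<alpha>) =
     of_nat d * of_nat (d - 1) * (\<Sum>k\<in>UNIV. q k * y k) * (\<Sum>k\<in>UNIV. q k * z k) * (\<Sum>k\<in>UNIV. q k) ^ (d - 2)
     + of_nat d * (\<Sum>k\<in>UNIV. q k * y k * z k) * (\<Sum>k\<in>UNIV. q k) ^ (d - 1)"
proof (induction d)
  case 0
  then show ?case by (simp add: multinom_sum_0 lin_form_def)
next
  case (Suc d)
  let ?S = "\<Sum>k\<in>UNIV. q k" and ?A = "\<Sum>k\<in>UNIV. q k * y k" and ?B = "\<Sum>k\<in>UNIV. q k * z k"
  let ?C = "\<Sum>k\<in>UNIV. q k * y k * z k"
  have e: "lin_form y (\<alpha> + axis k 1) * lin_form z (\<alpha> + axis k 1) =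
     (lin_form y \<alpha> * lin_form z \<alpha> + (z k * lin_form y \<alpha> + y k * lin_form z \<alpha>)) + (y k * z k) * 1" for \<alpha> k
    unfolding lin_form_add_axis by (simp add: algebra_simps)
  have "multinom_sum (Suc d) q (\<lambda>\<alpha>. lin_form y \<alpha> * lin_form z \<alpha>) =
    (\<Sum>k\<in>UNIV. q k * ((multinom_sum d q (\<lambda>\<alpha>. lin_form y \<alpha> * lin_form z \<alpha>)
      + (z k * multinom_sum d q (lin_form y) + y k * multinom_sum d q (lin_form z))) + (y k * z k) * ?S ^ d))"
    unfolding multinom_sum_Suc e multinom_sum_add multinom_sum_cmult multinom_sum_one by simp
  also have "\<dots> = ?S * multinom_sum d q (\<lambda>\<alpha>. lin_form y \<alpha> * lin_form z \<alpha>)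
      + ?B * multinom_sum d q (lin_form y) + ?A * multinom_sum d q (lin_form z) + ?C * ?S ^ d"
    by (simp add: distrib_left sum.distrib sum_distrib_left sum_distrib_right mult_ac)
  also have "\<dots> = of_nat (Suc d) * of_nat d * ?A * ?B * ?S ^ (d - 1) + of_nat (Suc d) * ?C * ?S ^ d"
    unfolding Suc multinom_sum_lin_form
    by (cases d; cases "d - 1") (simp_all add: algebra_simps)
  finally show ?case by simp
qed

text \<open>The exponential of a linear form is multiplicative over the steps, so it can be absorbed
  into the step weights.\<close>

lemma multinom_sum_exp:
  "multinom_sum d q (\<lambda>\<alpha>. exp (lin_form \<tau> \<alpha>)) = (\<Sum>k\<in>UNIV. q k * exp (\<tau> k)) ^ d"
proof -
  have "multinom_sum d q (\<lambda>\<alpha>. exp (lin_form \<tau> \<alpha>)) = multinom_sum d (\<lambda>k. q k * exp (\<tau> k)) (\<lambda>_. 1)"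
    unfolding multinom_sum_def lin_form_def
    by (intro sum.cong refl) (simp add: exp_sum exp_of_nat_mult power_mult_distrib prod.distrib)
  then show ?thesis by (simp add: multinom_sum_one)
qed

section \<open>The restriction of a random polynomial to a torus\<close>

definition multinom_weight :: "(3 \<Rightarrow> real) \<Rightarrow> nat \<Rightarrow> nat ^ 3 \<Rightarrow> real" where
  "multinom_weight p d \<alpha> = sqrt (fact d / (\<Prod>k\<in>UNIV. fact (\<alpha> $ k)) * (\<Prod>k\<in>UNIV. p k ^ (\<alpha> $ k)))"

definition real_form :: "(3 \<Rightarrow> real) \<Rightarrow> nat ^ 3 \<Rightarrow> real" where
  "real_form y \<alpha> = (\<Sum>k\<in>UNIV. real (\<alpha> $ k) * y k)"

lemma of_real_real_form: "complex_of_real (real_form y \<alpha>) = lin_form (\<lambda>k. complex_of_real (y k)) \<alpha>"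
  by (simp add: real_form_def lin_form_def)

lemma real_form_add: "real_form (\<lambda>k. x k + y k) \<alpha> = real_form x \<alpha> + real_form y \<alpha>"
  by (simp add: real_form_def distrib_left sum.distrib)

lemma real_form_diff: "real_form (\<lambda>k. x k - y k) \<alpha> = real_form x \<alpha> - real_form y \<alpha>"
  by (simp add: real_form_def right_diff_distrib sum_subtractf)

lemma real_form_scale: "real_form (\<lambda>k. c * y k) \<alpha> = c * real_form y \<alpha>"
  by (simp add: real_form_def sum_distrib_left mult_ac)

lemma real_form_const: "\<alpha> \<in> exponents d \<Longrightarrow> real_form (\<lambda>_. c) \<alpha> = real d * c"
  unfolding real_form_def sum_distrib_right[symmetric] exponents_def mem_Collect_eq by (metis of_nat_sum)

lemma multinom_weight_sq:
  assumes "\<And>k. 0 \<le> p k"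
  shows "(multinom_weight p d \<alpha>)\<^sup>2 = fact d / (\<Prod>k\<in>UNIV. fact (\<alpha> $ k)) * (\<Prod>k\<in>UNIV. p k ^ (\<alpha> $ k))"
  unfolding multinom_weight_def using assms by (intro real_sqrt_pow2) (auto intro!: prod_nonneg divide_nonneg_nonneg mult_nonneg_nonneg)

lemma sum_multinom_weight_sq:
  assumes "\<And>k. 0 \<le> p k"
  shows "(\<Sum>\<alpha>\<in>exponents d. complex_of_real ((multinom_weight p d \<alpha>)\<^sup>2) * g \<alpha>) = multinom_sum d (\<lambda>k. complex_of_real (p k)) g"
  unfolding multinom_sum_def multinom_weight_sq[OF assms]
  by (intro sum.cong refl) simp

text \<open>Such a vector is the coefficient vector of a linear functional of the Gaussian family;
  inner products of these vectors are covariances.\<close>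

definition phase_vec :: "(3 \<Rightarrow> real) \<Rightarrow> nat \<Rightarrow> (3 \<Rightarrow> real) \<Rightarrow> (3 \<Rightarrow> real) \<Rightarrow> nat ^ 3 \<Rightarrow> complex" where
  "phase_vec p d z \<theta> \<alpha> =
     complex_of_real (multinom_weight p d \<alpha> * (real_form z \<alpha> / sqrt d)) * exp (\<i> * complex_of_real (real_form \<theta> \<alpha>))"

text \<open>The two root weights multiply to a multinomial weight and the phases combine into the
  twisted step weights \<open>q\<close>, so the covariance is a second moment divided by
  \<open>d\<close>. The powers of the sum of \<open>q\<close> decide its size: they are one at equal
  points if \<open>p\<close> sums to one, and decay when the modulus of the sum is below
  one.\<close>

lemma gram_phase_vec:
  fixes p \<theta> \<theta>' :: "3 \<Rightarrow> real"
  assumes p: "\<And>k. 0 \<le> p k" and d: "1 \<le> d"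
  defines "q \<equiv> \<lambda>k. complex_of_real (p k) * exp (\<i> * complex_of_real (\<theta> k - \<theta>' k))"
  shows "(\<Sum>\<alpha>\<in>exponents d. phase_vec p d z \<theta> \<alpha> * cnj (phase_vec p d z' \<theta>' \<alpha>)) =
     of_nat (d - 1) * (\<Sum>k\<in>UNIV. q k * complex_of_real (z k)) * (\<Sum>k\<in>UNIV. q k * complex_of_real (z' k)) * (\<Sum>k\<in>UNIV. q k) ^ (d - 2)
     + (\<Sum>k\<in>UNIV. q k * complex_of_real (z k) * complex_of_real (z' k)) * (\<Sum>k\<in>UNIV. q k) ^ (d - 1)"
proof -
  let ?l = "\<lambda>z \<alpha>. lin_form (\<lambda>k. complex_of_real (z k)) \<alpha>"
  have "phase_vec p d z \<theta> \<alpha> * cnj (phase_vec p d z' \<theta>' \<alpha>) =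
     fact d / (\<Prod>k\<in>UNIV. fact (\<alpha> $ k)) * (\<Prod>k\<in>UNIV. q k ^ (\<alpha> $ k)) * (inverse (of_nat d) * (?l z \<alpha> * ?l z' \<alpha>))" for \<alpha>
  proof -
    have "exp (\<i> * complex_of_real (real_form \<theta> \<alpha>)) * cnj (exp (\<i> * complex_of_real (real_form \<theta>' \<alpha>)))
        = exp (\<i> * complex_of_real (real_form (\<lambda>k. \<theta> k - \<theta>' k) \<alpha>))"
      by (simp add: exp_cnj exp_add[symmetric] real_form_diff algebra_simps)
    also have "\<dots> = (\<Prod>k\<in>UNIV. exp (\<i> * complex_of_real (\<theta> k - \<theta>' k)) ^ (\<alpha> $ k))"
      unfolding real_form_def of_real_sum sum_distrib_left exp_sum[OF finite]
      by (intro prod.cong refl) (simp add: exp_of_nat_mult[symmetric] mult_ac)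
    finally have e: "exp (\<i> * complex_of_real (real_form \<theta> \<alpha>)) * cnj (exp (\<i> * complex_of_real (real_form \<theta>' \<alpha>)))
        = (\<Prod>k\<in>UNIV. exp (\<i> * complex_of_real (\<theta> k - \<theta>' k)) ^ (\<alpha> $ k))" .
    have s: "sqrt d * sqrt d = d" by simp
    let ?w = "multinom_weight p d \<alpha>" and ?z = "real_form z \<alpha>" and ?z' = "real_form z' \<alpha>"
    have "?w * (?z / sqrt d) * (?w * (?z' / sqrt d)) = ?w\<^sup>2 * (?z * ?z' / (sqrt d * sqrt d))"
      by (simp add: power2_eq_square)
    then have "complex_of_real (?w * (?z / sqrt d)) * complex_of_real (?w * (?z' / sqrt d)) = complex_of_real (?w\<^sup>2 * (?z * ?z' / (sqrt d * sqrt d)))"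
      by (simp only: of_real_mult[symmetric])
    moreover have "phase_vec p d z \<theta> \<alpha> * cnj (phase_vec p d z' \<theta>' \<alpha>) =
      complex_of_real (?w * (?z / sqrt d)) * complex_of_real (?w * (?z' / sqrt d)) *
      (exp (\<i> * complex_of_real (real_form \<theta> \<alpha>)) * cnj (exp (\<i> * complex_of_real (real_form \<theta>' \<alpha>))))"
      unfolding phase_vec_def by (simp only: complex_cnj_mult complex_cnj_complex_of_real mult_ac)
    ultimately have "phase_vec p d z \<theta> \<alpha> * cnj (phase_vec p d z' \<theta>' \<alpha>) =
      complex_of_real (?w\<^sup>2 * (?z * ?z' / (sqrt d * sqrt d))) *
      (exp (\<i> * complex_of_real (real_form \<theta> \<alpha>)) * cnj (exp (\<i> * complex_of_real (real_form \<theta>' \<alpha>))))"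
      by (simp only:)
    then show ?thesis
      unfolding e s multinom_weight_sq[OF p] q_def of_real_real_form[symmetric]
      by (simp add: power_mult_distrib prod.distrib divide_inverse mult_ac)
  qed
  then have "(\<Sum>\<alpha>\<in>exponents d. phase_vec p d z \<theta> \<alpha> * cnj (phase_vec p d z' \<theta>' \<alpha>)) =
     inverse (of_nat d) * multinom_sum d q (\<lambda>\<alpha>. ?l z \<alpha> * ?l z' \<alpha>)"
    by (simp only: multinom_sum_def[symmetric] multinom_sum_cmult)
  also have "\<dots> = of_nat (d - 1) * (\<Sum>k\<in>UNIV. q k * complex_of_real (z k)) * (\<Sum>k\<in>UNIV. q k * complex_of_real (z' k)) * (\<Sum>k\<in>UNIV. q k) ^ (d - 2)
     + (\<Sum>k\<in>UNIV. q k * complex_of_real (z k) * complex_of_real (z' k)) * (\<Sum>k\<in>UNIV. q k) ^ (d - 1)"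
  proof -
    have "inverse (of_nat d :: complex) * of_nat d = 1" using d by simp
    then have "inverse (of_nat d) * (of_nat d * A) = (A :: complex)" for A
      by (simp only: mult.assoc[symmetric] mult_1_left)
    then show ?thesis unfolding multinom_sum_lin_form2 distrib_left mult.assoc by (simp only:)
  qed
  finally show ?thesis .
qed

text \<open>On exponents of total degree \<open>d\<close> the linear form of the constant \<open>1 / sqrt d\<close> is
  \<open>sqrt d\<close>, so \<open>phase_vec\<close> with the frame vector \<open>0\<close> evaluates the polynomial, while \<open>1\<close> and
  \<open>2\<close> give its derivatives along \<open>y1\<close> and \<open>y2\<close> at scale \<open>1 / sqrt d\<close>, up to the factor \<open>i\<close>.\<close>

definition frame :: "(3 \<Rightarrow> real) \<Rightarrow> (3 \<Rightarrow> real) \<Rightarrow> nat \<Rightarrow> nat \<Rightarrow> 3 \<Rightarrow> real" where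
  "frame y1 y2 d m = (if m = 0 then \<lambda>_. 1 / sqrt d else if m = 1 then y1 else y2)"

text \<open>Together with the constant 1, \<open>y1\<close> and \<open>y2\<close> form an
  orthonormal basis of the functions on three points weighted by \<open>p\<close>. Thus the two
  linear forms, divided by sqrt d, are centred and uncorrelated with variance one under the
  multinomial law.\<close>

definition orthonormal_frame :: "(3 \<Rightarrow> real) \<Rightarrow> (3 \<Rightarrow> real) \<Rightarrow> (3 \<Rightarrow> real) \<Rightarrow> bool" where
  "orthonormal_frame p y1 y2 \<longleftrightarrow> (\<forall>k. 0 < p k) \<and> (\<Sum>k\<in>UNIV. p k) = 1 \<and>
     (\<Sum>k\<in>UNIV. p k * y1 k) = 0 \<and> (\<Sum>k\<in>UNIV. p k * y2 k) = 0 \<and>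
     (\<Sum>k\<in>UNIV. p k * y1 k * y1 k) = 1 \<and> (\<Sum>k\<in>UNIV. p k * y2 k * y2 k) = 1 \<and> (\<Sum>k\<in>UNIV. p k * y1 k * y2 k) = 0"

text \<open>Orthogonality is built in: \<open>y1\<close> is constant on the coordinates 1 and 3,
  while \<open>y2\<close> has mean zero and lives on these two only. The numbers \<open>a\<close>
  and \<open>b\<close> merely normalise.\<close>

lemma orthonormal_frame_exists:
  assumes p: "\<And>k. 0 < p k" "(\<Sum>k\<in>UNIV. p k) = 1"
  shows "\<exists>y1 y2. orthonormal_frame p y1 y2"
proof -
  define A B C where "A = p 1" "B = p 2" "C = p 3"
  have pos: "0 < A" "0 < B" "0 < C" and sum: "B = 1 - (A + C)" using p by (auto simp: A_B_C_def sum_3)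
  have sq: "1 / sqrt x * (1 / sqrt x) * x = 1" if "0 < x" for x :: real using that by simp
  define a where "a = 1 / sqrt (1 / B + 1 / (A + C))"
  define b where "b = 1 / sqrt (1 / A + 1 / C)"
  have "0 < 1 / B + 1 / (A + C)" "0 < 1 / A + 1 / C" using pos by (auto intro!: add_pos_pos)
  then have a2: "a * a * (1 / B + 1 / (A + C)) = 1" and b2: "b * b * (1 / A + 1 / C) = 1"
    unfolding a_def b_def by - (rule sq, assumption)+
  define y1 :: "3 \<Rightarrow> real" where "y1 k = (if k = 2 then a / B else - a / (A + C))" for k
  define y2 :: "3 \<Rightarrow> real" where "y2 k = (if k = 1 then - b / A else if k = 2 then 0 else b / C)" for k
  have y: "y1 1 = - a / (A + C)" "y1 2 = a / B" "y1 3 = - a / (A + C)" "y2 1 = - b / A" "y2 2 = 0" "y2 3 = b / C"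
    by (simp_all add: y1_def y2_def)
  have AC: "A + C \<noteq> 0" "A \<noteq> 0" "B \<noteq> 0" "C \<noteq> 0" using pos by auto
  have "A * (- a / (A + C)) + B * (a / B) + C * (- a / (A + C)) = 0"
    "A * (- a / (A + C)) * (- b / A) + C * (- a / (A + C)) * (b / C) = 0"
    "A * (- b / A) + C * (b / C) = 0"
    using AC by (auto simp: field_simps)
  moreover have "A * (- a / (A + C)) * (- a / (A + C)) + B * (a / B) * (a / B) + C * (- a / (A + C)) * (- a / (A + C)) = 1"
  proof -
    have "A * (- a / (A + C)) * (- a / (A + C)) + B * (a / B) * (a / B) + C * (- a / (A + C)) * (- a / (A + C))
       = a * a * (1 / B + (A + C) / ((A + C) * (A + C)))"
      using AC(3) by (simp add: add_divide_distrib distrib_left distrib_right mult_ac)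
    also have "(A + C) / ((A + C) * (A + C)) = 1 / (A + C)" using AC(1) by simp
    finally show ?thesis using a2 by simp
  qed
  moreover have "A * (- b / A) * (- b / A) + C * (b / C) * (b / C) = 1"
  proof -
    have "A * (- b / A) * (- b / A) + C * (b / C) * (b / C) = b * b * (1 / A + 1 / C)"
      using AC by (simp add: distrib_left mult_ac)
    then show ?thesis using b2 by simp
  qed
  ultimately have "orthonormal_frame p y1 y2"
    unfolding orthonormal_frame_def using p by (simp add: sum_3 y flip: A_B_C_def)
  then show ?thesis by blast
qed

text \<open>The step weights now sum to one and \<open>y1\<close>, \<open>y2\<close> have mean zero,
  so the term of order \<open>d\<close> survives only for the pair of constants. There it equals (d
  - 1)/d, and the other term supplies the missing 1/d.\<close>

lemma gram_frame_same:
  assumes on: "orthonormal_frame p y1 y2" and d: "1 \<le> d" and m: "m < 3" "n < 3"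
  shows "(\<Sum>\<alpha>\<in>exponents d. phase_vec p d (frame y1 y2 d m) \<theta> \<alpha> * cnj (phase_vec p d (frame y1 y2 d n) \<theta> \<alpha>)) = (if m = n then 1 else 0)"
proof -
  have p: "\<And>k. 0 \<le> p k" and p1: "(\<Sum>k\<in>UNIV. p k) = 1" using on by (auto simp: orthonormal_frame_def less_imp_le)
  let ?f = "frame y1 y2 d"
  define A B where "A m = (\<Sum>k\<in>UNIV. p k * ?f m k)" and "B m n = (\<Sum>k\<in>UNIV. p k * ?f m k * ?f n k)" for m n
  have d0: "0 < real d" using d by simp
  have A: "A m = (if m = 0 then 1 / sqrt d else 0)" for m
    using on by (simp add: A_def frame_def orthonormal_frame_def sum_divide_distrib[symmetric])
  have m': "m = 0 \<or> m = 1 \<or> m = 2" "n = 0 \<or> n = 1 \<or> n = 2" using m by linarith+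
  have sw: "(\<Sum>k\<in>UNIV. p k * y2 k * y1 k) = (\<Sum>k\<in>UNIV. p k * y1 k * y2 k)" by (simp add: mult_ac)
  have B: "B m n = (if m = n then (if m = 0 then 1 / d else 1) else 0)"
    using on m' d0 sw by (auto simp: B_def frame_def orthonormal_frame_def sum_divide_distrib[symmetric])
  have "real (d - 1) * A m * A n + B m n = (if m = n then 1 else 0)"
  proof (cases "m = 0 \<and> n = 0")
    case True
    have "real (d - 1) * (1 / sqrt d) * (1 / sqrt d) + 1 / d = real (d - 1) / d + 1 / d" by simp
    also have "\<dots> = 1" using d by (simp add: field_simps of_nat_diff)
    finally show ?thesis unfolding A B using True by simp
  qed (auto simp: A B)
  then have "complex_of_real (real (d - 1) * A m * A n + B m n) = (if m = n then 1 else 0)" by simp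
  moreover have "complex_of_real (p k) * exp (\<i> * complex_of_real (\<theta> k - \<theta> k)) = complex_of_real (p k)" for k by simp
  moreover have "complex_of_nat (d - 1) = complex_of_real (real (d - 1))" by simp
  ultimately show ?thesis
    unfolding gram_phase_vec[OF p d]
    by (simp only: of_real_mult[symmetric] of_real_sum[symmetric] p1 of_real_1 power_one mult_1_right
        A_def[symmetric] B_def[symmetric] of_real_add[symmetric])
qed

text \<open>The frame vectors are bounded independently of \<open>d\<close>, so the covariance is of
  order at most d * s^d, where s < 1 is the modulus in the hypothesis.\<close>

lemma gram_frame_tendsto:
  assumes p: "\<And>k. 0 \<le> p k" and q: "cmod (\<Sum>k\<in>UNIV. complex_of_real (p k) * exp (\<i> * complex_of_real (\<theta> k - \<theta>' k))) < 1"
  shows "(\<lambda>d. \<Sum>\<alpha>\<in>exponents d. phase_vec p d (frame y1 y2 d m) \<theta> \<alpha> * cnj (phase_vec p d (frame y1 y2 d n) \<theta>' \<alpha>)) \<longlonglongrightarrow> 0"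
proof -
  define q where "q k = complex_of_real (p k) * exp (\<i> * complex_of_real (\<theta> k - \<theta>' k))" for k
  define s where "s = cmod (\<Sum>k\<in>UNIV. q k)"
  have s: "0 \<le> s" "s < 1" using q by (auto simp: s_def q_def)
  define M where "M = 1 + (\<Sum>k\<in>UNIV. \<bar>y1 k\<bar> + \<bar>y2 k\<bar>)"
  have fb: "\<bar>frame y1 y2 d m k\<bar> \<le> M" if "1 \<le> d" for d m k
  proof -
    have "\<bar>y1 k\<bar> + \<bar>y2 k\<bar> \<le> (\<Sum>k\<in>UNIV. \<bar>y1 k\<bar> + \<bar>y2 k\<bar>)" by (rule member_le_sum) auto
    moreover have "1 / sqrt d \<le> 1" using that by simp
    moreover have "0 \<le> (\<Sum>k\<in>UNIV. \<bar>y1 k\<bar> + \<bar>y2 k\<bar>)" by (intro sum_nonneg) auto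
    moreover have "0 \<le> 1 / sqrt d" by simp
    ultimately show ?thesis unfolding frame_def M_def by (simp only: abs_of_nonneg split: if_split) linarith
  qed
  have M0: "0 \<le> M" unfolding M_def by (intro add_nonneg_nonneg sum_nonneg) auto
  have qn: "cmod (q k) = p k" for k using p by (simp add: q_def norm_mult)
  define P where "P = (\<Sum>k\<in>UNIV. p k)"
  have P0: "0 \<le> P" unfolding P_def using p by (intro sum_nonneg) auto
  have A: "cmod (\<Sum>k\<in>UNIV. q k * complex_of_real (frame y1 y2 d m k)) \<le> P * M" if "1 \<le> d" for d m
  proof -
    have "cmod (\<Sum>k\<in>UNIV. q k * complex_of_real (frame y1 y2 d m k)) \<le> (\<Sum>k\<in>UNIV. p k * M)"
    proof (rule sum_norm_le)
      fix k
      show "cmod (q k * complex_of_real (frame y1 y2 d m k)) \<le> p k * M"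
        unfolding norm_mult norm_of_real qn by (intro mult_left_mono fb[OF that] p)
    qed
    then show ?thesis by (simp add: P_def sum_distrib_right)
  qed
  have B: "cmod (\<Sum>k\<in>UNIV. q k * complex_of_real (frame y1 y2 d m k) * complex_of_real (frame y1 y2 d n k)) \<le> P * (M * M)" if "1 \<le> d" for d m n
  proof -
    have "cmod (\<Sum>k\<in>UNIV. q k * complex_of_real (frame y1 y2 d m k) * complex_of_real (frame y1 y2 d n k)) \<le> (\<Sum>k\<in>UNIV. p k * (M * M))"
    proof (rule sum_norm_le)
      fix k
      show "cmod (q k * complex_of_real (frame y1 y2 d m k) * complex_of_real (frame y1 y2 d n k)) \<le> p k * (M * M)"
        unfolding norm_mult norm_of_real qn mult.assoc
        by (intro mult_left_mono[OF mult_mono] fb[OF that] p M0 abs_ge_zero)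
    qed
    then show ?thesis by (simp add: P_def sum_distrib_right)
  qed
  define C where "C = (P * M) * (P * M) + P * (M * M)"
  \<comment> \<open>The shift by two turns the truncated exponents of \<open>gram_phase_vec\<close>
    into plain ones; \<open>LIMSEQ_offset\<close> undoes it at the end.\<close>
  have bound: "cmod (\<Sum>\<alpha>\<in>exponents (d + 2). phase_vec p (d + 2) (frame y1 y2 (d + 2) m) \<theta> \<alpha> * cnj (phase_vec p (d + 2) (frame y1 y2 (d + 2) n) \<theta>' \<alpha>))
     \<le> C * (real d * s ^ d + s ^ d)" for d
  proof -
    let ?A = "\<lambda>m. \<Sum>k\<in>UNIV. q k * complex_of_real (frame y1 y2 (d + 2) m k)"
    let ?B = "\<Sum>k\<in>UNIV. q k * complex_of_real (frame y1 y2 (d + 2) m k) * complex_of_real (frame y1 y2 (d + 2) n k)"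
    have eq: "(\<Sum>\<alpha>\<in>exponents (d + 2). phase_vec p (d + 2) (frame y1 y2 (d + 2) m) \<theta> \<alpha> * cnj (phase_vec p (d + 2) (frame y1 y2 (d + 2) n) \<theta>' \<alpha>))
       = of_nat (d + 1) * ?A m * ?A n * (\<Sum>k\<in>UNIV. q k) ^ d + ?B * (\<Sum>k\<in>UNIV. q k) ^ (d + 1)"
    proof -
      have d2: "d + 2 - 1 = d + 1" "d + 2 - 2 = d" "1 \<le> d + 2" by simp_all
      show ?thesis unfolding gram_phase_vec[OF p d2(3)] d2(1,2) q_def ..
    qed
    have "cmod (\<Sum>\<alpha>\<in>exponents (d + 2). phase_vec p (d + 2) (frame y1 y2 (d + 2) m) \<theta> \<alpha> * cnj (phase_vec p (d + 2) (frame y1 y2 (d + 2) n) \<theta>' \<alpha>))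
      \<le> real (d + 1) * cmod (?A m) * cmod (?A n) * s ^ d + cmod ?B * s ^ (d + 1)"
      unfolding eq by (rule order_trans[OF norm_triangle_ineq]) (simp only: norm_mult norm_power norm_of_nat s_def)
    also have "\<dots> \<le> real (d + 1) * (P * M) * (P * M) * s ^ d + P * (M * M) * s ^ (d + 1)"
    proof -
      have mono: "real (d + 1) * x * x' * u + z * v \<le> real (d + 1) * X * X * u + Z * v"
        if "0 \<le> x" "x \<le> X" "0 \<le> x'" "x' \<le> X" "z \<le> Z" "0 \<le> u" "0 \<le> v" for x x' X z Z u v :: real
        using that by (intro add_mono mult_right_mono mult_mono mult_left_mono) auto
      show ?thesis
        using s by (intro mono A B norm_ge_zero zero_le_power) simp_all
    qed
    also have "\<dots> \<le> real (d + 1) * (P * M) * (P * M) * s ^ d + P * (M * M) * (real (d + 1) * s ^ d)"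
    proof -
      have "s * s ^ d \<le> real (d + 1) * s ^ d" using s by (intro mult_right_mono) auto
      then show ?thesis using P0 M0 by (intro add_left_mono mult_left_mono) auto
    qed
    also have "\<dots> = C * (real d * s ^ d + s ^ d)" by (simp add: C_def algebra_simps)
    finally show ?thesis .
  qed
  have "(\<lambda>d. real d * s ^ d) \<longlonglongrightarrow> 0" using powser_times_n_limit_0[of s] s by simp
  moreover have "(\<lambda>d. s ^ d) \<longlonglongrightarrow> 0" using s by (intro LIMSEQ_realpow_zero)
  ultimately have "(\<lambda>d. C * (real d * s ^ d + s ^ d)) \<longlonglongrightarrow> C * (0 + 0)" by (intro tendsto_mult tendsto_const tendsto_add)
  then have "(\<lambda>d. C * (real d * s ^ d + s ^ d)) \<longlonglongrightarrow> 0" by simp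
  from LIMSEQ_offset[OF Lim_null_comparison[OF always_eventually[OF allI[OF bound]] this]] show ?thesis .
qed

section \<open>Tails of the Taylor coefficients\<close>

text \<open>After multiplication by 1 - x the number 1 separates the two sides, by 1 - x \<le> exp
  (- x) on the left.\<close>

lemma exp_le_quadratic:
  fixes x :: real
  assumes "x \<le> 1 / 2"
  shows "exp x \<le> 1 + x + 2 * x\<^sup>2"
proof -
  have "1 - x \<le> exp (- x)" using exp_ge_add_one_self[of "- x"] by simp
  then have "(1 - x) * exp x \<le> exp (- x) * exp x" by (intro mult_right_mono) auto
  then have 1: "(1 - x) * exp x \<le> 1" by (simp add: exp_minus)
  have "(1 - x) * (1 + x + 2 * x\<^sup>2) = 1 + x\<^sup>2 * (1 - 2 * x)"
    by (simp add: algebra_simps power2_eq_square)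
  also have "\<dots> \<ge> 1" using assms by (simp add: mult_nonneg_nonneg)
  finally have "(1 - x) * exp x \<le> (1 - x) * (1 + x + 2 * x\<^sup>2)" using 1 by linarith
  then show ?thesis using assms by (simp add: mult_le_cancel_left)
qed

lemma power_le_fact_exp: "x ^ n \<le> fact n * exp x" if "0 \<le> x" for x :: real
proof -
  have "(\<Sum>i\<in>{n}. x ^ i /\<^sub>R fact i) \<le> (\<Sum>i. x ^ i /\<^sub>R fact i)"
    using that by (intro sum_le_suminf) (auto simp: summable_exp)
  then show ?thesis by (simp add: exp_def field_simps)
qed

lemma fact_double_le: "(fact (2 * n) :: real) \<le> 4 ^ n * (fact n)\<^sup>2"
proof -
  have "fact n * fact (2 * n - n) * ((2 * n) choose n) = (fact (2 * n) :: nat)"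
    by (rule binomial_fact_lemma) simp
  then have "(fact (2 * n) :: nat) = (fact n)\<^sup>2 * ((2 * n) choose n)" by (simp add: power2_eq_square)
  also have "\<dots> \<le> (fact n)\<^sup>2 * 2 ^ (2 * n)" by (intro mult_left_mono binomial_le_pow2) simp
  finally have "real (fact (2 * n)) \<le> real ((fact n)\<^sup>2 * 2 ^ (2 * n))" by (rule of_nat_mono)
  moreover have "(4::real) ^ n = 2 ^ (2 * n)" by (simp add: power_mult)
  ultimately show ?thesis by (simp add: mult.commute)
qed

text \<open>The generating function is the d-th power of a single step. There the linear term
  vanishes and the quadratic term gives 2 * 2 / d, so the power is at most (1 + 4/d)^d. The variance
  2 is that of the four combinations of \<open>y1\<close> and \<open>y2\<close> with signs, for
  which the bound is used.\<close>

lemma multinomial_mgf_le: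
  assumes p: "\<And>k. 0 < p k" "(\<Sum>k\<in>UNIV. p k) = 1"
    and u: "(\<Sum>k\<in>UNIV. p k * u k) = 0" "(\<Sum>k\<in>UNIV. p k * u k * u k) = 2"
    and d: "1 \<le> d" "\<And>k. \<bar>u k\<bar> \<le> sqrt d / 2"
  shows "(\<Sum>\<alpha>\<in>exponents d. (multinom_weight p d \<alpha>)\<^sup>2 * exp (real_form u \<alpha> / sqrt d)) \<le> exp 4"
proof -
  let ?u = "\<lambda>k. 1 / sqrt d * u k"
  have d0: "0 < sqrt d" using d by simp
  have "complex_of_real (\<Sum>\<alpha>\<in>exponents d. (multinom_weight p d \<alpha>)\<^sup>2 * exp (real_form u \<alpha> / sqrt d)) =
     multinom_sum d (\<lambda>k. complex_of_real (p k)) (\<lambda>\<alpha>. exp (lin_form (\<lambda>k. complex_of_real (?u k)) \<alpha>))"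
    unfolding of_real_real_form[symmetric] real_form_scale
    by (subst sum_multinom_weight_sq[symmetric]) (use p in \<open>auto simp: less_imp_le exp_of_real[symmetric]\<close>)
  also have "\<dots> = complex_of_real ((\<Sum>k\<in>UNIV. p k * exp (?u k)) ^ d)"
    unfolding multinom_sum_exp by (simp add: exp_of_real[symmetric])
  finally have eq: "(\<Sum>\<alpha>\<in>exponents d. (multinom_weight p d \<alpha>)\<^sup>2 * exp (real_form u \<alpha> / sqrt d)) = (\<Sum>k\<in>UNIV. p k * exp (?u k)) ^ d"
    by (simp only: of_real_eq_iff)
  have "(\<Sum>k\<in>UNIV. p k * exp (?u k)) \<le> (\<Sum>k\<in>UNIV. p k * (1 + ?u k + 2 * (?u k)\<^sup>2))"
  proof (intro sum_mono mult_left_mono exp_le_quadratic)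
    fix k
    have "u k \<le> sqrt d / 2" using d(2)[of k] by linarith
    then show "?u k \<le> 1 / 2" using d0 by (simp add: field_simps)
    show "0 \<le> p k" using p(1)[of k] by simp
  qed
  also have "\<dots> = (\<Sum>k\<in>UNIV. p k) + 1 / sqrt d * (\<Sum>k\<in>UNIV. p k * u k) + 2 / d * (\<Sum>k\<in>UNIV. p k * u k * u k)"
    by (simp add: distrib_left sum.distrib sum_distrib_left power_mult_distrib power_divide power2_eq_square mult_ac)
  also have "\<dots> = 1 + 4 / d" using p u by simp
  also have "\<dots> \<le> exp (4 / d)" by (rule exp_ge_add_one_self)
  finally have "(\<Sum>k\<in>UNIV. p k * exp (?u k)) ^ d \<le> exp (4 / d) ^ d"
    using p by (intro power_mono sum_nonneg) (auto simp: less_imp_le)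
  also have "\<dots> = exp 4" using d by (simp add: exp_of_nat_mult[symmetric])
  finally show ?thesis unfolding eq .
qed

text \<open>The coefficient vector of the quantity \<open>Y k l\<close> in
  \<open>exp_sum_has_zero\<close>, for the expansion around the point \<open>\<theta>\<close> at
  scale 1 / sqrt d.\<close>

definition taylor_vec :: "(3 \<Rightarrow> real) \<Rightarrow> (3 \<Rightarrow> real) \<Rightarrow> (3 \<Rightarrow> real) \<Rightarrow> nat \<Rightarrow> (3 \<Rightarrow> real) \<Rightarrow> nat \<Rightarrow> nat \<Rightarrow> nat ^ 3 \<Rightarrow> complex" where
  "taylor_vec p y1 y2 d \<theta> k l \<alpha> = complex_of_real (multinom_weight p d \<alpha>) * exp (\<i> * complex_of_real (real_form \<theta> \<alpha>)) *
     complex_of_real ((real_form y1 \<alpha> / sqrt d) ^ k * (real_form y2 \<alpha> / sqrt d) ^ l)"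

text \<open>Even powers are bounded by x^(2k) \<le> (2k)! exp |x|, and exp (|x| + |y|) by the sum
  over the four choices of signs, each of which has expectation at most exp 4. The constant 2 exp 2
  is the root of 4 exp 4, and (2k)! \<le> 4^k (k!)^2 gives the other factors.\<close>

lemma taylor_vec_variance:
  assumes on: "orthonormal_frame p y1 y2" and d: "1 \<le> d" "\<And>k. \<bar>y1 k\<bar> + \<bar>y2 k\<bar> \<le> sqrt d / 2"
  shows "(\<Sum>\<alpha>\<in>exponents d. (cmod (taylor_vec p y1 y2 d \<theta> k l \<alpha>))\<^sup>2) \<le> (2 * exp 2 * 2 ^ (k + l) * fact k * fact l)\<^sup>2"
proof -
  define w where "w = multinom_weight p d"
  define \<eta>1 where "\<eta>1 \<alpha> = real_form y1 \<alpha> / sqrt d" for \<alpha>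
  define \<eta>2 where "\<eta>2 \<alpha> = real_form y2 \<alpha> / sqrt d" for \<alpha>
  have mgf: "(\<Sum>\<alpha>\<in>exponents d. (w \<alpha>)\<^sup>2 * exp (\<sigma> * \<eta>1 \<alpha> + \<tau> * \<eta>2 \<alpha>)) \<le> exp 4" if st: "\<sigma> \<in> {-1, 1}" "\<tau> \<in> {-1, 1}" for \<sigma> \<tau>
  proof -
    have "real_form (\<lambda>k. \<sigma> * y1 k + \<tau> * y2 k) \<alpha> / sqrt d = \<sigma> * \<eta>1 \<alpha> + \<tau> * \<eta>2 \<alpha>" for \<alpha>
      unfolding real_form_add real_form_scale \<eta>1_def \<eta>2_def by (simp add: add_divide_distrib)
    moreover have "(\<Sum>\<alpha>\<in>exponents d. (w \<alpha>)\<^sup>2 * exp (real_form (\<lambda>k. \<sigma> * y1 k + \<tau> * y2 k) \<alpha> / sqrt d)) \<le> exp 4"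
      unfolding w_def
    proof (rule multinomial_mgf_le)
      show "(\<Sum>k\<in>UNIV. p k * (\<sigma> * y1 k + \<tau> * y2 k)) = 0"
        using on by (simp add: orthonormal_frame_def distrib_left sum.distrib mult.left_commute[of _ \<sigma>] mult.left_commute[of _ \<tau>] sum_distrib_left[symmetric])
      have "(\<Sum>k\<in>UNIV. p k * (\<sigma> * y1 k + \<tau> * y2 k) * (\<sigma> * y1 k + \<tau> * y2 k))
         = \<sigma> * \<sigma> * (\<Sum>k\<in>UNIV. p k * y1 k * y1 k) + 2 * \<sigma> * \<tau> * (\<Sum>k\<in>UNIV. p k * y1 k * y2 k) + \<tau> * \<tau> * (\<Sum>k\<in>UNIV. p k * y2 k * y2 k)"
        unfolding sum_distrib_left sum.distrib[symmetric] by (intro sum.cong refl) (simp add: algebra_simps)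
      then show "(\<Sum>k\<in>UNIV. p k * (\<sigma> * y1 k + \<tau> * y2 k) * (\<sigma> * y1 k + \<tau> * y2 k)) = 2"
        using on st by (auto simp: orthonormal_frame_def)
      fix k
      have "\<bar>\<sigma> * y1 k + \<tau> * y2 k\<bar> \<le> \<bar>y1 k\<bar> + \<bar>y2 k\<bar>" using st by auto
      then show "\<bar>\<sigma> * y1 k + \<tau> * y2 k\<bar> \<le> sqrt d / 2" using d(2)[of k] by linarith
    qed (use on d in \<open>auto simp: orthonormal_frame_def\<close>)
    ultimately show ?thesis by simp
  qed
  have trm: "(cmod (taylor_vec p y1 y2 d \<theta> k l \<alpha>))\<^sup>2 \<le> (fact (2 * k) * fact (2 * l)) *
     ((w \<alpha>)\<^sup>2 * exp (1 * \<eta>1 \<alpha> + 1 * \<eta>2 \<alpha>) + (w \<alpha>)\<^sup>2 * exp (1 * \<eta>1 \<alpha> + (-1) * \<eta>2 \<alpha>)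
      + (w \<alpha>)\<^sup>2 * exp ((-1) * \<eta>1 \<alpha> + 1 * \<eta>2 \<alpha>) + (w \<alpha>)\<^sup>2 * exp ((-1) * \<eta>1 \<alpha> + (-1) * \<eta>2 \<alpha>))" for \<alpha>
  proof -
    have "(cmod (taylor_vec p y1 y2 d \<theta> k l \<alpha>))\<^sup>2 = (w \<alpha>)\<^sup>2 * (\<bar>\<eta>1 \<alpha>\<bar> ^ (2 * k) * \<bar>\<eta>2 \<alpha>\<bar> ^ (2 * l))"
      unfolding taylor_vec_def norm_mult norm_of_real w_def[symmetric] \<eta>1_def[symmetric] \<eta>2_def[symmetric]
      by (simp add: abs_mult power_abs power_mult_distrib power_mult[symmetric] mult.commute[of 2])
    also have "\<dots> \<le> (w \<alpha>)\<^sup>2 * ((fact (2 * k) * exp \<bar>\<eta>1 \<alpha>\<bar>) * (fact (2 * l) * exp \<bar>\<eta>2 \<alpha>\<bar>))"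
      by (intro mult_left_mono mult_mono power_le_fact_exp) auto
    also have "\<dots> = (fact (2 * k) * fact (2 * l)) * ((w \<alpha>)\<^sup>2 * exp (\<bar>\<eta>1 \<alpha>\<bar> + \<bar>\<eta>2 \<alpha>\<bar>))"
      by (simp add: exp_add)
    also have "\<dots> \<le> (fact (2 * k) * fact (2 * l)) *
     ((w \<alpha>)\<^sup>2 * exp (1 * \<eta>1 \<alpha> + 1 * \<eta>2 \<alpha>) + (w \<alpha>)\<^sup>2 * exp (1 * \<eta>1 \<alpha> + (-1) * \<eta>2 \<alpha>)
      + (w \<alpha>)\<^sup>2 * exp ((-1) * \<eta>1 \<alpha> + 1 * \<eta>2 \<alpha>) + (w \<alpha>)\<^sup>2 * exp ((-1) * \<eta>1 \<alpha> + (-1) * \<eta>2 \<alpha>))"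
    proof (rule mult_left_mono)
      have pos: "0 \<le> (w \<alpha>)\<^sup>2 * exp x" for x by simp
      show "(w \<alpha>)\<^sup>2 * exp (\<bar>\<eta>1 \<alpha>\<bar> + \<bar>\<eta>2 \<alpha>\<bar>) \<le> (w \<alpha>)\<^sup>2 * exp (1 * \<eta>1 \<alpha> + 1 * \<eta>2 \<alpha>) + (w \<alpha>)\<^sup>2 * exp (1 * \<eta>1 \<alpha> + (-1) * \<eta>2 \<alpha>)
      + (w \<alpha>)\<^sup>2 * exp ((-1) * \<eta>1 \<alpha> + 1 * \<eta>2 \<alpha>) + (w \<alpha>)\<^sup>2 * exp ((-1) * \<eta>1 \<alpha> + (-1) * \<eta>2 \<alpha>)"
        using pos[of "1 * \<eta>1 \<alpha> + 1 * \<eta>2 \<alpha>"] pos[of "1 * \<eta>1 \<alpha> + (-1) * \<eta>2 \<alpha>"] pos[of "(-1) * \<eta>1 \<alpha> + 1 * \<eta>2 \<alpha>"] pos[of "(-1) * \<eta>1 \<alpha> + (-1) * \<eta>2 \<alpha>"]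
        by (cases "0 \<le> \<eta>1 \<alpha>"; cases "0 \<le> \<eta>2 \<alpha>") simp_all
    qed simp
    finally show ?thesis .
  qed
  have "(\<Sum>\<alpha>\<in>exponents d. (cmod (taylor_vec p y1 y2 d \<theta> k l \<alpha>))\<^sup>2) \<le> (fact (2 * k) * fact (2 * l)) * (exp 4 + exp 4 + exp 4 + exp 4)"
    by (rule order_trans[OF sum_mono[OF trm]], unfold sum_distrib_left[symmetric] sum.distrib, intro mult_left_mono add_mono mgf) auto
  also have "\<dots> \<le> (4 ^ k * (fact k)\<^sup>2 * (4 ^ l * (fact l)\<^sup>2)) * (exp 4 + exp 4 + exp 4 + exp 4)"
    by (intro mult_right_mono mult_mono fact_double_le) auto
  also have "\<dots> = (2 * exp 2 * 2 ^ (k + l) * fact k * fact l)\<^sup>2"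
  proof -
    have "exp (4 :: real) = (exp 2)\<^sup>2" by (simp add: exp_double[symmetric])
    moreover have "(4::real) ^ n = (2 ^ n)\<^sup>2" for n by (simp add: power2_eq_square flip: power_mult_distrib)
    ultimately show ?thesis by (simp add: power_mult_distrib power_add)
  qed
  finally show ?thesis .
qed

definition rough_event :: "(3 \<Rightarrow> real) \<Rightarrow> (3 \<Rightarrow> real) \<Rightarrow> (3 \<Rightarrow> real) \<Rightarrow> nat \<Rightarrow> (3 \<Rightarrow> real) \<Rightarrow> real \<Rightarrow> (nat ^ 3 \<Rightarrow> complex) set" where
  "rough_event p y1 y2 d \<theta> K = {a \<in> space (iid_gaussian (exponents d)).
     \<exists>n. \<exists>k\<le>n. K * 4 ^ n * fact k * fact (n - k) \<le> cmod (\<Sum>\<alpha>\<in>exponents d. a \<alpha> * taylor_vec p y1 y2 d \<theta> k (n - k) \<alpha>)}"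

text \<open>The threshold grows like 4^n but the standard deviation only like 2^n, so one
  coefficient of order n fails with probability of order exp (- \<open>\<kappa>\<close> 2^n). The
  condition \<open>ln 4 \<le> \<kappa>\<close> makes this, times the n + 1 coefficients of order n,
  at most a geometric series of ratio 1/2. The factor 4 exp 2 in \<open>K\<close> cancels twice the
  constant 2 exp 2 of the variance bound.\<close>

lemma rough_event_prob:
  assumes on: "orthonormal_frame p y1 y2" and d: "1 \<le> d" "\<And>k. \<bar>y1 k\<bar> + \<bar>y2 k\<bar> \<le> sqrt d / 2"
    and \<kappa>: "ln 4 \<le> \<kappa>" "K = 4 * exp 2 * \<kappa>"
  shows "rough_event p y1 y2 d \<theta> K \<in> sets (iid_gaussian (exponents d))"
    "measure (iid_gaussian (exponents d)) (rough_event p y1 y2 d \<theta> K) \<le> 8 * exp (1 / 4) * exp (- \<kappa>)"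
proof -
  let ?G = "iid_gaussian (exponents d)"
  interpret G: prob_space ?G by (rule prob_space_iid_gaussian)
  define A where "A n k = {a \<in> space ?G. K * 4 ^ n * fact k * fact (n - k) \<le> cmod (\<Sum>\<alpha>\<in>exponents d. a \<alpha> * taylor_vec p y1 y2 d \<theta> k (n - k) \<alpha>)}" for n k
  have A_sets: "A n k \<in> sets ?G" for n k unfolding A_def by measurable
  define B where "B n = (\<Union>k\<in>{..n}. A n k)" for n
  have B_sets: "B n \<in> sets ?G" for n unfolding B_def using A_sets by auto
  have eq: "rough_event p y1 y2 d \<theta> K = (\<Union>n. B n)" unfolding rough_event_def B_def A_def by auto
  show "rough_event p y1 y2 d \<theta> K \<in> sets ?G" unfolding eq using B_sets by auto
  have A_le: "measure ?G (A n k) \<le> 4 * exp (1 / 4) * exp (- \<kappa> * 2 ^ n)" if "k \<le> n" for n k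
  proof -
    let ?s = "2 * exp 2 * 2 ^ (k + (n - k)) * fact k * fact (n - k) :: real"
    have s0: "0 < ?s" by simp
    have "measure ?G (A n k) \<le> 4 * exp (1 / 4) * exp (- (K * 4 ^ n * fact k * fact (n - k)) / (2 * ?s))"
      unfolding A_def by (rule iid_gaussian_tail[OF finite_exponents s0 taylor_vec_variance[OF on d]])
    also have "- (K * 4 ^ n * fact k * fact (n - k)) / (2 * ?s) = - \<kappa> * 2 ^ n"
    proof -
      have "(4::real) ^ n = 2 ^ n * 2 ^ n" by (simp flip: power_mult_distrib)
      moreover have "k + (n - k) = n" using that by simp
      ultimately show ?thesis unfolding \<kappa>(2) by simp
    qed
    finally show ?thesis .
  qed
  have B_le: "measure ?G (B n) \<le> 4 * exp (1 / 4) * exp (- \<kappa>) * (1 / 2) ^ n" for n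
  proof -
    have n2: "Suc n \<le> 2 ^ n" using less_exp[of n] by linarith
    then have n2r: "real (Suc n) \<le> 2 ^ n" by (metis of_nat_le_iff of_nat_numeral of_nat_power)
    have \<kappa>0: "0 \<le> \<kappa>" using \<kappa>(1) ln_ge_zero[of 4] by linarith
    have "measure ?G (B n) \<le> (\<Sum>k\<le>n. measure ?G (A n k))"
      unfolding B_def using A_sets by (intro measure_UNION_le) auto
    also have "\<dots> \<le> (\<Sum>k\<le>n. 4 * exp (1 / 4) * exp (- \<kappa> * 2 ^ n))" by (intro sum_mono A_le) simp
    also have "\<dots> = real (Suc n) * (4 * exp (1 / 4) * exp (- \<kappa> * 2 ^ n))" by simp
    also have "\<dots> \<le> 2 ^ n * (4 * exp (1 / 4) * (exp (- \<kappa>) * (1 / 4) ^ n))"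
    proof (intro mult_mono mult_left_mono n2r)
      have "exp (- \<kappa> * 2 ^ n) \<le> exp (- \<kappa> * real (Suc n))" using n2r \<kappa>0 by (simp add: mult_left_mono)
      also have "\<dots> = exp (- \<kappa>) * exp (- \<kappa>) ^ n" by (simp add: exp_of_nat_mult[symmetric] exp_add[symmetric] algebra_simps)
      also have "\<dots> \<le> exp (- \<kappa>) * (1 / 4) ^ n"
      proof (intro mult_left_mono power_mono)
        have "exp (- \<kappa>) \<le> exp (- ln 4)" using \<kappa>(1) by simp
        then show "exp (- \<kappa>) \<le> 1 / 4" by (simp add: exp_minus inverse_eq_divide)
      qed auto
      finally show "exp (- \<kappa> * 2 ^ n) \<le> exp (- \<kappa>) * (1 / 4) ^ n" .
    qed auto
    also have "\<dots> = 4 * exp (1 / 4) * exp (- \<kappa>) * (2 ^ n * (1 / 4) ^ n)" by simp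
    also have "(2::real) ^ n * (1 / 4) ^ n = (1 / 2) ^ n" by (simp flip: power_mult_distrib)
    finally show ?thesis .
  qed
  have sums: "(\<lambda>n. 4 * exp (1 / 4) * exp (- \<kappa>) * (1 / 2) ^ n) sums (4 * exp (1 / 4) * exp (- \<kappa>) * 2)"
    using sums_mult[OF geometric_sums[of "1 / 2 :: real"], of "4 * exp (1 / 4) * exp (- \<kappa>)"] by simp
  have summ: "summable (\<lambda>n. measure ?G (B n))"
    by (rule summable_comparison_test'[OF sums_summable[OF sums], of 0]) (use B_le in auto)
  have "measure ?G (\<Union>n. B n) \<le> (\<Sum>n. measure ?G (B n))"
    using B_sets by (intro G.finite_measure_subadditive_countably summ) auto
  also have "\<dots> \<le> (\<Sum>n. 4 * exp (1 / 4) * exp (- \<kappa>) * (1 / 2) ^ n)"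
    by (intro suminf_le B_le summ sums_summable[OF sums])
  also have "\<dots> = 8 * exp (1 / 4) * exp (- \<kappa>)" using sums_unique[OF sums] by simp
  finally show "measure ?G (rough_event p y1 y2 d \<theta> K) \<le> 8 * exp (1 / 4) * exp (- \<kappa>)" unfolding eq .
qed

section \<open>The Gaussian measure and the amoeba\<close>

lemma density_PiM_lborel:
  fixes f :: "'a::euclidean_space \<Rightarrow> ennreal"
  assumes I: "finite I" and f [measurable]: "f \<in> borel_measurable borel"
    and sf: "sigma_finite_measure (density lborel f)"
  shows "density (\<Pi>\<^sub>M i\<in>I. lborel) (\<lambda>a. \<Prod>i\<in>I. f (a i)) = (\<Pi>\<^sub>M i\<in>I. density lborel f)"
proof -
  interpret D: product_sigma_finite "\<lambda>_. density lborel f" by (rule product_sigma_finite.intro) (rule sf)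
  interpret L: product_sigma_finite "\<lambda>_. lborel :: 'a measure" ..
  show ?thesis
  proof (rule D.PiM_eqI[OF I])
    show "sets (density (\<Pi>\<^sub>M i\<in>I. lborel) (\<lambda>a. \<Prod>i\<in>I. f (a i))) = sets (\<Pi>\<^sub>M i\<in>I. density lborel f)"
      unfolding sets_density by (intro sets_PiM_cong) auto
    fix A assume A: "\<And>i. i \<in> I \<Longrightarrow> A i \<in> sets (density lborel f)"
    then have A' [measurable]: "\<And>i. i \<in> I \<Longrightarrow> A i \<in> sets borel" by simp
    have "Pi\<^sub>E I A \<in> sets (\<Pi>\<^sub>M i\<in>I. lborel)" using I A' by (intro sets_PiM_I_finite) auto
    then have "emeasure (density (\<Pi>\<^sub>M i\<in>I. lborel) (\<lambda>a. \<Prod>i\<in>I. f (a i))) (Pi\<^sub>E I A)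
       = (\<integral>\<^sup>+a. (\<Prod>i\<in>I. f (a i)) * indicator (Pi\<^sub>E I A) a \<partial>(\<Pi>\<^sub>M i\<in>I. lborel))"
      by (subst emeasure_density) (auto simp: I)
    also have "\<dots> = (\<integral>\<^sup>+a. (\<Prod>i\<in>I. f (a i) * indicator (A i) (a i)) \<partial>(\<Pi>\<^sub>M i\<in>I. lborel))"
    proof (rule nn_integral_cong)
      fix a :: "'b \<Rightarrow> 'a" assume "a \<in> space (\<Pi>\<^sub>M i\<in>I. lborel)"
      then have "a \<in> extensional I" by (simp add: space_PiM PiE_def)
      then have "indicator (Pi\<^sub>E I A) a = (\<Prod>i\<in>I. indicator (A i) (a i) :: ennreal)"
        using I by (auto simp: indicator_def PiE_def Pi_def)
      then show "(\<Prod>i\<in>I. f (a i)) * indicator (Pi\<^sub>E I A) a = (\<Prod>i\<in>I. f (a i) * indicator (A i) (a i))"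
        by (simp add: prod.distrib)
    qed
    also have "\<dots> = (\<Prod>i\<in>I. \<integral>\<^sup>+x. f x * indicator (A i) x \<partial>lborel)"
      by (rule L.product_nn_integral_prod[OF I]) measurable
    also have "\<dots> = (\<Prod>i\<in>I. emeasure (density lborel f) (A i))"
      by (intro prod.cong refl) (simp add: emeasure_density)
    finally show "emeasure (density (\<Pi>\<^sub>M i\<in>I. lborel) (\<lambda>a. \<Prod>i\<in>I. f (a i))) (Pi\<^sub>E I A) = (\<Prod>i\<in>I. emeasure (density lborel f) (A i))" .
  qed
qed

definition scale_coeffs :: "nat \<Rightarrow> (nat ^ 3 \<Rightarrow> complex) \<Rightarrow> nat ^ 3 \<Rightarrow> complex" where
  "scale_coeffs d a = (\<lambda>\<alpha>\<in>exponents d. a \<alpha> / complex_of_real (sqrt (monomial_normsq d \<alpha>)))"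

lemma monomial_normsq_pos: "0 < monomial_normsq d \<alpha>"
  by (auto simp: monomial_normsq_def intro!: prod_pos divide_pos_pos)

lemma poly_normsq_scale_coeffs: "poly_normsq d (scale_coeffs d a) = (\<Sum>\<alpha>\<in>exponents d. (cmod (a \<alpha>))\<^sup>2)"
proof -
  have "scale_coeffs d a \<alpha> * cnj (scale_coeffs d a \<alpha>) * complex_of_real (monomial_normsq d \<alpha>) = complex_of_real ((cmod (a \<alpha>))\<^sup>2)"
    if "\<alpha> \<in> exponents d" for \<alpha>
  proof -
    define m where "m = monomial_normsq d \<alpha>"
    have m: "0 < m" unfolding m_def by (rule monomial_normsq_pos)
    have "scale_coeffs d a \<alpha> * cnj (scale_coeffs d a \<alpha>) = a \<alpha> * cnj (a \<alpha>) / (complex_of_real (sqrt m) * complex_of_real (sqrt m))"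
      using that by (simp add: scale_coeffs_def m_def)
    also have "complex_of_real (sqrt m) * complex_of_real (sqrt m) = complex_of_real m"
      using m by (simp flip: of_real_mult)
    finally have "scale_coeffs d a \<alpha> * cnj (scale_coeffs d a \<alpha>) * complex_of_real m = a \<alpha> * cnj (a \<alpha>)"
      using m by simp
    then show ?thesis by (simp only: m_def complex_norm_square)
  qed
  then show ?thesis unfolding poly_normsq_def herm_prod_def by (simp only: Re_sum Re_complex_of_real cong: sum.cong)
qed

text \<open>In orthonormal coordinates the squared norm is the sum of the |a_\<alpha>|^2, so the
  density is a product with one factor per exponent; \<open>card_exponents\<close> matches the power
  of pi.\<close>

lemma gaussian_polys_eq:
  "gaussian_polys d = distr (iid_gaussian (exponents d)) (\<Pi>\<^sub>M \<alpha>\<in>exponents d. borel) (scale_coeffs d)"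
proof -
  let ?L = "\<Pi>\<^sub>M \<alpha>\<in>exponents d. lborel :: complex measure" and ?B = "\<Pi>\<^sub>M \<alpha>\<in>exponents d. borel :: complex measure"
  have sf: "sigma_finite_measure (density lborel (\<lambda>z. ennreal (exp (- (cmod z)\<^sup>2) / pi)))"
    using prob_space_imp_sigma_finite[OF prob_space_complex_gaussian] by (simp add: complex_gaussian_def)
  have m: "scale_coeffs d \<in> measurable ?L ?B" unfolding scale_coeffs_def[abs_def] by measurable
  have eq: "ennreal (exp (- poly_normsq d (scale_coeffs d a)) / pi ^ dim_polys d) =
      (\<Prod>\<alpha>\<in>exponents d. ennreal (exp (- (cmod (a \<alpha>))\<^sup>2) / pi))" for a
    by (simp add: prod_ennreal poly_normsq_scale_coeffs prod_dividef card_exponents exp_sum[symmetric] finite_exponents sum_negf)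
  have "gaussian_polys d = density (distr ?L ?B (scale_coeffs d)) (\<lambda>P. ennreal (exp (- poly_normsq d P) / pi ^ dim_polys d))"
    unfolding gaussian_polys_def lebesgue_polys_def scale_coeffs_def[abs_def] ..
  also have "\<dots> = distr (density ?L (\<lambda>a. ennreal (exp (- poly_normsq d (scale_coeffs d a)) / pi ^ dim_polys d))) ?B (scale_coeffs d)"
    by (rule density_distr) (use m in \<open>auto simp: poly_normsq_def herm_prod_def\<close>)
  also have "density ?L (\<lambda>a. ennreal (exp (- poly_normsq d (scale_coeffs d a)) / pi ^ dim_polys d)) = iid_gaussian (exponents d)"
    unfolding eq iid_gaussian_def complex_gaussian_def
    by (rule density_PiM_lborel[OF finite_exponents _ sf]) measurable
  finally show ?thesis .
qed

lemma measurable_scale_coeffs: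
  "scale_coeffs d \<in> measurable (iid_gaussian (exponents d)) (\<Pi>\<^sub>M \<alpha>\<in>exponents d. borel)"
  unfolding scale_coeffs_def[abs_def] by measurable

lemma prob_space_gaussian_polys: "prob_space (gaussian_polys d)"
proof -
  interpret prob_space "iid_gaussian (exponents d)" by (rule prob_space_iid_gaussian)
  show ?thesis unfolding gaussian_polys_eq by (rule prob_space_distr[OF measurable_scale_coeffs])
qed

lemma sets_gaussian_polys [measurable_cong]: "sets (gaussian_polys d) = sets (\<Pi>\<^sub>M \<alpha>\<in>exponents d. borel)"
  by (simp add: gaussian_polys_eq)

lemma poly_eval_smult: "poly_eval d P (c *s x) = c ^ d * poly_eval d P x"
proof -
  have "(\<Prod>k\<in>UNIV. (c *s x) $ k ^ (\<alpha> $ k)) = c ^ d * (\<Prod>k\<in>UNIV. x $ k ^ (\<alpha> $ k))" if "\<alpha> \<in> exponents d" for \<alpha>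
  proof -
    have "(\<Prod>k\<in>UNIV. (c *s x) $ k ^ (\<alpha> $ k)) = (\<Prod>k\<in>UNIV. c ^ (\<alpha> $ k)) * (\<Prod>k\<in>UNIV. x $ k ^ (\<alpha> $ k))"
      by (simp only: vector_smult_component power_mult_distrib prod.distrib)
    also have "(\<Prod>k\<in>UNIV. c ^ (\<alpha> $ k)) = c ^ d"
      using that unfolding exponents_def mem_Collect_eq by (simp only: power_sum[symmetric])
    finally show ?thesis .
  qed
  then show ?thesis unfolding poly_eval_def sum_distrib_left
    by (intro sum.cong refl) simp
qed

text \<open>By homogeneity, vanishing at one representative of a projective point is vanishing at
  all of them.\<close>

lemma affine_chart_in_zero_locus_iff:
  "affine_chart z \<in> zero_locus d P \<longleftrightarrow> poly_eval d P (vector [1, fst z, snd z]) = 0"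
proof -
  let ?v = "vector [1, fst z, snd z] :: complex ^ 3"
  have v: "?v \<noteq> 0"
  proof
    assume "?v = 0"
    then have "?v $ 1 = 0" by (simp only: zero_index)
    then show False by simp
  qed
  then have "affine_chart z \<in> CP2" unfolding CP2_def affine_chart_def by (intro quotientI) auto
  moreover have "(?v, ?v) \<in> proj_rel" using equiv_proj_rel v unfolding equiv_def refl_on_def by blast
  then have "?v \<in> affine_chart z" unfolding affine_chart_def by blast
  moreover have "\<exists>c. x = c *s ?v" if "x \<in> affine_chart z" for x
    using that unfolding affine_chart_def proj_rel_def by auto
  moreover have "poly_eval d P (c *s ?v) = 0" if "poly_eval d P ?v = 0" for c
    using that by (simp add: poly_eval_smult)
  ultimately show ?thesis
    unfolding zero_locus_def mem_Collect_eq by blast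
qed

section \<open>Torus coordinates and measurability of the amoeba\<close>

lemma prod_UNIV_3: "(\<Prod>k\<in>UNIV. f k) = f 1 * f 2 * f (3 :: 3)" for f :: "3 \<Rightarrow> 'a :: comm_monoid_mult"
  unfolding UNIV_3 by (simp add: ac_simps)

text \<open>Parametrises the fibre of \<open>Log_map\<close> over \<open>t\<close> by pairs of unit
  complex numbers, a compact set that does not depend on \<open>t\<close>.\<close>

definition torus_point :: "real \<times> real \<Rightarrow> complex \<times> complex \<Rightarrow> complex ^ 3" where
  "torus_point t u = vector [1, of_real (exp (fst t)) * fst u, of_real (exp (snd t)) * snd u]"

lemma mem_amoeba_iff:
  "t \<in> amoeba d P \<longleftrightarrow> (\<exists>u\<in>sphere 0 1 \<times> sphere 0 1. poly_eval d P (torus_point t u) = 0)"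
proof
  assume "t \<in> amoeba d P"
  then obtain z where "z \<in> complex_torus" "affine_chart z \<in> zero_locus d P" "t = Log_map z"
    unfolding amoeba_def by auto
  then have z: "fst z \<noteq> 0" "snd z \<noteq> 0" "t = Log_map z" "poly_eval d P (vector [1, fst z, snd z]) = 0"
    by (auto simp: complex_torus_def affine_chart_in_zero_locus_iff)
  have polar: "complex_of_real (exp (ln (cmod w))) * sgn w = w" if "w \<noteq> 0" for w
    using that by (simp add: sgn_eq)
  have "torus_point t (sgn (fst z), sgn (snd z)) = vector [1, fst z, snd z]"
    by (simp only: torus_point_def z(3) Log_map_def fst_conv snd_conv polar[OF z(1)] polar[OF z(2)])
  then show "\<exists>u\<in>sphere 0 1 \<times> sphere 0 1. poly_eval d P (torus_point t u) = 0"
    using z(1,2,4) by (intro bexI[of _ "(sgn (fst z), sgn (snd z))"]) (simp_all add: norm_sgn)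
next
  assume "\<exists>u\<in>sphere 0 1 \<times> sphere 0 1. poly_eval d P (torus_point t u) = 0"
  then obtain u where u: "cmod (fst u) = 1" "cmod (snd u) = 1" "poly_eval d P (torus_point t u) = 0" by auto
  let ?z = "(of_real (exp (fst t)) * fst u, of_real (exp (snd t)) * snd u)"
  have "?z \<in> complex_torus" using u by (auto simp: complex_torus_def)
  moreover have "Log_map ?z = t" using u by (simp add: Log_map_def norm_mult)
  moreover have "affine_chart ?z \<in> zero_locus d P"
    using u unfolding affine_chart_in_zero_locus_iff torus_point_def by simp
  ultimately show "t \<in> amoeba d P"
    unfolding amoeba_def by (intro image_eqI[of t Log_map ?z] CollectI conjI) simp_all
qed

text \<open>A version for arbitrary homogeneous coordinates: the zeros found later have a phase, not
  1, as first coordinate.\<close>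

lemma mem_amoebaI:
  assumes x: "cmod (x $ 2) = exp (fst t) * cmod (x $ 1)" "cmod (x $ 3) = exp (snd t) * cmod (x $ 1)" "x $ 1 \<noteq> 0"
    and P: "poly_eval d P x = 0"
  shows "t \<in> amoeba d P"
proof -
  let ?u = "(x $ 2 / x $ 1 / of_real (exp (fst t)), x $ 3 / x $ 1 / of_real (exp (snd t)))"
  have "torus_point t ?u = (1 / x $ 1) *s x"
    using x(3) by (simp add: torus_point_def vec_eq_iff forall_3)
  then have "poly_eval d P (torus_point t ?u) = 0" using P by (simp add: poly_eval_smult)
  moreover have "?u \<in> sphere 0 1 \<times> sphere 0 1" using x by (auto simp: norm_divide norm_mult)
  ultimately show ?thesis unfolding mem_amoeba_iff by blast
qed

text \<open>Membership asks for a zero on an uncountable torus. By compactness a zero exists as soon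
  as the modulus takes arbitrarily small values, and by continuity these can be sought on a
  countable dense subset. Joint measurability in the polynomial and the point is what Tonelli's
  theorem requires.\<close>

lemma measurable_mem_amoeba:
  "Measurable.pred (gaussian_polys d \<Otimes>\<^sub>M borel) (\<lambda>p. snd p \<in> amoeba d (fst p))"
proof -
  let ?S = "sphere 0 1 \<times> sphere 0 1 :: (complex \<times> complex) set"
  obtain D where D: "countable D" "D \<subseteq> ?S" "?S \<subseteq> closure D" using separable[of ?S] by blast
  have "continuous_on UNIV (\<lambda>u. poly_eval d P (torus_point t u))" for P t
    unfolding poly_eval_def torus_point_def prod_UNIV_3 vector_3 by (intro continuous_intros)
  then have cont: "continuous_on UNIV (\<lambda>u. cmod (poly_eval d P (torus_point t u)))" for P t
    by (rule continuous_on_norm)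
  have iff: "t \<in> amoeba d P \<longleftrightarrow> (\<forall>n. \<exists>u\<in>D. cmod (poly_eval d P (torus_point t u)) < 1 / real (Suc n))" for P t
  proof
    assume "t \<in> amoeba d P"
    then obtain u where u: "u \<in> ?S" "poly_eval d P (torus_point t u) = 0" unfolding mem_amoeba_iff by blast
    show "\<forall>n. \<exists>u\<in>D. cmod (poly_eval d P (torus_point t u)) < 1 / real (Suc n)"
    proof
      fix n
      have "open {u. cmod (poly_eval d P (torus_point t u)) < 1 / real (Suc n)}"
        by (intro open_Collect_less cont continuous_on_const)
      moreover have "u \<in> {u. cmod (poly_eval d P (torus_point t u)) < 1 / real (Suc n)}" using u by simp
      moreover have "u \<in> closure D" using u D by blast
      ultimately have "{u. cmod (poly_eval d P (torus_point t u)) < 1 / real (Suc n)} \<inter> D \<noteq> {}"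
        by (subst open_Int_closure_eq_empty[symmetric]) auto
      then show "\<exists>u\<in>D. cmod (poly_eval d P (torus_point t u)) < 1 / real (Suc n)" by blast
    qed
  next
    assume small: "\<forall>n. \<exists>u\<in>D. cmod (poly_eval d P (torus_point t u)) < 1 / real (Suc n)"
    have "compact ?S" by (intro compact_Times compact_sphere)
    moreover have "?S \<noteq> {}" using small D by blast
    ultimately have "\<exists>u\<in>?S. \<forall>v\<in>?S. cmod (poly_eval d P (torus_point t u)) \<le> cmod (poly_eval d P (torus_point t v))"
      by (rule continuous_attains_inf) (rule continuous_on_subset[OF cont subset_UNIV])
    then obtain u where u: "u \<in> ?S"
      "\<forall>v\<in>?S. cmod (poly_eval d P (torus_point t u)) \<le> cmod (poly_eval d P (torus_point t v))" ..
    have less: "cmod (poly_eval d P (torus_point t u)) < 1 / real (Suc n)" for n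
    proof -
      obtain v where "v \<in> D" "cmod (poly_eval d P (torus_point t v)) < 1 / real (Suc n)" using small by blast
      with u(2) D(2) show ?thesis by (blast intro: order_le_less_trans)
    qed
    have "poly_eval d P (torus_point t u) = 0"
    proof (rule ccontr)
      assume "poly_eval d P (torus_point t u) \<noteq> 0"
      then have "0 < cmod (poly_eval d P (torus_point t u))" by simp
      then obtain n where "inverse (real (Suc n)) < cmod (poly_eval d P (torus_point t u))"
        using reals_Archimedean by blast
      with less[of n] show False by (simp add: inverse_eq_divide)
    qed
    with u show "t \<in> amoeba d P" unfolding mem_amoeba_iff by blast
  qed
  have meas: "(\<lambda>p. poly_eval d (fst p) (torus_point (snd p) u)) \<in> borel_measurable (gaussian_polys d \<Otimes>\<^sub>M borel)" for u
  proof -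
    have 1: "(\<lambda>p. fst p \<alpha>) \<in> borel_measurable (gaussian_polys d \<Otimes>\<^sub>M (borel :: (real \<times> real) measure))" if "\<alpha> \<in> exponents d" for \<alpha>
      using that by (intro measurable_compose[OF measurable_fst]) measurable
    have 2: "(\<lambda>p. complex_of_real (exp (fst (snd p)))) \<in> borel_measurable (gaussian_polys d \<Otimes>\<^sub>M (borel :: (real \<times> real) measure))"
      "(\<lambda>p. complex_of_real (exp (snd (snd p)))) \<in> borel_measurable (gaussian_polys d \<Otimes>\<^sub>M (borel :: (real \<times> real) measure))"
      by (rule measurable_compose[OF measurable_snd], intro borel_measurable_continuous_onI continuous_intros)+
    show ?thesis unfolding poly_eval_def torus_point_def prod_UNIV_3 vector_3
      by (intro borel_measurable_sum borel_measurable_times borel_measurable_power borel_measurable_const 1 2)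
  qed
  show ?thesis
    unfolding iff
  proof (intro pred_intros_countable(1))
    fix n
    have "{p \<in> space (gaussian_polys d \<Otimes>\<^sub>M borel). cmod (poly_eval d (fst p) (torus_point (snd p) u)) < 1 / real (Suc n)}
        \<in> sets (gaussian_polys d \<Otimes>\<^sub>M borel)" for u
      by (rule borel_measurable_less[OF measurable_compose[OF meas borel_measurable_norm] borel_measurable_const])
    then show "Measurable.pred (gaussian_polys d \<Otimes>\<^sub>M borel)
        (\<lambda>p. \<exists>u\<in>D. cmod (poly_eval d (fst p) (torus_point (snd p) u)) < 1 / real (Suc n))"
      unfolding pred_def by (intro sets.sets_Collect_countable_Ex' D(1)) auto
  qed
qed

section \<open>The density of the expected measure\<close>

definition hit_prob :: "nat \<Rightarrow> real \<times> real \<Rightarrow> real" where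
  "hit_prob d t = measure (gaussian_polys d) {P \<in> space (gaussian_polys d). t \<in> amoeba d P}"

lemma sets_hit_event: "{P \<in> space (gaussian_polys d). t \<in> amoeba d P} \<in> sets (gaussian_polys d)"
proof -
  have "(\<lambda>P. (P, t)) \<in> measurable (gaussian_polys d) (gaussian_polys d \<Otimes>\<^sub>M borel)" by measurable
  from measurable_compose[OF this measurable_mem_amoeba] show ?thesis by (simp add: pred_def)
qed

lemma hit_prob_bounds: "0 \<le> hit_prob d t" "hit_prob d t \<le> 1"
  using prob_space.prob_le_1[OF prob_space_gaussian_polys] by (auto simp: hit_prob_def)

lemma expected_amoeba_measure_eq:
  "(\<lambda>t. hit_prob d t) \<in> borel_measurable borel"
  "expected_amoeba_measure d = density lborel (\<lambda>t. ennreal (hit_prob d t))"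
proof -
  let ?G = "gaussian_polys d"
  interpret G: prob_space ?G by (rule prob_space_gaussian_polys)
  interpret p: pair_sigma_finite ?G "lborel :: (real \<times> real) measure" ..
  let ?f = "\<lambda>p. indicator {p \<in> space (?G \<Otimes>\<^sub>M lborel). snd p \<in> amoeba d (fst p)} p :: ennreal"
  have "Measurable.pred (?G \<Otimes>\<^sub>M (lborel :: (real \<times> real) measure)) (\<lambda>p. snd p \<in> amoeba d (fst p))"
    using measurable_mem_amoeba[of d] by (subst measurable_cong_sets[OF sets_pair_measure_cong[OF refl sets_lborel] refl])
  then have f: "?f \<in> borel_measurable (?G \<Otimes>\<^sub>M lborel)"
    by (intro borel_measurable_indicator) (simp add: pred_def)
  have f_eq: "?f (P, t) = indicator (amoeba d P) t" if "P \<in> space ?G" for P t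
    using that by (auto simp: space_pair_measure indicator_def)
  have inner: "(\<integral>\<^sup>+P. ?f (P, t) \<partial>?G) = ennreal (hit_prob d t)" for t
  proof -
    have "(\<integral>\<^sup>+P. ?f (P, t) \<partial>?G) = (\<integral>\<^sup>+P. indicator {P \<in> space ?G. t \<in> amoeba d P} P \<partial>?G)"
      by (intro nn_integral_cong) (auto simp: indicator_def space_pair_measure)
    also have "\<dots> = emeasure ?G {P \<in> space ?G. t \<in> amoeba d P}"
      by (rule nn_integral_indicator[OF sets_hit_event])
    finally show ?thesis by (simp add: hit_prob_def G.emeasure_eq_measure)
  qed
  have "(\<lambda>t. \<integral>\<^sup>+P. ?f (P, t) \<partial>?G) \<in> borel_measurable lborel"
    using G.borel_measurable_nn_integral_fst[OF measurable_pair_swap[OF f]] by simp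
  then have "(\<lambda>t. ennreal (hit_prob d t)) \<in> borel_measurable borel" unfolding inner by simp
  then have "(\<lambda>t. enn2real (ennreal (hit_prob d t))) \<in> borel_measurable borel" by measurable
  then show m: "(\<lambda>t. hit_prob d t) \<in> borel_measurable borel" by (simp add: hit_prob_bounds)
  have "(\<integral>\<^sup>+P. emeasure (amoeba_measure d P) B \<partial>?G) = emeasure (density lborel (\<lambda>t. ennreal (hit_prob d t))) B"
    if B: "B \<in> sets borel" for B
  proof -
    have "(\<integral>\<^sup>+P. emeasure (amoeba_measure d P) B \<partial>?G) = (\<integral>\<^sup>+P. \<integral>\<^sup>+t. ?f (P, t) * indicator B t \<partial>lborel \<partial>?G)"
    proof (rule nn_integral_cong)
      fix P assume P: "P \<in> space ?G"
      have "(\<lambda>t. ?f (P, t)) \<in> borel_measurable lborel"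
        using P by (intro measurable_compose[OF measurable_Pair1' f])
      then have m: "(indicator (amoeba d P) :: _ \<Rightarrow> ennreal) \<in> borel_measurable lborel"
        unfolding f_eq[OF P] .
      show "emeasure (amoeba_measure d P) B = (\<integral>\<^sup>+t. ?f (P, t) * indicator B t \<partial>lborel)"
        unfolding amoeba_measure_def f_eq[OF P] using B by (intro emeasure_density m) simp
    qed
    also have "\<dots> = (\<integral>\<^sup>+t. \<integral>\<^sup>+P. ?f (P, t) * indicator B t \<partial>?G \<partial>lborel)"
    proof (rule p.Fubini'[symmetric])
      have "(\<lambda>p. ?f p * indicator B (snd p)) \<in> borel_measurable (?G \<Otimes>\<^sub>M lborel)"
        using B by (intro borel_measurable_times_ennreal f measurable_compose[OF measurable_snd] borel_measurable_indicator) simp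
      then show "(\<lambda>(P, t). ?f (P, t) * indicator B t) \<in> borel_measurable (?G \<Otimes>\<^sub>M lborel)"
        by (simp add: case_prod_beta')
    qed
    also have "\<dots> = (\<integral>\<^sup>+t. ennreal (hit_prob d t) * indicator B t \<partial>lborel)"
    proof (rule nn_integral_cong)
      fix t
      have "(\<lambda>P. ?f (P, t)) \<in> borel_measurable ?G"
        by (intro measurable_compose[OF _ f]) measurable
      then show "(\<integral>\<^sup>+P. ?f (P, t) * indicator B t \<partial>?G) = ennreal (hit_prob d t) * indicator B t"
        by (subst nn_integral_multc) (simp_all only: inner)
    qed
    also have "\<dots> = emeasure (density lborel (\<lambda>t. ennreal (hit_prob d t))) B"
      using B m by (subst emeasure_density) auto
    finally show ?thesis .
  qed
  \<comment> \<open>\<open>measure_of\<close> depends only on the values on the sigma-algebra, where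
    the set function now agrees with a genuine measure; countable additivity is inherited from
    there.\<close>
  then have "expected_amoeba_measure d = measure_of UNIV (sets borel) (emeasure (density lborel (\<lambda>t. ennreal (hit_prob d t))))"
    unfolding expected_amoeba_measure_def
    by (intro measure_of_eq) (auto simp: sets.sigma_sets_eq[of borel, simplified])
  then show "expected_amoeba_measure d = density lborel (\<lambda>t. ennreal (hit_prob d t))"
    using measure_of_of_measure[of "density lborel (\<lambda>t. ennreal (hit_prob d t))"] by simp
qed

lemma expected_amoeba_measure_tendsto:
  fixes \<phi> :: "real \<times> real \<Rightarrow> real"
  assumes hit: "\<And>t. (\<lambda>d. hit_prob d t) \<longlonglongrightarrow> 1"
    and cont: "continuous_on UNIV \<phi>"
    and supp: "compact (closure {t. \<phi> t \<noteq> 0})"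
  shows "(\<lambda>d. \<integral>t. \<phi> t \<partial>expected_amoeba_measure d) \<longlonglongrightarrow> (\<integral>t. \<phi> t \<partial>lborel)"
proof -
  let ?K = "closure {t. \<phi> t \<noteq> 0}"
  have m [measurable]: "\<phi> \<in> borel_measurable borel" using cont by (rule borel_measurable_continuous_onI)
  have "integrable lborel (\<lambda>t. indicator ?K t *\<^sub>R \<phi> t)"
    using borel_integrable_compact[OF supp continuous_on_subset[OF cont subset_UNIV]] by (simp add: set_integrable_def)
  moreover have "indicator ?K t *\<^sub>R \<phi> t = \<phi> t" for t
    using closure_subset[of "{t. \<phi> t \<noteq> 0}"] by (auto simp: indicator_def)
  ultimately have i: "integrable lborel \<phi>" by (simp only:)
  have eq: "(\<integral>t. \<phi> t \<partial>expected_amoeba_measure d) = (\<integral>t. hit_prob d t *\<^sub>R \<phi> t \<partial>lborel)" for d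
    unfolding expected_amoeba_measure_eq(2)
    by (rule integral_density) (use m expected_amoeba_measure_eq(1)[of d] in \<open>auto simp: hit_prob_bounds\<close>)
  show ?thesis unfolding eq
  proof (rule integral_dominated_convergence[where w="\<lambda>t. \<bar>\<phi> t\<bar>"])
    show "AE t in lborel. (\<lambda>d. hit_prob d t *\<^sub>R \<phi> t) \<longlonglongrightarrow> \<phi> t"
    proof (rule AE_I2)
      fix t show "(\<lambda>d. hit_prob d t *\<^sub>R \<phi> t) \<longlonglongrightarrow> \<phi> t"
        using tendsto_mult[OF hit[of t] tendsto_const[of "\<phi> t"]] by simp
    qed
    show "AE t in lborel. norm (hit_prob d t *\<^sub>R \<phi> t) \<le> \<bar>\<phi> t\<bar>" for d
      using hit_prob_bounds by (intro AE_I2) (simp add: abs_mult mult_left_le_one_le)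
    show "(\<lambda>t. hit_prob d t *\<^sub>R \<phi> t) \<in> borel_measurable lborel" for d
      using expected_amoeba_measure_eq(1)[of d] by measurable
  qed (use i in auto)
qed

section \<open>The probability of meeting a torus\<close>

text \<open>A Chebyshev argument for the average X of the \<open>\<psi> j\<close>. On
  \<open>E\<close> this average is at most \<open>\<epsilon>\<close> plus the fraction Z of indices
  whose exceptional event \<open>B j\<close> occurs, so \<open>m\<close> is at most |X - m| +
  \<open>\<epsilon>\<close> + Z; squaring costs the factor 3. The bound contains the expanded
  expectation of (X - m)^2, in a form whose limit can be taken term by term.\<close>

lemma (in prob_space) second_moment_event:
  fixes \<psi> :: "nat \<Rightarrow> 'a \<Rightarrow> real" and \<epsilon> \<delta> m :: real
  assumes L: "0 < L" and \<epsilon>: "0 \<le> \<epsilon>" and m: "0 \<le> m"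
    and \<psi> [measurable]: "\<And>j. \<psi> j \<in> borel_measurable M" and \<psi>01: "\<And>j a. 0 \<le> \<psi> j a" "\<And>j a. \<psi> j a \<le> 1"
    and E: "E \<in> events" and B: "\<And>j. B j \<in> events" "\<And>j. prob (B j) \<le> \<delta>"
    and small: "\<And>j a. a \<in> E \<Longrightarrow> a \<notin> B j \<Longrightarrow> \<psi> j a \<le> \<epsilon>"
  shows "m\<^sup>2 * prob E \<le> 3 * ((\<Sum>i<L. \<Sum>j<L. expectation (\<lambda>a. \<psi> i a * \<psi> j a)) / (real L)\<^sup>2
     - 2 * m * (\<Sum>j<L. expectation (\<psi> j)) / real L + m\<^sup>2 + \<epsilon>\<^sup>2 + \<delta>)"
proof -
  define X where "X a = (\<Sum>j<L. \<psi> j a) / real L" for a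
  define Z where "Z a = (\<Sum>j<L. indicator (B j) a) / real L" for a
  have L0: "0 < real L" using L by simp
  have i1: "integrable M (\<psi> j)" for j using \<psi>01 by (intro integrable_const_bound[where B=1]) auto
  have i2: "integrable M (\<lambda>a. \<psi> i a * \<psi> j a)" for i j
    using \<psi>01 by (intro integrable_const_bound[where B=1]) (auto simp: abs_mult mult_le_one)
  have i3: "integrable M (indicator (B j) :: 'a \<Rightarrow> real)" for j
    using B(1)[of j] by (intro integrable_real_indicator) (auto simp: emeasure_eq_measure)
  have pt: "m\<^sup>2 * indicator E a \<le> 3 * ((X a - m)\<^sup>2 + \<epsilon>\<^sup>2 + Z a)" for a
  proof (cases "a \<in> E")
    case True
    have "X a \<le> (\<Sum>j<L. \<epsilon> + indicator (B j) a) / real L"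
      unfolding X_def
    proof (intro divide_right_mono sum_mono)
      fix j show "\<psi> j a \<le> \<epsilon> + indicator (B j) a"
        using small[OF True, of j] \<psi>01(2)[of j a] \<epsilon> by (cases "a \<in> B j") auto
    qed simp
    also have "\<dots> = \<epsilon> + Z a" using L0 by (simp add: Z_def sum.distrib add_divide_distrib)
    finally have "X a \<le> \<epsilon> + Z a" .
    then have mle: "m \<le> \<bar>X a - m\<bar> + \<epsilon> + Z a" by linarith
    have Z01: "0 \<le> Z a" "Z a \<le> 1"
    proof -
      show "0 \<le> Z a" unfolding Z_def by (intro divide_nonneg_nonneg sum_nonneg) auto
      have "(\<Sum>j<L. indicator (B j) a :: real) \<le> (\<Sum>j<L. 1)" by (intro sum_mono) (auto simp: indicator_def)
      then show "Z a \<le> 1" unfolding Z_def using L0 by simp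
    qed
    have cs: "(x + y + z)\<^sup>2 \<le> 3 * (x\<^sup>2 + y\<^sup>2 + z\<^sup>2)" for x y z :: real
      using sum_squares_bound[of x y] sum_squares_bound[of x z] sum_squares_bound[of y z]
      by (simp add: power2_eq_square algebra_simps)
    have "m\<^sup>2 \<le> (\<bar>X a - m\<bar> + \<epsilon> + Z a)\<^sup>2" using mle m by (intro power_mono)
    also have "\<dots> \<le> 3 * (\<bar>X a - m\<bar>\<^sup>2 + \<epsilon>\<^sup>2 + (Z a)\<^sup>2)" by (rule cs)
    \<comment> \<open>Z lies in the unit interval, so its square is bounded by Z itself, whose
      expectation is at most \<open>\<delta>\<close>.\<close>
    also have "\<dots> \<le> 3 * ((X a - m)\<^sup>2 + \<epsilon>\<^sup>2 + Z a)"
      using Z01 by (auto simp: power2_eq_square mult_left_le)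
    finally show ?thesis using True by simp
  next
    case False
    have "0 \<le> Z a" unfolding Z_def by (intro divide_nonneg_nonneg sum_nonneg) auto
    with False show ?thesis by simp
  qed
  have Xsq: "(X a - m)\<^sup>2 = (\<Sum>i<L. \<Sum>j<L. \<psi> i a * \<psi> j a) / (real L)\<^sup>2 - 2 * m * (\<Sum>j<L. \<psi> j a) / real L + m\<^sup>2" for a
  proof -
    have "(s / l - m)\<^sup>2 = s * s / l\<^sup>2 - 2 * m * s / l + m\<^sup>2" for s l :: real
      unfolding power2_diff power_divide by (simp add: power2_eq_square mult_ac)
    then show ?thesis unfolding X_def sum_product[symmetric] by this
  qed
  have iE: "integrable M (\<lambda>a. m\<^sup>2 * indicator E a)"
    using E by (intro integrable_mult_right integrable_real_indicator) (auto simp: emeasure_eq_measure)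
  have "m\<^sup>2 * prob E = expectation (\<lambda>a. m\<^sup>2 * indicator E a)"
    using E by simp
  also have "\<dots> \<le> expectation (\<lambda>a. 3 * ((X a - m)\<^sup>2 + \<epsilon>\<^sup>2 + Z a))"
    by (rule integral_mono[OF iE _ pt]) (use i1 i2 i3 in \<open>simp add: Xsq Z_def\<close>)
  also have "\<dots> = 3 * ((\<Sum>i<L. \<Sum>j<L. expectation (\<lambda>a. \<psi> i a * \<psi> j a)) / (real L)\<^sup>2
     - 2 * m * (\<Sum>j<L. expectation (\<psi> j)) / real L + m\<^sup>2 + \<epsilon>\<^sup>2 + (\<Sum>j<L. prob (B j)) / real L)"
    unfolding Xsq Z_def using i1 i2 i3 B(1) by (simp add: prob_space)
  also have "\<dots> \<le> 3 * ((\<Sum>i<L. \<Sum>j<L. expectation (\<lambda>a. \<psi> i a * \<psi> j a)) / (real L)\<^sup>2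
     - 2 * m * (\<Sum>j<L. expectation (\<psi> j)) / real L + m\<^sup>2 + \<epsilon>\<^sup>2 + \<delta>)"
  proof -
    have "(\<Sum>j<L. prob (B j)) \<le> (\<Sum>j<L. \<delta>)" by (intro sum_mono B(2))
    then have "(\<Sum>j<L. prob (B j)) / real L \<le> \<delta>" using L0 by (simp add: field_simps)
    then show ?thesis by simp
  qed
  finally show ?thesis .
qed

section \<open>Bumps at finitely many points of the torus\<close>

definition site :: "nat \<Rightarrow> 3 \<Rightarrow> real" where
  "site j k = (if k = 2 then 1 / real (Suc j) else 0)"

text \<open>Strict triangle inequality: positive masses with phases 0 and t are not aligned, because
  the sites 1/(j + 1) differ by 0 < |t| \<le> 1 < pi.\<close>

lemma sites_separated:
  assumes p: "\<And>k. 0 < p k" "(\<Sum>k\<in>UNIV. p k) = 1" and ij: "i \<noteq> j"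
  shows "cmod (\<Sum>k\<in>UNIV. complex_of_real (p k) * exp (\<i> * complex_of_real (site i k - site j k))) < 1"
proof -
  define t where "t = 1 / real (Suc i) - 1 / real (Suc j)"
  have t: "t \<noteq> 0" "\<bar>t\<bar> \<le> 1"
  proof -
    show "t \<noteq> 0"
    proof
      assume "t = 0"
      then have "inverse (real (Suc i)) = inverse (real (Suc j))" by (simp add: t_def inverse_eq_divide)
      then show False using ij by simp
    qed
    have "0 \<le> 1 / real (Suc n)" "1 / real (Suc n) \<le> 1" for n by auto
    then show "\<bar>t\<bar> \<le> 1" unfolding t_def by (smt (verit))
  qed
  define q where "q = p 1 + p 3"
  have q: "0 < q" "0 < p 2" "q + p 2 = 1" using p by (auto simp: q_def sum_3 add_pos_pos)
  have eq: "(\<Sum>k\<in>UNIV. complex_of_real (p k) * exp (\<i> * complex_of_real (site i k - site j k))) = of_real q + of_real (p 2) * cis t"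
    by (simp add: sum_3 site_def q_def t_def cis_conv_exp)
  have "cos t < 1"
  proof -
    have "cos \<bar>t\<bar> < cos 0" using t pi_gt3 by (intro cos_monotone_0_pi) auto
    then show ?thesis by simp
  qed
  have "(cmod (of_real q + of_real (p 2) * cis t))\<^sup>2 = (q + p 2 * cos t)\<^sup>2 + (p 2 * sin t)\<^sup>2"
    by (simp add: cmod_power2)
  also have "\<dots> = q\<^sup>2 + 2 * q * p 2 * cos t + (p 2)\<^sup>2 * ((cos t)\<^sup>2 + (sin t)\<^sup>2)"
    by algebra
  also have "\<dots> < q\<^sup>2 + 2 * q * p 2 * 1 + (p 2)\<^sup>2"
    using \<open>cos t < 1\<close> q by (simp add: mult_less_cancel_left)
  also have "\<dots> = (q + p 2)\<^sup>2" by (simp add: power2_sum)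
  also have "\<dots> = 1\<^sup>2" using q by simp
  finally show ?thesis unfolding eq by (rule power2_less_imp_less) simp
qed

text \<open>For these Taylor coefficients the localised polynomial is close to the identity map of
  the complex plane \<open>s = s\<^sub>1 + i s\<^sub>2\<close> of parameters.\<close>

definition target :: "nat \<Rightarrow> complex" where
  "target m = (if m = 0 then 0 else if m = 1 then - \<i> else 1)"

text \<open>The factor \<open>\<tau>\<close> in both the vectors and the targets makes the bump have
  width 1/\<open>\<tau>\<close>. Taking a set of sites lets single sites and pairs share one limit
  theorem, since products of bumps at distinct sites are again of this form.\<close>

definition site_bump :: "(3 \<Rightarrow> real) \<Rightarrow> (3 \<Rightarrow> real) \<Rightarrow> (3 \<Rightarrow> real) \<Rightarrow> nat \<Rightarrow> real \<Rightarrow> nat set \<Rightarrow> (nat ^ 3 \<Rightarrow> complex) \<Rightarrow> real" where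
  "site_bump p y1 y2 d \<tau> A = gauss_bump (exponents d) ({..<3} \<times> A)
     (\<lambda>(m, j) \<alpha>. complex_of_real \<tau> * phase_vec p d (frame y1 y2 d m) (site j) \<alpha>) (\<lambda>(m, j). complex_of_real \<tau> * target m)"

lemma site_bump_mult:
  assumes "i \<noteq> j"
  shows "site_bump p y1 y2 d \<tau> {i} a * site_bump p y1 y2 d \<tau> {j} a = site_bump p y1 y2 d \<tau> {i, j} a"
proof -
  have "{..<3::nat} \<times> {i, j} = {..<3} \<times> {i} \<union> {..<3} \<times> {j}" by auto
  moreover have "({..<3::nat} \<times> {i}) \<inter> ({..<3} \<times> {j}) = {}" using assms by auto
  ultimately show ?thesis
    unfolding site_bump_def gauss_bump_def exp_add[symmetric]
    by (simp add: sum.union_disjoint)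
qed

lemma site_bump_bounds: "0 \<le> site_bump p y1 y2 d \<tau> A a" "site_bump p y1 y2 d \<tau> A a \<le> 1"
  unfolding site_bump_def using gauss_bump_bounds less_imp_le by blast+

lemma measurable_site_bump [measurable]: "site_bump p y1 y2 d \<tau> A \<in> borel_measurable (iid_gaussian (exponents d))"
  unfolding site_bump_def by measurable

text \<open>The expectation of the bump at one site for d \<ge> 1 and an orthonormal frame: the
  three functionals are then independent standard Gaussians.\<close>

definition bump_mass :: "real \<Rightarrow> real" where
  "bump_mass \<tau> = (\<Prod>m<3. \<integral>z. exp (- (cmod (\<tau> * z - \<tau> * target m))\<^sup>2) \<partial>complex_gaussian)"

text \<open>The targets have modulus at most 1, whence the exponent 2 + (1 + 2)^2 = 11.\<close>

lemma bump_mass_ge: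
  assumes "1 \<le> \<tau>"
  shows "(exp (- 11) / \<tau>\<^sup>2 / pi) ^ 3 \<le> bump_mass \<tau>"
proof -
  have "(\<Prod>m<3::nat. exp (- 11) / \<tau>\<^sup>2 / pi) \<le> bump_mass \<tau>"
    unfolding bump_mass_def
  proof (intro prod_mono conjI)
    fix m
    have "cmod (target m) \<le> 1" by (simp add: target_def)
    then have "(cmod (target m) + 2)\<^sup>2 \<le> 3\<^sup>2" by (intro power_mono) auto
    then have "exp (- 11) / \<tau>\<^sup>2 / pi \<le> exp (- 2 - (cmod (target m) + 2)\<^sup>2) / \<tau>\<^sup>2 / pi"
      by (intro divide_right_mono) auto
    also have "\<dots> \<le> (\<integral>z. exp (- (cmod (\<tau> * z - \<tau> * target m))\<^sup>2) \<partial>complex_gaussian)"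
      by (rule integral_bump_lower_bound[OF assms])
    finally show "exp (- 11) / \<tau>\<^sup>2 / pi \<le> (\<integral>z. exp (- (cmod (\<tau> * z - \<tau> * target m))\<^sup>2) \<partial>complex_gaussian)" .
  qed simp
  then show ?thesis by simp
qed

text \<open>The Gram matrix is exact within a site and its entries between sites tend to zero, so it
  tends to \<open>\<tau>\<close>^2 times the identity. This is the Gram matrix of independent
  coordinates indexed by the functionals themselves, where the bump factorises.\<close>

lemma expectation_site_bump_tendsto:
  assumes on: "orthonormal_frame p y1 y2" and A: "finite A"
  shows "(\<lambda>d. \<integral>a. site_bump p y1 y2 d \<tau> A a \<partial>iid_gaussian (exponents d)) \<longlonglongrightarrow> bump_mass \<tau> ^ card A"
proof -
  let ?K = "{..<3::nat} \<times> A"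
  let ?c = "\<lambda>(m, j::nat). complex_of_real \<tau> * target m"
  let ?u = "\<lambda>k i. if i = k then complex_of_real \<tau> else 0"
  have p: "\<And>k. 0 < p k" "(\<Sum>k\<in>UNIV. p k) = 1" using on by (auto simp: orthonormal_frame_def)
  have "(\<lambda>d. \<integral>a. site_bump p y1 y2 d \<tau> A a \<partial>iid_gaussian (exponents d)) \<longlonglongrightarrow> (\<integral>a. gauss_bump ?K ?K ?u ?c a \<partial>iid_gaussian ?K)"
    unfolding site_bump_def
  proof (rule gauss_bump_tendsto[OF finite_exponents])
    show "finite ?K" "finite ?K" using A by auto
    fix k l :: "nat \<times> nat" assume kl: "k \<in> ?K" "l \<in> ?K"
    obtain m i n j where k: "k = (m, i)" and l: "l = (n, j)" by (cases k, cases l)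
    define g where "g d = (\<Sum>\<alpha>\<in>exponents d. phase_vec p d (frame y1 y2 d m) (site i) \<alpha> * cnj (phase_vec p d (frame y1 y2 d n) (site j) \<alpha>))" for d
    have "g \<longlonglongrightarrow> (if k = l then 1 else 0)"
    proof (cases "i = j")
      case True
      have "g d = (if k = l then 1 else 0)" if "1 \<le> d" for d
        using gram_frame_same[OF on that, of m n "site j"] kl True by (simp add: g_def k l)
      then show ?thesis by (intro tendsto_eventually eventually_sequentiallyI[of 1])
    next
      case False
      have "g \<longlonglongrightarrow> 0" unfolding g_def
        by (rule gram_frame_tendsto[OF less_imp_le[OF p(1)] sites_separated[OF p False]])
      then show ?thesis using False by (simp add: k l)
    qed
    then have "(\<lambda>d. complex_of_real (\<tau>\<^sup>2) * g d) \<longlonglongrightarrow> complex_of_real (\<tau>\<^sup>2) * (if k = l then 1 else 0)"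
      by (intro tendsto_mult tendsto_const)
    moreover have "(\<Sum>i\<in>exponents d. (case k of (m, j) \<Rightarrow> \<lambda>\<alpha>. complex_of_real \<tau> * phase_vec p d (frame y1 y2 d m) (site j) \<alpha>) i *
        cnj ((case l of (m, j) \<Rightarrow> \<lambda>\<alpha>. complex_of_real \<tau> * phase_vec p d (frame y1 y2 d m) (site j) \<alpha>) i)) = complex_of_real (\<tau>\<^sup>2) * g d" for d
      by (simp add: k l g_def sum_distrib_left power2_eq_square mult_ac)
    moreover have "(\<Sum>j\<in>?K. ?u k j * cnj (?u l j)) = complex_of_real (\<tau>\<^sup>2) * (if k = l then 1 else 0)"
    proof -
      have "(\<Sum>j\<in>?K. ?u k j * cnj (?u l j)) = (\<Sum>j\<in>?K. if j = k then (if k = l then complex_of_real \<tau> * complex_of_real \<tau> else 0) else 0)"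
        by (intro sum.cong refl) auto
      also have "\<dots> = (if k = l then complex_of_real \<tau> * complex_of_real \<tau> else 0)" using kl A by simp
      finally show ?thesis by (simp add: power2_eq_square)
    qed
    ultimately show "(\<lambda>d. \<Sum>i\<in>exponents d. (case k of (m, j) \<Rightarrow> \<lambda>\<alpha>. complex_of_real \<tau> * phase_vec p d (frame y1 y2 d m) (site j) \<alpha>) i *
        cnj ((case l of (m, j) \<Rightarrow> \<lambda>\<alpha>. complex_of_real \<tau> * phase_vec p d (frame y1 y2 d m) (site j) \<alpha>) i)) \<longlonglongrightarrow> (\<Sum>j\<in>?K. ?u k j * cnj (?u l j))"
      by (simp only:)
  qed
  also have "(\<integral>a. gauss_bump ?K ?K ?u ?c a \<partial>iid_gaussian ?K) = bump_mass \<tau> ^ card A"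
  proof -
    have "(\<integral>a. gauss_bump ?K ?K ?u ?c a \<partial>iid_gaussian ?K) = (\<Prod>k\<in>?K. \<integral>z. exp (- (cmod (\<tau> * z - ?c k))\<^sup>2) \<partial>complex_gaussian)"
      by (rule integral_gauss_bump_diagonal) (use A in auto)
    also have "\<dots> = (\<Prod>m<3. \<Prod>j\<in>A. \<integral>z. exp (- (cmod (\<tau> * z - \<tau> * target m))\<^sup>2) \<partial>complex_gaussian)"
      by (subst prod.cartesian_product) (simp add: case_prod_beta')
    finally show ?thesis by (simp add: bump_mass_def prod_power_distrib)
  qed
  finally show ?thesis .
qed

lemma phase_vec_frame:
  assumes "1 \<le> d" "\<alpha> \<in> exponents d"
  shows "phase_vec p d (frame y1 y2 d 0) \<theta> \<alpha> = taylor_vec p y1 y2 d \<theta> 0 0 \<alpha>"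
    "phase_vec p d (frame y1 y2 d 1) \<theta> \<alpha> = taylor_vec p y1 y2 d \<theta> 1 0 \<alpha>"
    "phase_vec p d (frame y1 y2 d 2) \<theta> \<alpha> = taylor_vec p y1 y2 d \<theta> 0 1 \<alpha>"
proof -
  have "real_form (\<lambda>_. 1 / sqrt d) \<alpha> / sqrt d = 1"
    unfolding real_form_const[OF assms(2)] using assms(1) by simp
  then show "phase_vec p d (frame y1 y2 d 0) \<theta> \<alpha> = taylor_vec p y1 y2 d \<theta> 0 0 \<alpha>"
    by (simp add: phase_vec_def taylor_vec_def frame_def)
qed (simp_all add: phase_vec_def taylor_vec_def frame_def)

text \<open>Contrapositive of \<open>exp_sum_has_zero\<close>: without a zero and with tame Taylor
  coefficients, one of the three functionals misses its target by at least 1/(4N), which bounds the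
  bump.\<close>

lemma site_bump_small:
  fixes N :: nat
  assumes d: "1 \<le> d" and N: "16 \<le> N" and \<tau>: "0 \<le> \<tau>"
    and a: "a \<in> space (iid_gaussian (exponents d))" "a \<notin> rough_event p y1 y2 d (site j) (real N / 512)"
    and nz: "\<And>\<theta>. (\<Sum>\<alpha>\<in>exponents d. a \<alpha> * (multinom_weight p d \<alpha> * exp (\<i> * complex_of_real (real_form \<theta> \<alpha>)))) \<noteq> 0"
  shows "site_bump p y1 y2 d \<tau> {j} a \<le> exp (- (\<tau>\<^sup>2 / (16 * (real N)\<^sup>2)))"
proof (rule ccontr)
  assume "\<not> site_bump p y1 y2 d \<tau> {j} a \<le> exp (- (\<tau>\<^sup>2 / (16 * (real N)\<^sup>2)))"
  then have big: "exp (- (\<tau>\<^sup>2 / (16 * (real N)\<^sup>2))) < site_bump p y1 y2 d \<tau> {j} a" by simp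
  define V where "V m = (\<Sum>\<alpha>\<in>exponents d. a \<alpha> * phase_vec p d (frame y1 y2 d m) (site j) \<alpha>)" for m
  have "site_bump p y1 y2 d \<tau> {j} a = exp (- (\<Sum>k\<in>{..<3} \<times> {j}. (\<tau> * cmod (V (fst k) - target (fst k)))\<^sup>2))"
    unfolding site_bump_def gauss_bump_def
  proof (intro arg_cong[where f = "\<lambda>x. exp (- x)"] sum.cong refl arg_cong[where f = "\<lambda>x. x\<^sup>2"])
    fix k assume k: "k \<in> {..<3::nat} \<times> {j}"
    have "(\<Sum>i\<in>exponents d. a i * (case k of (m, j) \<Rightarrow> \<lambda>\<alpha>. complex_of_real \<tau> * phase_vec p d (frame y1 y2 d m) (site j) \<alpha>) i) -
       (case k of (m, j) \<Rightarrow> complex_of_real \<tau> * target m) = complex_of_real \<tau> * (V (fst k) - target (fst k))"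
      using k by (auto simp: V_def sum_distrib_left right_diff_distrib mult_ac)
    then show "cmod ((\<Sum>i\<in>exponents d. a i * (case k of (m, j) \<Rightarrow> \<lambda>\<alpha>. complex_of_real \<tau> * phase_vec p d (frame y1 y2 d m) (site j) \<alpha>) i) -
       (case k of (m, j) \<Rightarrow> complex_of_real \<tau> * target m)) = \<tau> * cmod (V (fst k) - target (fst k))"
      using \<tau> by (simp add: norm_mult)
  qed
  then have sum_less: "(\<Sum>k\<in>{..<3::nat} \<times> {j}. (\<tau> * cmod (V (fst k) - target (fst k)))\<^sup>2) < \<tau>\<^sup>2 / (16 * (real N)\<^sup>2)"
    using big by simp
  have close: "cmod (V m - target m) \<le> (1 / real N) / 4" if "m < 3" for m
  proof -
    have "(\<tau> * cmod (V (fst (m, j)) - target (fst (m, j))))\<^sup>2 \<le> (\<Sum>k\<in>{..<3::nat} \<times> {j}. (\<tau> * cmod (V (fst k) - target (fst k)))\<^sup>2)"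
      using that by (intro member_le_sum) auto
    with sum_less have *: "\<tau>\<^sup>2 * (cmod (V m - target m))\<^sup>2 < \<tau>\<^sup>2 * (1 / (16 * (real N)\<^sup>2))"
      by (simp add: power_mult_distrib)
    then have "0 < \<tau>\<^sup>2" by (cases "\<tau> = 0") auto
    with * have "(cmod (V m - target m))\<^sup>2 < 1 / (16 * (real N)\<^sup>2)" by (simp only: mult_less_cancel_left_pos)
    also have "\<dots> = (1 / real N / 4)\<^sup>2" by (simp add: power_divide power2_eq_square)
    finally have "cmod (V m - target m) < 1 / real N / 4" by (rule power2_less_imp_less) simp
    then show ?thesis by simp
  qed
  define c where "c \<alpha> = a \<alpha> * (multinom_weight p d \<alpha> * exp (\<i> * complex_of_real (real_form (site j) \<alpha>)))" for \<alpha>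
  define x where "x \<alpha> = real_form y1 \<alpha> / sqrt d" for \<alpha>
  define y where "y \<alpha> = real_form y2 \<alpha> / sqrt d" for \<alpha>
  have Y: "(\<Sum>\<alpha>\<in>exponents d. c \<alpha> * complex_of_real (x \<alpha> ^ k * y \<alpha> ^ l)) = (\<Sum>\<alpha>\<in>exponents d. a \<alpha> * taylor_vec p y1 y2 d (site j) k l \<alpha>)" for k l
    by (simp add: c_def x_def y_def taylor_vec_def mult_ac)
  have V: "V 0 = (\<Sum>\<alpha>\<in>exponents d. a \<alpha> * taylor_vec p y1 y2 d (site j) 0 0 \<alpha>)"
    "V 1 = (\<Sum>\<alpha>\<in>exponents d. a \<alpha> * taylor_vec p y1 y2 d (site j) 1 0 \<alpha>)"
    "V 2 = (\<Sum>\<alpha>\<in>exponents d. a \<alpha> * taylor_vec p y1 y2 d (site j) 0 1 \<alpha>)"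
    unfolding V_def by (rule sum.cong[OF refl], simp only: phase_vec_frame[OF d])+
  have tg: "target 1 = - \<i>" "target 2 = 1" by (simp_all add: target_def)
  have N0: "0 < real N" "1 / real N \<le> 1 / 16" "1 / real N / 4 \<le> 1 / 4" using N by (auto simp: field_simps)
  \<comment> \<open>With radius 1/N and K = N/512 the condition 512 * K * \<open>\<rho>\<close>
    \<le> 1 holds with equality.\<close>
  have "\<exists>s. (\<Sum>\<alpha>\<in>exponents d. c \<alpha> * exp (\<i> * complex_of_real (x \<alpha> * Re s + y \<alpha> * Im s))) = 0"
  proof (rule exp_sum_has_zero[where \<rho> = "1 / real N" and K = "real N / 512"], unfold Y)
    fix k l
    have "\<forall>n. \<forall>k\<le>n. \<not> real N / 512 * 4 ^ n * fact k * fact (n - k) \<le> cmod (\<Sum>\<alpha>\<in>exponents d. a \<alpha> * taylor_vec p y1 y2 d (site j) k (n - k) \<alpha>)"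
      using a unfolding rough_event_def by blast
    from this[rule_format, of k "k + l"]
    show "cmod (\<Sum>\<alpha>\<in>exponents d. a \<alpha> * taylor_vec p y1 y2 d (site j) k l \<alpha>) \<le> real N / 512 * 4 ^ (k + l) * fact k * fact l"
      by simp
  next
    show "cmod (\<Sum>\<alpha>\<in>exponents d. a \<alpha> * taylor_vec p y1 y2 d (site j) 0 0 \<alpha>) \<le> 1 / real N / 4"
      using close[of 0] by (simp add: V target_def)
    show "cmod ((\<Sum>\<alpha>\<in>exponents d. a \<alpha> * taylor_vec p y1 y2 d (site j) 1 0 \<alpha>) + \<i>) \<le> 1 / 4"
      using order_trans[OF close N0(3), of 1] unfolding V tg by simp
    show "cmod ((\<Sum>\<alpha>\<in>exponents d. a \<alpha> * taylor_vec p y1 y2 d (site j) 0 1 \<alpha>) - 1) \<le> 1 / 4"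
      using order_trans[OF close N0(3), of 2] unfolding V tg by simp
  qed (use N0 in auto)
  then obtain s where s: "(\<Sum>\<alpha>\<in>exponents d. c \<alpha> * exp (\<i> * complex_of_real (x \<alpha> * Re s + y \<alpha> * Im s))) = 0" by blast
  \<comment> \<open>The point of the torus with local coordinates \<open>s\<close> at scale 1 / sqrt
    d around the site.\<close>
  define \<theta> where "\<theta> k = site j k + (Re s / sqrt d * y1 k + Im s / sqrt d * y2 k)" for k
  have "c \<alpha> * exp (\<i> * complex_of_real (x \<alpha> * Re s + y \<alpha> * Im s)) = a \<alpha> * (multinom_weight p d \<alpha> * exp (\<i> * complex_of_real (real_form \<theta> \<alpha>)))" for \<alpha>
  proof -
    have "real_form \<theta> \<alpha> = real_form (site j) \<alpha> + (x \<alpha> * Re s + y \<alpha> * Im s)"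
      unfolding \<theta>_def real_form_add real_form_scale x_def y_def by (simp add: mult.commute)
    then show ?thesis unfolding c_def by (simp add: distrib_left exp_add)
  qed
  then show False using s nz[of \<theta>] by simp
qed

text \<open>The bound of \<open>second_moment_event\<close>, divided by the squared mean, tends as
  \<open>d\<close> grows to a variance part of order 1/(L m) and an error part
  ((\<open>\<epsilon>\<close>)^2 + \<open>\<delta>\<close>)/m^2. The error part is made small by the
  choice of \<open>N\<close>, and then the variance part by the number \<open>L\<close> of
  sites.\<close>

lemma no_zero_prob_tendsto:
  assumes on: "orthonormal_frame p y1 y2"
    and E: "\<And>d. E d \<in> sets (iid_gaussian (exponents d))"
    and nz: "\<And>d a \<theta>. a \<in> E d \<Longrightarrow> (\<Sum>\<alpha>\<in>exponents d. a \<alpha> * (multinom_weight p d \<alpha> * exp (\<i> * complex_of_real (real_form \<theta> \<alpha>)))) \<noteq> 0"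
  shows "(\<lambda>d. measure (iid_gaussian (exponents d)) (E d)) \<longlonglongrightarrow> 0"
proof (rule order_tendstoI)
  fix \<eta> :: real assume \<eta>: "\<eta> < 0"
  show "\<forall>\<^sub>F d in sequentially. \<eta> < measure (iid_gaussian (exponents d)) (E d)"
    using \<eta> by (intro always_eventually allI) (meson less_le_trans measure_nonneg)
next
  fix \<eta> :: real assume \<eta>: "0 < \<eta>"
  \<comment> \<open>Solves N/512 = 4 * exp 2 * (c * N), so that the Taylor bound needed for
    Brouwer's theorem has the form required by \<open>rough_event_prob\<close>.\<close>
  define c where "c = 1 / (2048 * exp (2::real))"
  have c: "0 < c" by (simp add: c_def)
  define \<epsilon> where "\<epsilon> N = exp (- ((real N)\<^sup>2 / 16))" for N
  define \<delta> where "\<delta> N = 8 * exp (1 / 4) * exp (- (c * real N))" for N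
  define m where "m N = bump_mass ((real N)\<^sup>2)" for N
  define b where "b N = (exp (- 11) / ((real N)\<^sup>2)\<^sup>2 / pi) ^ 3" for N
  have "(\<lambda>N::nat. 3 * ((exp (- ((real N)\<^sup>2 / 16)))\<^sup>2 + 8 * exp (1 / 4) * exp (- (c * real N))) / ((exp (- 11) / ((real N)\<^sup>2)\<^sup>2 / pi) ^ 3)\<^sup>2) \<longlonglongrightarrow> 0"
    using c by real_asymp
  then have "(\<lambda>N. 3 * ((\<epsilon> N)\<^sup>2 + \<delta> N) / (b N)\<^sup>2) \<longlonglongrightarrow> 0" unfolding \<epsilon>_def \<delta>_def b_def .
  then have "\<forall>\<^sub>F N in sequentially. 3 * ((\<epsilon> N)\<^sup>2 + \<delta> N) / (b N)\<^sup>2 < \<eta> / 2" using \<eta> by (intro order_tendstoD(2)) auto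
  moreover have "\<forall>\<^sub>F N in sequentially. ln 4 \<le> c * real N" using c by real_asymp
  moreover have "\<forall>\<^sub>F N in sequentially. (16::nat) \<le> N" by (rule eventually_ge_at_top)
  ultimately have "\<forall>\<^sub>F N in sequentially. 3 * ((\<epsilon> N)\<^sup>2 + \<delta> N) / (b N)\<^sup>2 < \<eta> / 2 \<and> ln 4 \<le> c * real N \<and> 16 \<le> N"
    by eventually_elim auto
  then obtain N where N: "3 * ((\<epsilon> N)\<^sup>2 + \<delta> N) / (b N)\<^sup>2 < \<eta> / 2" "ln 4 \<le> c * real N" "16 \<le> N"
    unfolding eventually_sequentially by blast
  \<comment> \<open>Large enough to make the bump leak exp (- N^2 / 16) at distance 1/(4N), yet
    polynomial in N, so that the lower bound \<open>b N\<close> is polynomial too.\<close>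
  define \<tau> where "\<tau> = (real N)\<^sup>2"
  have \<tau>1: "1 \<le> \<tau>" unfolding \<tau>_def using N(3) by simp
  have b0: "0 < b N" unfolding b_def using N(3) by simp
  have mb: "b N \<le> m N" unfolding b_def m_def using bump_mass_ge[OF \<tau>1] by (simp add: \<tau>_def)
  then have m0: "0 < m N" using b0 by linarith
  have \<epsilon>\<delta>0: "0 \<le> \<epsilon> N" "0 \<le> \<delta> N" by (auto simp: \<epsilon>_def \<delta>_def)
  have main: "3 * ((\<epsilon> N)\<^sup>2 + \<delta> N) / (m N)\<^sup>2 < \<eta> / 2"
  proof -
    have "3 * ((\<epsilon> N)\<^sup>2 + \<delta> N) / (m N)\<^sup>2 \<le> 3 * ((\<epsilon> N)\<^sup>2 + \<delta> N) / (b N)\<^sup>2"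
      using \<epsilon>\<delta>0 b0 mb by (intro divide_left_mono power_mono mult_pos_pos) auto
    then show ?thesis using N(1) by linarith
  qed
  obtain L :: nat where L: "0 < L" "3 / (real L * m N) < \<eta> / 2"
  proof -
    have "(\<lambda>L. 3 / m N * (1 / real L)) \<longlonglongrightarrow> 3 / m N * 0" by (intro tendsto_intros lim_1_over_n)
    then have "\<forall>\<^sub>F L in sequentially. 3 / m N * (1 / real L) < \<eta> / 2" using \<eta> by (intro order_tendstoD(2)) auto
    moreover have "\<forall>\<^sub>F L in sequentially. (0::nat) < L" by (rule eventually_gt_at_top)
    ultimately have "\<forall>\<^sub>F L in sequentially. 3 / m N * (1 / real L) < \<eta> / 2 \<and> 0 < L" by eventually_elim auto
    then obtain L where "3 / m N * (1 / real L) < \<eta> / 2" "0 < L" unfolding eventually_sequentially by blast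
    then show ?thesis by (intro that[of L]) (auto simp: mult.commute)
  qed
  have L0: "0 < real L" using L by simp
  define X where "X A d = (\<integral>a. site_bump p y1 y2 d \<tau> A a \<partial>iid_gaussian (exponents d))" for A d
  define R where "R d = 3 * ((\<Sum>i<L. \<Sum>j<L. X {i, j} d) / (real L)\<^sup>2 - 2 * m N * (\<Sum>j<L. X {j} d) / real L + (m N)\<^sup>2 + (\<epsilon> N)\<^sup>2 + \<delta> N)" for d
  have X: "(\<lambda>d. X A d) \<longlonglongrightarrow> m N ^ card A" if "finite A" for A
    using expectation_site_bump_tendsto[OF on that, of \<tau>] unfolding X_def m_def \<tau>_def .
  have "(\<lambda>d. R d) \<longlonglongrightarrow> 3 * ((\<Sum>i<L. \<Sum>j<L. m N ^ card {i, j}) / (real L)\<^sup>2 - 2 * m N * (\<Sum>j<L. m N ^ card {j}) / real L + (m N)\<^sup>2 + (\<epsilon> N)\<^sup>2 + \<delta> N)"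
    unfolding R_def using L0 by (intro tendsto_intros X) auto
  also have "3 * ((\<Sum>i<L. \<Sum>j<L. m N ^ card {i, j}) / (real L)\<^sup>2 - 2 * m N * (\<Sum>j<L. m N ^ card {j}) / real L + (m N)\<^sup>2 + (\<epsilon> N)\<^sup>2 + \<delta> N)
     = 3 * ((m N - (m N)\<^sup>2) / real L + (\<epsilon> N)\<^sup>2 + \<delta> N)"
  proof -
    \<comment> \<open>Distinct sites are independent in the limit and contribute m^2 per pair; only
      the L diagonal pairs contribute m.\<close>
    have "(\<Sum>i<L. \<Sum>j<L. m N ^ card {i, j}) = (\<Sum>i<L. \<Sum>j<L. (m N)\<^sup>2 + (if j = i then m N - (m N)\<^sup>2 else 0))"
      by (intro sum.cong refl) (auto simp: power2_eq_square)
    also have "\<dots> = (real L)\<^sup>2 * (m N)\<^sup>2 + real L * (m N - (m N)\<^sup>2)"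
      by (simp add: sum.distrib power2_eq_square algebra_simps)
    finally have s: "(\<Sum>i<L. \<Sum>j<L. m N ^ card {i, j}) / (real L)\<^sup>2 = (m N)\<^sup>2 + (m N - (m N)\<^sup>2) / real L"
      using L0 by (simp add: add_divide_distrib power2_eq_square)
    show ?thesis unfolding s using L0 by (simp add: power2_eq_square)
  qed
  finally have R: "(\<lambda>d. R d / (m N)\<^sup>2) \<longlonglongrightarrow> 3 * ((m N - (m N)\<^sup>2) / real L + (\<epsilon> N)\<^sup>2 + \<delta> N) / (m N)\<^sup>2"
    using m0 by (intro tendsto_divide tendsto_const) auto
  have "3 * ((m N - (m N)\<^sup>2) / real L + (\<epsilon> N)\<^sup>2 + \<delta> N) / (m N)\<^sup>2 = 3 * ((m N - (m N)\<^sup>2) / real L) / (m N)\<^sup>2 + 3 * ((\<epsilon> N)\<^sup>2 + \<delta> N) / (m N)\<^sup>2"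
    by (simp add: add_divide_distrib distrib_left add.assoc)
  also have "3 * ((m N - (m N)\<^sup>2) / real L) / (m N)\<^sup>2 \<le> 3 * (m N / real L) / (m N)\<^sup>2"
    using L0 by (intro divide_right_mono mult_left_mono) auto
  also have "3 * (m N / real L) / (m N)\<^sup>2 = 3 / (real L * m N)" using m0 by (simp add: power2_eq_square)
  finally have "3 * ((m N - (m N)\<^sup>2) / real L + (\<epsilon> N)\<^sup>2 + \<delta> N) / (m N)\<^sup>2 < \<eta>" using main L(2) by linarith
  then have "\<forall>\<^sub>F d in sequentially. R d / (m N)\<^sup>2 < \<eta>" by (rule order_tendstoD(2)[OF R])
  moreover have "\<forall>\<^sub>F d in sequentially. 1 \<le> (d::nat)" by (rule eventually_ge_at_top)
  moreover have "\<forall>\<^sub>F d in sequentially. \<forall>k. \<bar>y1 k\<bar> + \<bar>y2 k\<bar> \<le> sqrt (real d) / 2"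
    by (intro eventually_all_finite) real_asymp
  ultimately show "\<forall>\<^sub>F d in sequentially. measure (iid_gaussian (exponents d)) (E d) < \<eta>"
  proof eventually_elim
    case (elim d)
    interpret G: prob_space "iid_gaussian (exponents d)" by (rule prob_space_iid_gaussian)
    have rough: "rough_event p y1 y2 d (site j) (real N / 512) \<in> G.events"
      "G.prob (rough_event p y1 y2 d (site j) (real N / 512)) \<le> \<delta> N" for j
    proof -
      have K: "real N / 512 = 4 * exp 2 * (c * real N)" by (simp add: c_def)
      show "rough_event p y1 y2 d (site j) (real N / 512) \<in> G.events"
        "G.prob (rough_event p y1 y2 d (site j) (real N / 512)) \<le> \<delta> N"
        using rough_event_prob[OF on elim(2) _ N(2) K] elim(3) unfolding \<delta>_def by auto
    qed
    have small: "site_bump p y1 y2 d \<tau> {j} a \<le> \<epsilon> N" if "a \<in> E d" "a \<notin> rough_event p y1 y2 d (site j) (real N / 512)" for j a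
    proof -
      have "site_bump p y1 y2 d \<tau> {j} a \<le> exp (- (\<tau>\<^sup>2 / (16 * (real N)\<^sup>2)))"
        using that sets.sets_into_space[OF E[of d]] \<tau>1 by (intro site_bump_small[OF elim(2) N(3)] nz[OF that(1)]) auto
      also have "\<tau>\<^sup>2 / (16 * (real N)\<^sup>2) = (real N)\<^sup>2 / 16" using N(3) by (simp add: \<tau>_def power2_eq_square)
      finally show ?thesis by (simp add: \<epsilon>_def)
    qed
    have "(m N)\<^sup>2 * G.prob (E d) \<le> 3 * ((\<Sum>i<L. \<Sum>j<L. G.expectation (\<lambda>a. site_bump p y1 y2 d \<tau> {i} a * site_bump p y1 y2 d \<tau> {j} a)) / (real L)\<^sup>2
       - 2 * m N * (\<Sum>j<L. G.expectation (site_bump p y1 y2 d \<tau> {j})) / real L + (m N)\<^sup>2 + (\<epsilon> N)\<^sup>2 + \<delta> N)"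
      by (rule G.second_moment_event[OF L(1) \<epsilon>\<delta>0(1) less_imp_le[OF m0] measurable_site_bump site_bump_bounds E rough small])
    also have "\<dots> \<le> R d"
    proof -
      \<comment> \<open>On the diagonal the square of a bump is at most the bump, whose expectation
        is \<open>X {i, i} d\<close> because the set \<open>{i, i}\<close> is a singleton.\<close>
      have "G.expectation (\<lambda>a. site_bump p y1 y2 d \<tau> {i} a * site_bump p y1 y2 d \<tau> {j} a) \<le> X {i, j} d" for i j
      proof (cases "i = j")
        case True
        have int: "integrable (iid_gaussian (exponents d)) (site_bump p y1 y2 d \<tau> {i})"
          using site_bump_bounds by (intro G.integrable_const_bound[where B=1]) auto
        have "G.expectation (\<lambda>a. site_bump p y1 y2 d \<tau> {i} a * site_bump p y1 y2 d \<tau> {i} a) \<le> G.expectation (site_bump p y1 y2 d \<tau> {i})"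
          using site_bump_bounds by (intro integral_mono_AE' int AE_I2) (auto simp: mult_left_le)
        then show ?thesis using True by (simp add: X_def)
      next
        case False
        then show ?thesis by (simp add: X_def site_bump_mult)
      qed
      then have "(\<Sum>i<L. \<Sum>j<L. G.expectation (\<lambda>a. site_bump p y1 y2 d \<tau> {i} a * site_bump p y1 y2 d \<tau> {j} a)) / (real L)\<^sup>2
         \<le> (\<Sum>i<L. \<Sum>j<L. X {i, j} d) / (real L)\<^sup>2"
        by (intro divide_right_mono sum_mono) auto
      then show ?thesis unfolding R_def X_def by simp
    qed
    finally have "G.prob (E d) \<le> R d / (m N)\<^sup>2" using m0 by (simp add: field_simps)
    then show ?case using elim(1) by linarith
  qed
qed

text \<open>On the torus over \<open>t\<close> the variance of the monomial with exponent \<alpha>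
  is r^(2\<alpha>) divided by its squared norm. Normalised over all exponents, this is the
  multinomial law with step probabilities \<open>p\<close>, so missing the torus is the event
  treated by \<open>no_zero_prob_tendsto\<close>.\<close>

lemma hit_prob_tendsto: "(\<lambda>d. hit_prob d t) \<longlonglongrightarrow> 1"
proof -
  define r :: "3 \<Rightarrow> real" where "r k = (if k = 1 then 1 else if k = 2 then exp (fst t) else exp (snd t))" for k
  have r: "0 < r k" for k by (simp add: r_def)
  define Q where "Q = (\<Sum>k\<in>UNIV. (r k)\<^sup>2)"
  have Q: "0 < Q" unfolding Q_def by (intro sum_pos zero_less_power r) auto
  define p where "p k = (r k)\<^sup>2 / Q" for k
  have p: "0 < p k" "(\<Sum>k\<in>UNIV. p k) = 1" for k
    using r[of k] Q by (auto simp: p_def sum_divide_distrib[symmetric] Q_def[symmetric])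
  obtain y1 y2 where on: "orthonormal_frame p y1 y2" using orthonormal_frame_exists[OF p] by blast
  define M where "M d = {P \<in> space (gaussian_polys d). t \<in> amoeba d P}" for d
  define E where "E d = scale_coeffs d -` (space (gaussian_polys d) - M d) \<inter> space (iid_gaussian (exponents d))" for d
  have sc: "scale_coeffs d \<in> measurable (iid_gaussian (exponents d)) (gaussian_polys d)" for d
    using measurable_scale_coeffs by (simp add: measurable_cong_sets[OF refl sets_gaussian_polys])
  have Msets: "M d \<in> sets (gaussian_polys d)" for d unfolding M_def by (rule sets_hit_event)
  have E: "E d \<in> sets (iid_gaussian (exponents d))" for d
    unfolding E_def using Msets by (intro measurable_sets[OF sc]) auto
  \<comment> \<open>The positive constant is the root of the total variance Q^d (d + 2)!/(2 d!) of
    the polynomial at a point of the torus; it does not affect zeros.\<close>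
  have zero: "poly_eval d (scale_coeffs d a) (\<chi> k. complex_of_real (r k) * exp (\<i> * complex_of_real (\<theta> k))) =
      complex_of_real (sqrt (fact (d + 2) / (2 * fact d) * Q ^ d)) * (\<Sum>\<alpha>\<in>exponents d. a \<alpha> * (multinom_weight p d \<alpha> * exp (\<i> * complex_of_real (real_form \<theta> \<alpha>))))" for d a \<theta>
    unfolding poly_eval_def sum_distrib_left
  proof (rule sum.cong[OF refl])
    fix \<alpha> assume \<alpha>: "\<alpha> \<in> exponents d"
    define F :: real where "F = (\<Prod>k\<in>UNIV. fact (\<alpha> $ k))"
    define S where "S = (\<Prod>k\<in>UNIV. r k ^ (\<alpha> $ k))"
    have F: "0 < F" unfolding F_def by (intro prod_pos) simp
    have S: "0 < S" unfolding S_def using r by (intro prod_pos) simp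
    have mono: "(\<Prod>k\<in>UNIV. ((\<chi> k. complex_of_real (r k) * exp (\<i> * complex_of_real (\<theta> k))) $ k) ^ (\<alpha> $ k)) =
       complex_of_real S * exp (\<i> * complex_of_real (real_form \<theta> \<alpha>))"
      unfolding S_def real_form_def of_real_sum sum_distrib_left exp_sum[OF finite]
      by (simp add: power_mult_distrib prod.distrib exp_of_nat_mult[symmetric] mult_ac)
    have pp: "(\<Prod>k\<in>UNIV. p k ^ (\<alpha> $ k)) = S\<^sup>2 / Q ^ d"
    proof -
      have "(\<Prod>k\<in>UNIV. Q ^ (\<alpha> $ k)) = Q ^ d"
        using \<alpha> unfolding exponents_def mem_Collect_eq by (simp only: power_sum[symmetric])
      then show ?thesis
        by (simp add: p_def power_divide prod_dividef S_def prod_power_distrib power_mult[symmetric] mult.commute)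
    qed
    have "sqrt (fact (d + 2) / (2 * fact d) * Q ^ d) * multinom_weight p d \<alpha> = S / sqrt (monomial_normsq d \<alpha>)"
    proof -
      have "sqrt (fact (d + 2) / (2 * fact d) * Q ^ d) * multinom_weight p d \<alpha>
         = sqrt (fact (d + 2) / (2 * fact d) * Q ^ d * (fact d / F * (S\<^sup>2 / Q ^ d)))"
        unfolding multinom_weight_def pp F_def by (simp only: real_sqrt_mult)
      also have "fact (d + 2) / (2 * fact d) * Q ^ d * (fact d / F * (S\<^sup>2 / Q ^ d)) = S\<^sup>2 / monomial_normsq d \<alpha>"
        unfolding monomial_normsq_def F_def[symmetric] using Q F by (simp add: field_simps)
      also have "sqrt \<dots> = S / sqrt (monomial_normsq d \<alpha>)" using S by (simp add: real_sqrt_divide)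
      finally show ?thesis .
    qed
    then have c: "complex_of_real (sqrt (fact (d + 2) / (2 * fact d) * Q ^ d)) * complex_of_real (multinom_weight p d \<alpha>) =
      complex_of_real S / complex_of_real (sqrt (monomial_normsq d \<alpha>))"
      by (simp only: of_real_mult[symmetric] of_real_divide[symmetric])
    show "scale_coeffs d a \<alpha> * (\<Prod>k\<in>UNIV. ((\<chi> k. complex_of_real (r k) * exp (\<i> * complex_of_real (\<theta> k))) $ k) ^ (\<alpha> $ k)) =
       complex_of_real (sqrt (fact (d + 2) / (2 * fact d) * Q ^ d)) * (a \<alpha> * (multinom_weight p d \<alpha> * exp (\<i> * complex_of_real (real_form \<theta> \<alpha>))))"
    proof -
      let ?E = "exp (\<i> * complex_of_real (real_form \<theta> \<alpha>))" and ?C = "complex_of_real (sqrt (fact (d + 2) / (2 * fact d) * Q ^ d))"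
      have "scale_coeffs d a \<alpha> * (complex_of_real S * ?E) = ?C * complex_of_real (multinom_weight p d \<alpha>) * (a \<alpha> * ?E)"
        unfolding c using \<alpha> by (simp add: scale_coeffs_def)
      also have "\<dots> = ?C * (a \<alpha> * (complex_of_real (multinom_weight p d \<alpha>) * ?E))" by (simp only: mult_ac)
      finally show ?thesis unfolding mono .
    qed
  qed
  have nz: "(\<Sum>\<alpha>\<in>exponents d. a \<alpha> * (multinom_weight p d \<alpha> * exp (\<i> * complex_of_real (real_form \<theta> \<alpha>)))) \<noteq> 0" if a: "a \<in> E d" for d a \<theta>
  proof
    assume "(\<Sum>\<alpha>\<in>exponents d. a \<alpha> * (multinom_weight p d \<alpha> * exp (\<i> * complex_of_real (real_form \<theta> \<alpha>)))) = 0"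
    then have "poly_eval d (scale_coeffs d a) (\<chi> k. complex_of_real (r k) * exp (\<i> * complex_of_real (\<theta> k))) = 0"
      unfolding zero by (simp only: mult_zero_right)
    then have "t \<in> amoeba d (scale_coeffs d a)"
      by (intro mem_amoebaI[of "\<chi> k. complex_of_real (r k) * exp (\<i> * complex_of_real (\<theta> k))"]) (simp_all add: r_def norm_mult)
    moreover have "scale_coeffs d a \<in> space (gaussian_polys d)" "scale_coeffs d a \<notin> M d" using a unfolding E_def by auto
    ultimately show False unfolding M_def by simp
  qed
  have "measure (iid_gaussian (exponents d)) (E d) = 1 - hit_prob d t" for d
  proof -
    interpret g: prob_space "gaussian_polys d" by (rule prob_space_gaussian_polys)
    have "measure (iid_gaussian (exponents d)) (E d) = measure (distr (iid_gaussian (exponents d)) (gaussian_polys d) (scale_coeffs d)) (space (gaussian_polys d) - M d)"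
      unfolding E_def using Msets[of d] by (subst measure_distr[OF sc]) auto
    also have "distr (iid_gaussian (exponents d)) (gaussian_polys d) (scale_coeffs d) = gaussian_polys d"
      by (subst (2) gaussian_polys_eq, rule distr_cong) (simp_all add: sets_gaussian_polys)
    also have "measure (gaussian_polys d) (space (gaussian_polys d) - M d) = 1 - hit_prob d t"
      using g.prob_compl[OF Msets[of d]] by (simp add: hit_prob_def M_def)
    finally show ?thesis .
  qed
  then have "(\<lambda>d. 1 - hit_prob d t) \<longlonglongrightarrow> 0" using no_zero_prob_tendsto[OF on E nz] by simp
  from tendsto_diff[OF tendsto_const this, of 1] show ?thesis by simp
qed

theorem corollary5p10:
  fixes \<phi> :: "real \<times> real \<Rightarrow> real"
  assumes "continuous_on UNIV \<phi>"
    and "compact (closure {t. \<phi> t \<noteq> 0})"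
  shows "(\<lambda>d. \<integral>t. \<phi> t \<partial>expected_amoeba_measure d) \<longlonglongrightarrow> (\<integral>t. \<phi> t \<partial>lborel)"
  by (rule expected_amoeba_measure_tendsto[OF hit_prob_tendsto assms])

end
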